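(* Let $f_t$, $t\in[0,1]$, be a continuous family of germs at $(\mathbb{C}^2,0)$ of quasi-homogeneous (and not homogeneous) functions with isolated singularity and constant Henry-Parusiński invariant. Then $f_t$ is analytically trivial.
   Context: Two germs $f,g\in\mathcal{O}_2$ of holomorphic functions at $(\mathbb{C}^2,0)$ are analytically equivalent if $g=f\circ\Phi$ for some germ of biholomorphism $\Phi\in\operatorname{Diff}(\mathbb{C}^2,0)$. The family is analytically trivial when all its members $f_t$ lie in the same analytic equivalence class. A germ is quasi-homogeneous if it is analytically equivalent to a quasi-homogeneous polynomial $\sum_{ai+bj=d}a_{ij}x^iy^j$, $a,b,d\in\mathbb{N}$. Up to permuting variables, a reduced (i.e. isolated singularity) quasi-homogeneous polynomial can be written $x^my^k\prod_{j=1}^n(y^p-\lambda_jx^q)$ with $m,k\in\{0,1\}$, $p\le q$, $\gcd(p,q)=1$ and $\lambda_j\in\mathbb{C}^*$ pairwise distinct; its commode part is the case $k=m=0$. It is assumed throughout that $f$ is miniregular in $y$, i.e. $x=0$ is not a line of the tangent cone of $(f=0)$, and (as bi-Lipschitz equivalence of reduced quasi-homogeneous germs is equivalent to that of their commode parts) one works with commode polynomials $f_\lambda(x,y)=\prod_{j=1}^n(y^p-\lambda_jx^q)$, $1\le p<q$, $\gcd(p,q)=1$, those with given $p,q$ and quasi-homogeneous degree $d=npq$ forming the set $H_{p,q}^d$. Henry-Parusiński invariant: to each polar arc $\gamma$ (a Puiseux-parametrised branch of $\partial_yf=0$) tangent to a singular line of the tangent cone of $f=0$, associate $h\in\mathbb{Q}_+$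 and $c\in\mathbb{C}^*$ by $f(\gamma(s))=cs^h+\cdots$, $c\ne0$. For quasi-homogeneous $f$ the exponents are determined by the weights and the invariant is the set of coefficients modulo $\mathbb{C}^*$. Explicitly for $f_\lambda$: let $Q_\lambda(t)=\prod_{j=1}^n(t-\lambda_j)$ with critical points $\kappa_1,\dots,\kappa_{n-1}$, of which $\kappa_1,\dots,\kappa_r$ are the nonzero ones. The polar arcs are $\gamma_\ell(s)=(s^p,\alpha_\ell s^q)$, $\alpha_\ell^p=\kappa_\ell$, $1\le\ell\le r$, and also $\gamma_0(s)=(s,0)$ if $p>1$; $c_\ell$ is the leading coefficient of $f_\lambda(\gamma_\ell(s))$, so $c_\ell=\prod_{j=1}^n(\kappa_\ell-\lambda_j)$ for $\ell\ge1$ and $c_0=(-1)^n\lambda_1\cdots\lambda_n$. If $p>1$, the invariant is $\{c_0,c_1,\dots,c_r\}$, where two sets define the same invariant if $\{c_0',c_1',\dots,c_r'\}=\{c_0\xi^{qn},c_1\xi^{pqn},\dots,c_r\xi^{pqn}\}$ for some $\xi\in\mathbb{C}^*$. If $p=1$, it is $\{c_1,\dots,c_r\}$, where two sets define the same invariant if $\{c_1',\dots,c_r'\}=\{c_1\xi^{qn},\dots,c_r\xi^{qn}\}$ for some $\xi\in\mathbb{C}^*$.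
   Formalization: Weights and degree of the quasi-homogeneous model are the same for all t; the invariant uses all polar arcs (also (s,0) when p=1), exponents taken in x, with the single action c -> c ξ^h. With varying weights or with the printed C*-actions the claim is false. *)

theory Defs
  imports "HOL-Complex_Analysis.Complex_Analysis"
begin

text \<open>
  Germs at the origin of $C^2$ are represented by functions on \<^typ>\<open>complex \<times> complex\<close>;
  every notion below depends only on the values near the origin.
\<close>

definition holomorphic2_on :: "(complex \<times> complex \<Rightarrow> complex) \<Rightarrow> (complex \<times> complex) set \<Rightarrow> bool"
  where "holomorphic2_on f U \<longleftrightarrow>
    (\<forall>z\<in>U. \<exists>a b. (f has_derivative (\<lambda>(u, v). a * u + b * v)) (at z))"

definition biholomorphic_germ :: "(complex \<times> complex \<Rightarrow> complex \<times> complex) \<Rightarrow> bool"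
  where "biholomorphic_germ \<Phi> \<longleftrightarrow> \<Phi> 0 = 0 \<and>
    (\<exists>U V \<Psi>. open U \<and> open V \<and> 0 \<in> U \<and> homeomorphism U V \<Phi> \<Psi> \<and>
      holomorphic2_on (fst \<circ> \<Phi>) U \<and> holomorphic2_on (snd \<circ> \<Phi>) U \<and>
      holomorphic2_on (fst \<circ> \<Psi>) V \<and> holomorphic2_on (snd \<circ> \<Psi>) V)"

definition analytically_equivalent ::
    "(complex \<times> complex \<Rightarrow> complex) \<Rightarrow> (complex \<times> complex \<Rightarrow> complex) \<Rightarrow> bool"
  where "analytically_equivalent f g \<longleftrightarrow>
    (\<exists>\<Phi>. biholomorphic_germ \<Phi> \<and> (\<forall>\<^sub>F z in nhds 0. g z = f (\<Phi> z)))"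

definition continuous_germ_family :: "(real \<Rightarrow> complex \<times> complex \<Rightarrow> complex) \<Rightarrow> bool"
  where "continuous_germ_family f \<longleftrightarrow>
    (\<exists>U. open U \<and> 0 \<in> U \<and> (\<forall>t\<in>{0..1}. holomorphic2_on (f t) U) \<and>
      continuous_on ({0..1} \<times> U) (\<lambda>(t, z). f t z))"

definition analytically_trivial :: "(real \<Rightarrow> complex \<times> complex \<Rightarrow> complex) \<Rightarrow> bool"
  where "analytically_trivial f \<longleftrightarrow>
    (\<forall>s\<in>{0..1}. \<forall>t\<in>{0..1}. analytically_equivalent (f s) (f t))"

definition quasi_homogeneous_poly ::
    "nat \<Rightarrow> nat \<Rightarrow> nat \<Rightarrow> (complex \<times> complex \<Rightarrow> complex) \<Rightarrow> bool"
  where "quasi_homogeneous_poly a b d P \<longleftrightarrow> 0 < a \<and> 0 < b \<and>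
    (\<exists>c. \<forall>x y. P (x, y) = (\<Sum>(i, j)\<in>{(i, j). a * i + b * j = d}. c i j * x ^ i * y ^ j))"

definition quasi_homogeneous_germ ::
    "nat \<Rightarrow> nat \<Rightarrow> nat \<Rightarrow> (complex \<times> complex \<Rightarrow> complex) \<Rightarrow> bool"
  where "quasi_homogeneous_germ a b d f \<longleftrightarrow>
    (\<exists>P. quasi_homogeneous_poly a b d P \<and> analytically_equivalent f P)"

text \<open>No critical points in a punctured neighbourhood; the origin itself may be regular.\<close>

definition isolated_singularity :: "(complex \<times> complex \<Rightarrow> complex) \<Rightarrow> bool"
  where "isolated_singularity f \<longleftrightarrow> (\<forall>\<^sub>F z in at 0. \<not> (f has_derivative (\<lambda>_. 0)) (at z))"

text \<open>
  \<open>F\<close> is the lowest-degree homogeneous part of the Taylor expansion of \<open>f\<close> at the origin, and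
  \<open>\<nu>\<close> is its degree, i.e. the multiplicity of \<open>f\<close>. The tangent cone is the zero set of \<open>F\<close>.
\<close>

definition initial_form ::
    "(complex \<times> complex \<Rightarrow> complex) \<Rightarrow> nat \<Rightarrow> (complex \<times> complex \<Rightarrow> complex) \<Rightarrow> bool"
  where "initial_form f \<nu> F \<longleftrightarrow>
    (\<forall>x y. ((\<lambda>\<tau>. f (\<tau> * x, \<tau> * y) / \<tau> ^ \<nu>) \<longlongrightarrow> F (x, y)) (at 0)) \<and> (\<exists>z. F z \<noteq> 0)"

definition miniregular :: "(complex \<times> complex \<Rightarrow> complex) \<Rightarrow> bool"
  where "miniregular f \<longleftrightarrow> (\<exists>\<nu> F. initial_form f \<nu> F \<and> F (0, 1) \<noteq> 0)"

text \<open>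
  The line $y = mx$ is a singular (i.e. multiple) line of the tangent cone when \<open>F\<close> is critical
  along it. By homogeneity it suffices to test the point $(1,m)$; in degree at least two,
  criticality there also forces \<open>F\<close> to vanish on the line.
\<close>

definition singular_tangent :: "(complex \<times> complex \<Rightarrow> complex) \<Rightarrow> complex \<Rightarrow> bool"
  where "singular_tangent f m \<longleftrightarrow>
    (\<exists>\<nu> F. initial_form f \<nu> F \<and> (F has_derivative (\<lambda>_. 0)) (at (1, m)))"

text \<open>
  A polar arc $\gamma(s) = (s^N, \varphi(s))$, i.e. the Puiseux arc
  $y = \varphi(x^{1/N})$ of $\partial_y f = 0$, tangent at the origin to a singular line of the
  tangent cone. For miniregular \<open>f\<close> all polar arcs are transverse to $x = 0$, hence of this shape
  up to reparametrisation.
\<close>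

definition polar_arc :: "(complex \<times> complex \<Rightarrow> complex) \<Rightarrow> nat \<Rightarrow> (complex \<Rightarrow> complex) \<Rightarrow> bool"
  where "polar_arc f N \<phi> \<longleftrightarrow> 0 < N \<and> \<phi> analytic_on {0} \<and> \<phi> 0 = 0 \<and>
    (\<exists>m. ((\<lambda>s. \<phi> s / s ^ N) \<longlongrightarrow> m) (at 0) \<and> singular_tangent f m) \<and>
    (\<forall>\<^sub>F s in nhds 0. deriv (\<lambda>y. f (s ^ N, y)) (\<phi> s) = 0)"

text \<open>
  The pairs $(h,c)$ with $f = c\,x^h + \cdots$ along a polar arc. Exponents are taken with respect to
  $x = s^N$, so $f(\gamma(s)) = c\,s^k + \cdots$ gives $h = k/N$; this makes arcs with different
  ramification comparable, and $(h,c)$ independent of the choice of a multiple of \<open>N\<close>.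
\<close>

definition henry_parusinski :: "(complex \<times> complex \<Rightarrow> complex) \<Rightarrow> (rat \<times> complex) set"
  where "henry_parusinski f = {(h, c). c \<noteq> 0 \<and>
    (\<exists>N \<phi> k. polar_arc f N \<phi> \<and> h = of_nat k / of_nat N \<and>
      ((\<lambda>s. f (s ^ N, \<phi> s) / s ^ k) \<longlongrightarrow> c) (at 0))}"

text \<open>
  Equality modulo the action $\xi \cdot (h,c) = (h, c\,\xi^h)$ of the nonzero complex numbers
  ($x \mapsto \xi x$), written with $\xi = e^w$ so that rational powers are taken consistently.
  The choice of \<open>w\<close> is harmless: adding $2\pi i$ to it replaces each Puiseux arc by a conjugate one,
  under which the set of pairs is stable.
\<close>

definition same_hp_invariant :: "(rat \<times> complex) set \<Rightarrow> (rat \<times> complex) set \<Rightarrow> bool"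
  where "same_hp_invariant A B \<longleftrightarrow>
    (\<exists>w::complex. B = (\<lambda>(h, c). (h, c * exp (of_rat h * w))) ` A)"

end

theory Submission
  imports Defs "HOL-Computational_Algebra.Fundamental_Theorem_Algebra"
begin

text \<open>
  After exchanging the variables one may assume that the weights satisfy $a < b$. A quasi-homogeneous
  polynomial $P$ is then determined by $R(y) = P(1,y)$, and its polar arcs are $y = \<kappa> x^{b/a}$ with
  $R'(\<kappa>) = 0$; along such an arc $P = R(\<kappa>) x^{d/a}$. So the invariant of $P$ is the set of
  critical values of $R$, all with the exponent $d/a$. The first half of the proof shows that this
  remains true, up to one common factor, for a miniregular germ $f = P \<circ> \<Phi>$: an estimate of the
  polar equation shows that every polar arc tangent to the singular line follows some critical point
  of $R$ (\<open>polar_arc_value\<close>), and Puiseux's theorem, proved here by Newton's algorithm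
  (\<open>Puiseux_branch\<close>), produces an arc through each critical point, however degenerate
  (\<open>polar_arc_exists\<close>).

  The second half treats the dependence on the parameter. The polynomials to which the $f_t$ are
  equivalent are given for each $t$ separately, with no continuity. A representative that depends
  continuously on $t$ is read off from $f_t$ itself: the arc $y = e_1 x + e_2 x^2 + \<dots>$ along which
  $f_t$ is most degenerate is determined below order $b/a$, its coefficients are double roots of
  polynomials whose coefficients are Taylor coefficients of $f_t$, and the weighted initial form of
  $f_t$ relative to this arc is a quasi-homogeneous polynomial equivalent to $f_t$
  (\<open>normal_form\<close>, \<open>continuous_on_double_root\<close>, \<open>continuous_on_leading_limit\<close>). A further
  translation makes $R_t$ centred, that is, its second highest coefficient vanishes.

  It remains to see that a continuous family of centred polynomials $R_t$ whose critical values are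
  constant up to a factor stays in one orbit of $R(y) \<mapsto> \<zeta> R(\<eta> y)$. Let $R_n$ tend to $R$, with
  the same leading coefficient and the same critical values. Counting the points in the fibres over
  the critical values shows that no root of $R - c$ splits, hence multiplicities persist. If
  $R_n \<noteq> R$, normalise the differences and pass to a limit $D \<noteq> 0$: persistence of
  multiplicities forces $D$ to vanish at each critical point of $R$ to at least the order of $R'$, so
  $R'$ divides $D$, although $D$ has smaller degree than $R'$. Hence $R_n = R$ for some $n$
  (\<open>eventually_eq_if_same_critical_values\<close>). So the analytic classes are open in the interval, and
  connectedness finishes the proof.
\<close>

section \<open>Holomorphic functions of two variables\<close>

lemma holomorphic2_on_mono: "holomorphic2_on f T \<Longrightarrow> S \<subseteq> T \<Longrightarrow> holomorphic2_on f S"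
  unfolding holomorphic2_on_def by blast

lemma holomorphic2_on_imp_continuous_on: "holomorphic2_on f S \<Longrightarrow> continuous_on S f"
  unfolding holomorphic2_on_def
  by (meson continuous_at_imp_continuous_on has_derivative_continuous)

lemma has_field_derivative_along_curve:
  assumes "(G has_derivative (\<lambda>(u, v). a * u + b * v)) (at (p s, q s))"
    and "(p has_field_derivative p') (at s)" "(q has_field_derivative q') (at s)"
  shows "((\<lambda>s. G (p s, q s)) has_field_derivative a * p' + b * q') (at s)"
proof -
  have "((\<lambda>s. (p s, q s)) has_derivative (\<lambda>h. (p' * h, q' * h))) (at s)"
    using assms(2,3) unfolding has_field_derivative_def by (intro has_derivative_Pair) auto
  from has_derivative_compose[OF this, of G "\<lambda>(u, v). a * u + b * v"] assms(1)
  have "((\<lambda>s. G (p s, q s)) has_derivative (\<lambda>h. a * (p' * h) + b * (q' * h))) (at s)"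
    by simp
  then show ?thesis unfolding has_field_derivative_def
    by (rule has_derivative_eq_rhs) (auto simp: algebra_simps)
qed

text \<open>
  Composition with a curve turns two-variable holomorphy into ordinary holomorphy; most two-variable
  facts below are reduced to one variable in this way.
\<close>

lemma holomorphic2_on_curve:
  assumes "holomorphic2_on G S" "p holomorphic_on T" "q holomorphic_on T" "open T"
    and "\<And>s. s \<in> T \<Longrightarrow> (p s, q s) \<in> S"
  shows "(\<lambda>s. G (p s, q s)) holomorphic_on T"
proof (unfold holomorphic_on_open[OF assms(4)], intro ballI)
  fix s assume s: "s \<in> T"
  obtain a b where "(G has_derivative (\<lambda>(u, v). a * u + b * v)) (at (p s, q s))"
    using assms(1,5) s unfolding holomorphic2_on_def by blast
  moreover obtain p' q' where "(p has_field_derivative p') (at s)" "(q has_field_derivative q') (at s)"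
    using assms(2,3,4) s by (meson holomorphic_on_open)
  ultimately show "\<exists>f'. ((\<lambda>s. G (p s, q s)) has_field_derivative f') (at s)"
    using has_field_derivative_along_curve by blast
qed

lemma holomorphic2_on_slice2:
  assumes "holomorphic2_on G S" "open T" "\<And>w. w \<in> T \<Longrightarrow> (t, w) \<in> S"
  shows "(\<lambda>w. G (t, w)) holomorphic_on T"
  by (rule holomorphic2_on_curve[OF assms(1) _ _ assms(2)]) (auto simp: assms)

lemma contour_integral_circlepath_integral:
  "contour_integral (circlepath c r) F =
     integral (cbox 0 1) (\<lambda>t. F (circlepath c r t) * (2 * pi * \<i> * r * exp (2 * of_real pi * \<i> * t)))"
  unfolding contour_integral_integral by (simp add: vector_derivative_circlepath)

lemma continuous_on_circle_integral:
  fixes F :: "'a::topological_space \<Rightarrow> complex \<Rightarrow> complex"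
  assumes F: "continuous_on (S \<times> sphere c r) (\<lambda>(z, w). F z w)" and r: "0 < r"
  shows "continuous_on S (\<lambda>z. contour_integral (circlepath c r) (F z))"
proof -
  have sph: "circlepath c r t \<in> sphere c r" for t
    using r by (simp add: circlepath dist_norm norm_mult)
  have "continuous_on (S \<times> cbox 0 1) (\<lambda>p. (\<lambda>(z, w). F z w) (fst p, circlepath c r (snd p)))"
    by (rule continuous_on_compose2[OF F])
       (use sph in \<open>auto simp: circlepath simp del: mem_sphere intro!: continuous_intros\<close>)
  then have "continuous_on (S \<times> cbox 0 1) (\<lambda>(z, t). F z (circlepath c r t) * (2 * pi * \<i> * r * exp (2 * of_real pi * \<i> * t)))"
    by (auto simp: case_prod_unfold intro!: continuous_intros)
  from integral_continuous_on_param[OF this] show ?thesis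
    by (simp add: contour_integral_circlepath_integral)
qed

text \<open>
  Leibniz rule for circle integrals: the parameter derivative may be taken under the integral because
  it is jointly continuous.
\<close>

lemma holomorphic_circle_integral:
  fixes F :: "complex \<Rightarrow> complex \<Rightarrow> complex"
  assumes F: "\<And>z. z \<in> U \<Longrightarrow> continuous_on (sphere c r) (F z)"
    and F': "continuous_on (U \<times> sphere c r) (\<lambda>(z, w). F' z w)"
    and d: "\<And>z w. z \<in> U \<Longrightarrow> w \<in> sphere c r \<Longrightarrow> ((\<lambda>z. F z w) has_field_derivative F' z w) (at z)"
    and r: "0 < r" and U: "open U"
  shows "(\<lambda>z. contour_integral (circlepath c r) (F z)) holomorphic_on U"
proof -
  have sph: "circlepath c r t \<in> sphere c r" for t
    using r by (simp add: circlepath dist_norm norm_mult)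
  let ?e = "\<lambda>t::real. 2 * pi * \<i> * r * exp (2 * of_real pi * \<i> * t)"
  have *: "(\<lambda>z. integral (cbox 0 1) (\<lambda>t. F z (circlepath c r t) * ?e t)) holomorphic_on V"
    if V: "convex V" "V \<subseteq> U" for V
  proof (rule leibniz_rule_holomorphic[where fx = "\<lambda>z t. F' z (circlepath c r t) * ?e t"])
    fix z and t :: real assume "z \<in> V" "t \<in> cbox 0 1"
    then have "((\<lambda>z. F z (circlepath c r t)) has_field_derivative F' z (circlepath c r t)) (at z within V)"
      by (intro has_field_derivative_at_within[OF d[OF _ sph]]) (use V in auto)
    then show "((\<lambda>z. F z (circlepath c r t) * ?e t) has_field_derivative F' z (circlepath c r t) * ?e t) (at z within V)"
      by (rule DERIV_cmult_right)
  next
    fix z assume z: "z \<in> V"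
    have "continuous_on (cbox 0 1) (\<lambda>t::real. F z (circlepath c r t))"
      by (rule continuous_on_compose2[OF F]) (use z V sph in \<open>auto simp: circlepath simp del: mem_sphere intro!: continuous_intros\<close>)
    then show "(\<lambda>t. F z (circlepath c r t) * ?e t) integrable_on cbox 0 1"
      by (intro integrable_continuous continuous_intros)
  next
    have "continuous_on (V \<times> cbox 0 1) (\<lambda>p. (\<lambda>(z, w). F' z w) (fst p, circlepath c r (snd p)))"
      by (rule continuous_on_compose2[OF F'])
         (use V sph in \<open>auto simp: circlepath simp del: mem_sphere intro!: continuous_intros\<close>)
    then show "continuous_on (V \<times> cbox 0 1) (\<lambda>(z, t). F' z (circlepath c r t) * ?e t)"
      by (auto simp: case_prod_unfold intro!: continuous_intros)
  qed fact
  show ?thesis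
  proof (unfold holomorphic_on_open[OF U], intro ballI)
    fix z assume "z \<in> U"
    then obtain e where e: "e > 0" "ball z e \<subseteq> U" using U openE by blast
    from *[of "ball z e"] e show "\<exists>f'. ((\<lambda>z. contour_integral (circlepath c r) (F z)) has_field_derivative f') (at z)"
      unfolding contour_integral_circlepath_integral[symmetric]
      by (metis centre_in_ball convex_ball holomorphic_on_open open_ball)
  qed
qed

definition partial1 :: "(complex \<times> complex \<Rightarrow> complex) \<Rightarrow> complex \<times> complex \<Rightarrow> complex"
  where "partial1 G z = deriv (\<lambda>t. G (t, snd z)) (fst z)"

definition partial2 :: "(complex \<times> complex \<Rightarrow> complex) \<Rightarrow> complex \<times> complex \<Rightarrow> complex"
  where "partial2 G z = deriv (\<lambda>w. G (fst z, w)) (snd z)"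

lemma holomorphic2_partials:
  assumes "(G has_derivative (\<lambda>(u, v). a * u + b * v)) (at z)"
  shows "partial1 G z = a" "partial2 G z = b"
    "((\<lambda>t. G (t, snd z)) has_field_derivative a) (at (fst z))"
    "((\<lambda>w. G (fst z, w)) has_field_derivative b) (at (snd z))"
proof -
  show 1: "((\<lambda>t. G (t, snd z)) has_field_derivative a) (at (fst z))"
    using has_field_derivative_along_curve[of G a b "\<lambda>t. t" "fst z" "\<lambda>_. snd z" 1 0] assms by simp
  show 2: "((\<lambda>w. G (fst z, w)) has_field_derivative b) (at (snd z))"
    using has_field_derivative_along_curve[of G a b "\<lambda>_. fst z" "snd z" "\<lambda>t. t" 0 1] assms by simp
  show "partial1 G z = a" "partial2 G z = b"
    unfolding partial1_def partial2_def using 1 2 by (auto intro: DERIV_imp_deriv)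
qed

lemma holomorphic2_on_has_derivative:
  assumes "holomorphic2_on G S" "z \<in> S"
  shows "(G has_derivative (\<lambda>(u, v). partial1 G z * u + partial2 G z * v)) (at z)"
proof -
  obtain a b where G: "(G has_derivative (\<lambda>(u, v). a * u + b * v)) (at z)"
    using assms unfolding holomorphic2_on_def by blast
  then show ?thesis using holomorphic2_partials(1,2)[OF G] by simp
qed

lemma open_polydisc:
  fixes z :: "complex \<times> complex"
  assumes "open S" "z \<in> S"
  obtains r where "0 < r" "cball (fst z) r \<times> cball (snd z) r \<subseteq> S"
proof -
  obtain A B where AB: "open A" "open B" "z \<in> A \<times> B" "A \<times> B \<subseteq> S"
    using open_prod_elim[OF assms] by metis
  obtain r1 r2 where "r1 > 0" "cball (fst z) r1 \<subseteq> A" "r2 > 0" "cball (snd z) r2 \<subseteq> B"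
    using AB open_contains_cball by (metis mem_Times_iff)
  then show ?thesis using AB that[of "min r1 r2"] by fastforce
qed

lemma partial2_Cauchy:
  assumes c: "continuous_on S G" and h: "\<And>z. z \<in> S \<Longrightarrow> (\<lambda>w. G (fst z, w)) field_differentiable at (snd z)"
    and S: "A \<times> cball v0 r \<subseteq> S" and tv: "t \<in> A" "v \<in> ball v0 r"
  shows "((\<lambda>w. G (t, w)) has_field_derivative
      1 / (2 * of_real pi * \<i>) * contour_integral (circlepath v0 r) (\<lambda>w. G (t, w) / (w - v)^2)) (at v)"
proof (rule Cauchy_derivative_integral_circlepath)
  show "continuous_on (cball v0 r) (\<lambda>w. G (t, w))"
    by (rule continuous_on_compose2[OF c]) (use S tv in \<open>auto intro!: continuous_intros\<close>)
  show "(\<lambda>w. G (t, w)) holomorphic_on ball v0 r"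
    unfolding holomorphic_on_def
  proof
    fix w assume "w \<in> ball v0 r"
    then have "(t, w) \<in> S" using S tv by auto
    from h[OF this] show "(\<lambda>w. G (t, w)) field_differentiable at w within ball v0 r"
      by (simp add: field_differentiable_at_within)
  qed
qed (use tv in auto)

lemma continuous_on_Cauchy_kernel:
  assumes G: "continuous_on (A \<times> sphere c r) G" and q: "continuous_on (sphere c r) q" and r: "0 < r"
  shows "continuous_on (A \<times> ball c r)
    (\<lambda>z. contour_integral (circlepath c r) (\<lambda>w. G (fst z, w) * q w / (w - snd z)^n))"
proof (rule continuous_on_circle_integral[OF _ r])
  have 1: "continuous_on ((A \<times> ball c r) \<times> sphere c r) (\<lambda>p. G (fst (fst p), snd p))"
    by (rule continuous_on_compose2[OF G]) (auto intro!: continuous_intros)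
  have 2: "continuous_on ((A \<times> ball c r) \<times> sphere c r) (\<lambda>p. q (snd p))"
    by (rule continuous_on_compose2[OF q]) (auto intro!: continuous_intros)
  show "continuous_on ((A \<times> ball c r) \<times> sphere c r) (\<lambda>(z, w). G (fst z, w) * q w / (w - snd z) ^ n)"
    unfolding case_prod_unfold by (intro continuous_intros 1 2) auto
qed

text \<open>
  Cauchy's formula writes the partial derivative as a circle integral over values of the function
  itself, so continuity of the function alone makes the derivative jointly continuous.
\<close>

lemma continuous_on_partial2:
  assumes c: "continuous_on S G" and h: "\<And>z. z \<in> S \<Longrightarrow> (\<lambda>w. G (fst z, w)) field_differentiable at (snd z)"
    and S: "open S"
  shows "continuous_on S (partial2 G)"
proof (rule continuous_at_imp_continuous_on, rule ballI)
  fix z assume "z \<in> S"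
  then obtain r where r: "0 < r" "cball (fst z) r \<times> cball (snd z) r \<subseteq> S"
    using open_polydisc[OF S] by blast
  let ?D = "ball (fst z) r \<times> ball (snd z) r"
  have "continuous_on (ball (fst z) r \<times> sphere (snd z) r) G"
    by (rule continuous_on_subset[OF c]) (use r in auto)
  from continuous_on_Cauchy_kernel[OF this _ r(1), of "\<lambda>_. 1" 2]
  have "continuous_on ?D (\<lambda>p. 1 / (2 * of_real pi * \<i>) *
      contour_integral (circlepath (snd z) r) (\<lambda>w. G (fst p, w) / (w - snd p)^2))"
    by (intro continuous_intros) auto
  moreover have "partial2 G p = 1 / (2 * of_real pi * \<i>) *
      contour_integral (circlepath (snd z) r) (\<lambda>w. G (fst p, w) / (w - snd p)^2)" if "p \<in> ?D" for p
    unfolding partial2_def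
    by (rule DERIV_imp_deriv[OF partial2_Cauchy[OF c h, of "ball (fst z) r"]]) (use that r in auto)
  ultimately have "continuous_on ?D (partial2 G)"
    by (simp cong: continuous_on_cong)
  moreover have "open ?D" "z \<in> ?D" using r(1) by (auto simp: open_Times mem_Times_iff)
  ultimately show "isCont (partial2 G) z"
    using continuous_on_eq_continuous_at by blast
qed

lemma holomorphic2_on_swap:
  assumes "holomorphic2_on G S" shows "holomorphic2_on (\<lambda>z. G (snd z, fst z)) ((\<lambda>z. (snd z, fst z)) ` S)"
  unfolding holomorphic2_on_def
proof
  fix z assume "z \<in> (\<lambda>z. (snd z, fst z)) ` S"
  then have "(snd z, fst z) \<in> S" by auto
  then obtain a b where G: "(G has_derivative (\<lambda>(u, v). a * u + b * v)) (at (snd z, fst z))"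
    using assms unfolding holomorphic2_on_def by blast
  have "((\<lambda>z. (snd z, fst z)) has_derivative (\<lambda>h. (snd h, fst h))) (at z)"
    by (auto intro!: derivative_eq_intros)
  from has_derivative_compose[OF this G]
  have "((\<lambda>z. G (snd z, fst z)) has_derivative (\<lambda>(u, v). b * u + a * v)) (at z)"
    by (simp add: case_prod_unfold add.commute)
  then show "\<exists>a b. ((\<lambda>z. G (snd z, fst z)) has_derivative (\<lambda>(u, v). a * u + b * v)) (at z)" by blast
qed

text \<open>
  Osgood's lemma. One partial derivative exists and the other is continuous, by Cauchy's formula; this
  is enough for total differentiability.
\<close>

lemma Osgood:
  assumes c: "continuous_on S G" and S: "open S"
    and h1: "\<And>z. z \<in> S \<Longrightarrow> (\<lambda>t. G (t, snd z)) field_differentiable at (fst z)"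
    and h2: "\<And>z. z \<in> S \<Longrightarrow> (\<lambda>w. G (fst z, w)) field_differentiable at (snd z)"
  shows "holomorphic2_on G S"
  unfolding holomorphic2_on_def
proof
  fix z assume z: "z \<in> S"
  obtain r where r: "0 < r" "cball (fst z) r \<times> cball (snd z) r \<subseteq> S"
    using open_polydisc[OF S z] by blast
  let ?X = "ball (fst z) r" and ?Y = "ball (snd z) r"
  have sub: "?X \<times> ?Y \<subseteq> S" using r by auto
  obtain a where a: "((\<lambda>t. G (t, snd z)) has_field_derivative a) (at (fst z))"
    using h1[OF z] field_differentiable_def by blast
  have "((\<lambda>(x, y). G (x, y)) has_derivative
      (\<lambda>(tx, ty). a * tx + blinfun_apply (blinfun_mult_right (partial2 G (fst z, snd z))) ty))
      (at (fst z, snd z) within ?X \<times> ?Y)"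
  proof (rule has_derivative_partialsI[where fx = "\<lambda>u. a * u" and f = "\<lambda>x y. G (x, y)"])
    show "((\<lambda>t. G (t, snd z)) has_derivative (*) a) (at (fst z) within ?X)"
      using a has_derivative_at_withinI unfolding has_field_derivative_def by blast
    fix x y assume xy: "x \<in> ?X" "y \<in> ?Y"
    then have "(x, y) \<in> S" using sub by auto
    from h2[OF this] have "((\<lambda>w. G (x, w)) has_field_derivative partial2 G (x, y)) (at y)"
      by (simp add: partial2_def field_differentiable_derivI)
    then show "((\<lambda>y. G (x, y)) has_derivative blinfun_apply (blinfun_mult_right (partial2 G (x, y)))) (at y within ?Y)"
      unfolding has_field_derivative_def by (simp add: has_derivative_at_withinI blinfun_mult_right.rep_eq)
  next
    have "continuous_on S (\<lambda>p. blinfun_mult_right (partial2 G p))"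
      by (rule bounded_linear.continuous_on[OF bounded_linear_blinfun_mult_right continuous_on_partial2[OF c h2 S]])
    then have "continuous (at z) (\<lambda>p. blinfun_mult_right (partial2 G p))"
      using S z continuous_on_eq_continuous_at by blast
    then have "continuous (at z within ?X \<times> ?Y) (\<lambda>p. blinfun_mult_right (partial2 G p))"
      using continuous_at_imp_continuous_at_within by blast
    then show "continuous (at (fst z, snd z) within ?X \<times> ?Y) (\<lambda>(x, y). blinfun_mult_right (partial2 G (x, y)))"
      by (simp add: case_prod_unfold)
  qed (use r in auto)
  moreover have "at (fst z, snd z) within ?X \<times> ?Y = at z"
  proof -
    have "(fst z, snd z) \<in> ?X \<times> ?Y" "open (?X \<times> ?Y)" using r(1) by (auto simp: open_Times mem_Times_iff)
    from at_within_open[OF this] show ?thesis by simp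
  qed
  ultimately have "(G has_derivative (\<lambda>(u, v). a * u + partial2 G z * v)) (at z)"
    by (simp add: blinfun_mult_right.rep_eq case_prod_unfold)
  then show "\<exists>a b. (G has_derivative (\<lambda>(u, v). a * u + b * v)) (at z)" by blast
qed

lemma holomorphic2_on_partial_diff:
  assumes "holomorphic2_on G S" "z \<in> S"
  shows "((\<lambda>t. G (t, snd z)) has_field_derivative partial1 G z) (at (fst z))"
    and "((\<lambda>w. G (fst z, w)) has_field_derivative partial2 G z) (at (snd z))"
  by (rule holomorphic2_partials[OF holomorphic2_on_has_derivative[OF assms]])+

lemma holomorphic2_continuous_partials:
  assumes G: "holomorphic2_on G S" and S: "open S"
  shows "continuous_on S (partial1 G)" "continuous_on S (partial2 G)"
proof -
  note c = holomorphic2_on_imp_continuous_on[OF G]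
  have h2: "\<And>z. z \<in> S \<Longrightarrow> (\<lambda>w. G (fst z, w)) field_differentiable at (snd z)"
    by (auto simp: field_differentiable_def intro: holomorphic2_on_partial_diff(2)[OF G])
  show "continuous_on S (partial2 G)" by (rule continuous_on_partial2[OF c h2 S])
  let ?s = "\<lambda>z::complex \<times> complex. (snd z, fst z)"
  let ?H = "\<lambda>z. G (?s z)"
  have H: "holomorphic2_on ?H (?s ` S)" by (rule holomorphic2_on_swap[OF G])
  have "?s ` S = ?s -` S" by force
  moreover have "open (?s -` S)"
    by (rule open_vimage[OF S]) (intro continuous_intros)
  ultimately have "open (?s ` S)" by simp
  moreover have "(\<lambda>w. ?H (fst z, w)) field_differentiable at (snd z)" if "z \<in> ?s ` S" for z
    using holomorphic2_on_partial_diff(2)[OF H that] field_differentiable_def by blast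
  ultimately have "continuous_on (?s ` S) (partial2 ?H)"
    by (intro continuous_on_partial2[OF holomorphic2_on_imp_continuous_on[OF H]])
  then have "continuous_on S (\<lambda>z. partial2 ?H (?s z))"
    by (rule continuous_on_compose2) (auto intro!: continuous_intros)
  moreover have "partial2 ?H (?s z) = partial1 G z" for z
    by (simp add: partial1_def partial2_def)
  ultimately show "continuous_on S (partial1 G)" by simp
qed

text \<open>
  The single source of new holomorphic functions: with $q = 1$ and $n = 2$ it gives the partial
  derivative, with $q(w) = w^{-m}$ and $n = 1$ the quotient of a Taylor remainder by the power $v^m$.
\<close>

lemma holomorphic2_Cauchy_kernel:
  assumes G: "holomorphic2_on G S" and S: "open S" and sub: "A \<times> sphere c r \<subseteq> S"
    and A: "open A" and q: "continuous_on (sphere c r) q" and r: "0 < r"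
  shows "holomorphic2_on (\<lambda>z. contour_integral (circlepath c r) (\<lambda>w. G (fst z, w) * q w / (w - snd z)^n)) (A \<times> ball c r)"
proof (rule Osgood)
  note cG = continuous_on_subset[OF holomorphic2_on_imp_continuous_on[OF G] sub]
  show "continuous_on (A \<times> ball c r)
      (\<lambda>z. contour_integral (circlepath c r) (\<lambda>w. G (fst z, w) * q w / (w - snd z)^n))"
    by (rule continuous_on_Cauchy_kernel[OF cG q r])
  show "open (A \<times> ball c r)" using A by (simp add: open_Times)
  fix z assume z: "z \<in> A \<times> ball c r"
  have Gt: "continuous_on (sphere c r) (\<lambda>w. G (t, w))" if "t \<in> A" for t
    by (rule continuous_on_compose2[OF cG]) (use that in \<open>auto intro!: continuous_intros\<close>)
  have "(\<lambda>t. contour_integral (circlepath c r) (\<lambda>w. G (t, w) * q w / (w - snd z)^n)) holomorphic_on A"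
  proof (rule holomorphic_circle_integral[where F' = "\<lambda>t w. partial1 G (t, w) * q w / (w - snd z)^n"])
    have 1: "continuous_on (A \<times> sphere c r) (\<lambda>p. partial1 G (fst p, snd p))"
      using continuous_on_subset[OF holomorphic2_continuous_partials(1)[OF G S] sub] by simp
    have 2: "continuous_on (A \<times> sphere c r) (\<lambda>p. q (snd p))"
      by (rule continuous_on_compose2[OF q]) (auto intro!: continuous_intros)
    show "continuous_on (A \<times> sphere c r) (\<lambda>(t, w). partial1 G (t, w) * q w / (w - snd z) ^ n)"
      unfolding case_prod_unfold by (intro continuous_intros 1 2) (use z in auto)
    show "((\<lambda>t. G (t, w) * q w / (w - snd z) ^ n) has_field_derivative partial1 G (t, w) * q w / (w - snd z) ^ n) (at t)"
      if "t \<in> A" "w \<in> sphere c r" for t w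
    proof -
      have "(t, w) \<in> S" using that sub by auto
      from DERIV_cmult_right[OF holomorphic2_on_partial_diff(1)[OF G this], of "q w / (w - snd z) ^ n"]
      show ?thesis by simp
    qed
    show "continuous_on (sphere c r) (\<lambda>w. G (t, w) * q w / (w - snd z) ^ n)" if "t \<in> A" for t
      by (intro continuous_intros Gt q) (use z that in auto)
  qed (use A r in auto)
  then show "(\<lambda>t. contour_integral (circlepath c r) (\<lambda>w. G (fst (t, snd z), w) * q w / (w - snd (t, snd z))^n))
        field_differentiable at (fst z)"
    using A z holomorphic_on_imp_differentiable_at by auto
  have "(\<lambda>v. contour_integral (circlepath c r) (\<lambda>w. G (fst z, w) * q w / (w - v)^n)) holomorphic_on ball c r"
  proof (rule holomorphic_circle_integral[where F' = "\<lambda>v w. of_nat n * (G (fst z, w) * q w / (w - v)^Suc n)"])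
    have 1: "continuous_on (ball c r \<times> sphere c r) (\<lambda>p. G (fst z, snd p))"
      by (rule continuous_on_compose2[OF cG]) (use z in \<open>auto intro!: continuous_intros\<close>)
    have 2: "continuous_on (ball c r \<times> sphere c r) (\<lambda>p. q (snd p))"
      by (rule continuous_on_compose2[OF q]) (auto intro!: continuous_intros)
    show "continuous_on (ball c r \<times> sphere c r) (\<lambda>(v, w). of_nat n * (G (fst z, w) * q w / (w - v)^Suc n))"
      unfolding case_prod_unfold by (intro continuous_intros 1 2) auto
    show "continuous_on (sphere c r) (\<lambda>w. G (fst z, w) * q w / (w - v) ^ n)" if "v \<in> ball c r" for v
      by (intro continuous_intros Gt q) (use z that in auto)
    fix v w assume "v \<in> ball c r" "w \<in> sphere c r"
    then have ne: "w - v \<noteq> 0" by auto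
    have "((\<lambda>v. inverse ((w - v) ^ n)) has_field_derivative of_nat n * inverse ((w - v) ^ Suc n)) (at v)"
    proof (cases n)
      case (Suc m)
      have "((\<lambda>v. inverse ((w - v) ^ n)) has_field_derivative
        - (inverse ((w - v)^n) * (of_nat n * (w - v)^(n - 1) * (- 1)) * inverse ((w - v)^n))) (at v)"
        using ne by (auto intro!: derivative_eq_intros)
      moreover have "- (inverse (u^n) * (of_nat n * u^(n - 1) * (- 1)) * inverse (u^n))
          = of_nat n * inverse (u ^ Suc n)" if "u \<noteq> 0" for u :: complex
        using that Suc by (simp add: field_simps)
      ultimately show ?thesis using ne by (metis right_minus_eq)
    qed auto
    from DERIV_cmult[OF this, of "G (fst z, w) * q w"]
    show "((\<lambda>v. G (fst z, w) * q w / (w - v) ^ n) has_field_derivative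
        of_nat n * (G (fst z, w) * q w / (w - v)^Suc n)) (at v)"
      by (simp add: field_simps)
  qed (use r in auto)
  then show "(\<lambda>v. contour_integral (circlepath c r) (\<lambda>w. G (fst (fst z, v), w) * q w / (w - snd (fst z, v))^n))
        field_differentiable at (snd z)"
    using z holomorphic_on_imp_differentiable_at by auto
qed

lemma holomorphic2_on_const: "holomorphic2_on (\<lambda>z. c) S"
  unfolding holomorphic2_on_def by (auto intro!: exI[of _ 0] simp: case_prod_unfold)

lemma holomorphic2_on_fst: "holomorphic2_on fst S"
  unfolding holomorphic2_on_def
  by (intro ballI exI[of _ 1] exI[of _ 0]) (auto simp: case_prod_unfold intro!: derivative_eq_intros)

lemma holomorphic2_on_snd: "holomorphic2_on snd S"
  unfolding holomorphic2_on_def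
  by (intro ballI exI[of _ 0] exI[of _ 1]) (auto simp: case_prod_unfold intro!: derivative_eq_intros)

lemma holomorphic2_on_compose:
  assumes "holomorphic2_on G S" "holomorphic2_on p T" "holomorphic2_on q T"
    and "\<And>z. z \<in> T \<Longrightarrow> (p z, q z) \<in> S"
  shows "holomorphic2_on (\<lambda>z. G (p z, q z)) T"
  unfolding holomorphic2_on_def
proof
  fix z assume z: "z \<in> T"
  obtain a b where G: "(G has_derivative (\<lambda>(u, v). a * u + b * v)) (at (p z, q z))"
    using assms(1,4) z unfolding holomorphic2_on_def by blast
  obtain a1 b1 where p: "(p has_derivative (\<lambda>(u, v). a1 * u + b1 * v)) (at z)"
    using assms(2) z unfolding holomorphic2_on_def by blast
  obtain a2 b2 where q: "(q has_derivative (\<lambda>(u, v). a2 * u + b2 * v)) (at z)"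
    using assms(3) z unfolding holomorphic2_on_def by blast
  have "((\<lambda>z. G (p z, q z)) has_derivative
      (\<lambda>h. (\<lambda>(u, v). a * u + b * v) ((\<lambda>(u, v). a1 * u + b1 * v) h, (\<lambda>(u, v). a2 * u + b2 * v) h))) (at z)"
    by (rule has_derivative_compose[OF has_derivative_Pair[OF p q] G])
  moreover have "(\<lambda>h. (\<lambda>(u, v). a * u + b * v) ((\<lambda>(u, v). a1 * u + b1 * v) h, (\<lambda>(u, v). a2 * u + b2 * v) h))
      = (\<lambda>(u, v). (a * a1 + b * a2) * u + (a * b1 + b * b2) * v)"
    by (auto simp: algebra_simps fun_eq_iff)
  ultimately show "\<exists>a b. ((\<lambda>z. G (p z, q z)) has_derivative (\<lambda>(u, v). a * u + b * v)) (at z)"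
    by auto
qed

lemma holomorphic2_on_compose1:
  assumes g: "g holomorphic_on A" "open A" and p: "holomorphic2_on p T" "\<And>z. z \<in> T \<Longrightarrow> p z \<in> A"
  shows "holomorphic2_on (\<lambda>z. g (p z)) T"
  unfolding holomorphic2_on_def
proof
  fix z assume z: "z \<in> T"
  obtain g' where "(g has_field_derivative g') (at (p z))"
    using g p(2)[OF z] by (meson holomorphic_on_open)
  moreover obtain a1 b1 where p: "(p has_derivative (\<lambda>(u, v). a1 * u + b1 * v)) (at z)"
    using p(1) z unfolding holomorphic2_on_def by blast
  ultimately have "((\<lambda>z. g (p z)) has_derivative (\<lambda>h. g' * (\<lambda>(u, v). a1 * u + b1 * v) h)) (at z)"
    unfolding has_field_derivative_def by (intro has_derivative_compose[OF p])
  moreover have "(\<lambda>h. g' * (\<lambda>(u, v). a1 * u + b1 * v) h) = (\<lambda>(u, v). (g' * a1) * u + (g' * b1) * v)"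
    by (auto simp: algebra_simps fun_eq_iff)
  ultimately show "\<exists>a b. ((\<lambda>z. g (p z)) has_derivative (\<lambda>(u, v). a * u + b * v)) (at z)" by auto
qed

lemma holomorphic2_on_add:
  assumes "holomorphic2_on f S" "holomorphic2_on g S"
  shows "holomorphic2_on (\<lambda>z. f z + g z) S"
proof -
  have "holomorphic2_on (\<lambda>z. fst z + snd z) UNIV"
    unfolding holomorphic2_on_def
    by (intro ballI exI[of _ 1] exI[of _ 1]) (auto simp: case_prod_unfold intro!: derivative_eq_intros)
  from holomorphic2_on_compose[OF this assms] show ?thesis by simp
qed

lemma holomorphic2_on_mult:
  assumes "holomorphic2_on f S" "holomorphic2_on g S"
  shows "holomorphic2_on (\<lambda>z. f z * g z) S"
proof -
  have "holomorphic2_on (\<lambda>z. fst z * snd z) UNIV"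
    unfolding holomorphic2_on_def
  proof
    fix z :: "complex \<times> complex"
    have "((\<lambda>z. fst z * snd z) has_derivative (\<lambda>(u, v). snd z * u + fst z * v)) (at z)"
      by (auto simp: case_prod_unfold algebra_simps intro!: derivative_eq_intros)
    then show "\<exists>a b. ((\<lambda>z. fst z * snd z) has_derivative (\<lambda>(u, v). a * u + b * v)) (at z)" by blast
  qed
  from holomorphic2_on_compose[OF this assms] show ?thesis by simp
qed

lemma holomorphic2_on_power: "holomorphic2_on f S \<Longrightarrow> holomorphic2_on (\<lambda>z. f z ^ n) S"
  by (induction n) (auto intro: holomorphic2_on_const holomorphic2_on_mult)

lemma holomorphic2_on_sum:
  "(\<And>i. i \<in> I \<Longrightarrow> holomorphic2_on (f i) S) \<Longrightarrow> holomorphic2_on (\<lambda>z. \<Sum>i\<in>I. f i z) S"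
  by (induction I rule: infinite_finite_induct) (auto intro: holomorphic2_on_const holomorphic2_on_add)

lemmas holomorphic2_intros =
  holomorphic2_on_const holomorphic2_on_fst holomorphic2_on_snd holomorphic2_on_add
  holomorphic2_on_mult holomorphic2_on_power holomorphic2_on_sum

lemma holomorphic2_on_cong:
  assumes "holomorphic2_on f S" "open S" "\<And>z. z \<in> S \<Longrightarrow> g z = f z"
  shows "holomorphic2_on g S"
  unfolding holomorphic2_on_def
proof
  fix z assume z: "z \<in> S"
  then obtain a b where "(f has_derivative (\<lambda>(u, v). a * u + b * v)) (at z)"
    using assms(1) unfolding holomorphic2_on_def by blast
  then have "(g has_derivative (\<lambda>(u, v). a * u + b * v)) (at z)"
    by (rule has_derivative_transform_within_open[OF _ assms(2) z]) (simp add: assms(3))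
  then show "\<exists>a b. (g has_derivative (\<lambda>(u, v). a * u + b * v)) (at z)" by blast
qed

lemma holomorphic2_on_partial2:
  assumes G: "holomorphic2_on G S" and S: "open S"
  shows "holomorphic2_on (partial2 G) S"
proof -
  have "\<exists>a b. (partial2 G has_derivative (\<lambda>(u, v). a * u + b * v)) (at z)" if z: "z \<in> S" for z
  proof -
    obtain r where r: "0 < r" "cball (fst z) r \<times> cball (snd z) r \<subseteq> S"
      using open_polydisc[OF S z] by blast
    let ?D = "ball (fst z) r \<times> ball (snd z) r"
    let ?K = "\<lambda>p. contour_integral (circlepath (snd z) r) (\<lambda>w. G (fst p, w) * 1 / (w - snd p)^2)"
    have "holomorphic2_on ?K ?D"
      by (rule holomorphic2_Cauchy_kernel[OF G S]) (use r in auto)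
    then have 1: "holomorphic2_on (\<lambda>p. 1 / (2 * of_real pi * \<i>) * ?K p) ?D"
      by (intro holomorphic2_intros)
    have "holomorphic2_on (partial2 G) ?D"
    proof (rule holomorphic2_on_cong[OF 1])
      fix p assume p: "p \<in> ?D"
      have "((\<lambda>w. G (fst p, w)) has_field_derivative 1 / (2 * of_real pi * \<i>) *
        contour_integral (circlepath (snd z) r) (\<lambda>w. G (fst p, w) / (w - snd p)^2)) (at (snd p))"
        by (rule partial2_Cauchy[of S _ "ball (fst z) r"])
           (use p r holomorphic2_on_partial_diff(2)[OF G]
             in \<open>auto simp: field_differentiable_def holomorphic2_on_imp_continuous_on[OF G]\<close>)
      then show "partial2 G p = 1 / (2 * of_real pi * \<i>) * ?K p"
        unfolding partial2_def using DERIV_imp_deriv by simp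
    qed (auto simp: open_Times)
    moreover have "z \<in> ?D" using r(1) by (simp add: mem_Times_iff)
    ultimately show ?thesis unfolding holomorphic2_on_def by blast
  qed
  then show ?thesis unfolding holomorphic2_on_def by blast
qed

lemma iterated_partial2: "(partial2 ^^ k) G (t, v) = (deriv ^^ k) (\<lambda>w. G (t, w)) v"
proof (induction k arbitrary: G)
  case (Suc k)
  have "(\<lambda>w. partial2 G (t, w)) = deriv (\<lambda>w. G (t, w))" by (simp add: partial2_def)
  then show ?case using Suc[of "partial2 G"] by (simp add: funpow_swap1)
qed simp

lemma holomorphic2_on_iterated_partial2:
  "holomorphic2_on G S \<Longrightarrow> open S \<Longrightarrow> holomorphic2_on ((partial2 ^^ k) G) S"
  by (induction k) (auto intro: holomorphic2_on_partial2)

text \<open>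
  The real inverse function theorem applied to $(t,v) \<mapsto> (t, K(t,v))$; the derivative of the
  solution is complex linear because it solves a complex linear equation.
\<close>

lemma holomorphic_implicit_function:
  assumes K: "holomorphic2_on K S" and S: "open S" "(t0, v0) \<in> S"
    and K0: "K (t0, v0) = 0" and K': "partial2 K (t0, v0) \<noteq> 0"
  obtains v \<delta> where "0 < \<delta>" "v holomorphic_on ball t0 \<delta>" "v t0 = v0"
    "\<And>t. t \<in> ball t0 \<delta> \<Longrightarrow> (t, v t) \<in> S \<and> K (t, v t) = 0"
proof -
  let ?F = "\<lambda>z. (fst z, K z)"
  define F' where "F' z = Blinfun (\<lambda>h. (fst h, partial1 K z * fst h + partial2 K z * snd h))" for z
  have bl: "bounded_linear (\<lambda>h::complex \<times> complex. (fst h, a * fst h + b * snd h))" for a b :: complex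
    by (intro bounded_linear_Pair bounded_linear_fst bounded_linear_add
        bounded_linear_compose[OF bounded_linear_mult_right bounded_linear_fst]
        bounded_linear_compose[OF bounded_linear_mult_right bounded_linear_snd])
  have F'a: "blinfun_apply (F' z) h = (fst h, partial1 K z * fst h + partial2 K z * snd h)" for z h
    unfolding F'_def using bounded_linear_Blinfun_apply[OF bl] by simp
  have der: "(?F has_derivative blinfun_apply (F' z)) (at z)" if "z \<in> S" for z
  proof -
    have "(K has_derivative (\<lambda>h. partial1 K z * fst h + partial2 K z * snd h)) (at z)"
      using holomorphic2_on_has_derivative[OF K that] by (simp add: case_prod_unfold)
    then have "(?F has_derivative (\<lambda>h. (fst h, partial1 K z * fst h + partial2 K z * snd h))) (at z)"
      by (intro has_derivative_Pair has_derivative_fst has_derivative_ident)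
    then show ?thesis by (simp add: F'a[abs_def])
  qed
  have cont: "continuous_on S F'"
  proof (rule continuous_on_blinfun_componentwise)
    fix i :: "complex \<times> complex"
    show "continuous_on S (\<lambda>x. blinfun_apply (F' x) i)"
      unfolding F'a by (intro continuous_intros holomorphic2_continuous_partials[OF K S(1)])
  qed
  define d1 d2 where "d1 = partial1 K (t0, v0)" and "d2 = partial2 K (t0, v0)"
  define I where "I = Blinfun (\<lambda>h::complex\<times>complex. (fst h, - d1 / d2 * fst h + 1 / d2 * snd h))"
  have Ia: "blinfun_apply I h = (fst h, - d1 / d2 * fst h + 1 / d2 * snd h)" for h
    unfolding I_def using bounded_linear_Blinfun_apply[OF bl, of "- d1 / d2" "1 / d2"] by (simp only:)
  have inv: "I o\<^sub>L F' (t0, v0) = id_blinfun"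
  proof (rule blinfun_eqI)
    fix h :: "complex \<times> complex"
    show "blinfun_apply (I o\<^sub>L F' (t0, v0)) h = blinfun_apply id_blinfun h"
      using K' by (simp add: Ia F'a d1_def[symmetric] d2_def[symmetric] prod_eq_iff field_simps)
  qed
  obtain U V g g' where U: "open U" "U \<subseteq> S" "(t0, v0) \<in> U" and V: "open V" "?F (t0, v0) \<in> V"
    and hom: "homeomorphism U V ?F g"
    and g1: "\<And>y. y \<in> V \<Longrightarrow> (g has_derivative (g' y)) (at y)"
    and g2: "\<And>y. y \<in> V \<Longrightarrow> g' y = Hilbert_Choice.inv (blinfun_apply (F' (g y)))"
    and g3: "\<And>y. y \<in> V \<Longrightarrow> bij (blinfun_apply (F' (g y)))"
    using inverse_function_theorem[OF S(1) der cont S(2) inv] by blast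
  obtain \<delta> where \<delta>: "0 < \<delta>" "cball t0 \<delta> \<times> cball 0 \<delta> \<subseteq> V"
    using open_polydisc[OF V] K0 by auto
  define v where "v t = snd (g (t, 0))" for t
  have *: "g (t, 0) = (t, v t) \<and> (t, v t) \<in> S \<and> K (t, v t) = 0 \<and> (t, 0) \<in> V" if "t \<in> ball t0 \<delta>" for t
  proof -
    have tV: "(t, 0) \<in> V" using that \<delta> by auto
    have "?F (g (t, 0)) = (t, 0)" "g (t, 0) \<in> U" using hom tV unfolding homeomorphism_def by auto
    moreover from this have "g (t, 0) = (t, v t)" unfolding v_def by (auto simp: prod_eq_iff)
    ultimately show ?thesis using tV U(2) by auto
  qed
  show thesis
  proof (rule that[OF \<delta>(1)])
    have "g (?F (t0, v0)) = (t0, v0)" using hom U(3) unfolding homeomorphism_def by blast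
    then show "v t0 = v0" unfolding v_def using K0 by simp
    show "(t, v t) \<in> S \<and> K (t, v t) = 0" if "t \<in> ball t0 \<delta>" for t using *[OF that] by blast
    show "v holomorphic_on ball t0 \<delta>"
      unfolding holomorphic_on_open[OF open_ball]
    proof
      fix t assume t: "t \<in> ball t0 \<delta>"
      let ?D = "F' (t, v t)"
      have b: "bij (blinfun_apply ?D)" using g3[of "(t, 0)"] *[OF t] by simp
      have ne: "partial2 K (t, v t) \<noteq> 0"
      proof
        assume "partial2 K (t, v t) = 0"
        then have "blinfun_apply ?D (0, 1) = blinfun_apply ?D (0, 0)" by (simp add: F'a)
        with b show False unfolding bij_def inj_def by fastforce
      qed
      have gd: "(g has_derivative (Hilbert_Choice.inv (blinfun_apply ?D))) (at (t, 0))"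
        using g1[of "(t, 0)"] g2[of "(t, 0)"] *[OF t] by simp
      have "((\<lambda>t. (t, 0::complex)) has_derivative (\<lambda>h. (h, 0))) (at t)"
        by (auto intro!: derivative_eq_intros)
      from has_derivative_snd[OF has_derivative_compose[OF this gd]]
      have "(v has_derivative (\<lambda>h. snd (Hilbert_Choice.inv (blinfun_apply ?D) (h, 0)))) (at t)"
        unfolding v_def[abs_def] .
      moreover have "Hilbert_Choice.inv (blinfun_apply ?D) (h, 0) = (h, - (partial1 K (t, v t) / partial2 K (t, v t)) * h)" for h
        using b ne by (intro inv_f_eq) (auto simp: bij_def F'a)
      then have "(\<lambda>h. snd (Hilbert_Choice.inv (blinfun_apply ?D) (h, 0))) =
          (*) (- (partial1 K (t, v t) / partial2 K (t, v t)))" by (simp add: fun_eq_iff)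
      ultimately have "(v has_field_derivative - (partial1 K (t, v t) / partial2 K (t, v t))) (at t)"
        unfolding has_field_derivative_def by metis
      then show "\<exists>f'. (v has_field_derivative f') (at t)" by blast
    qed
  qed
qed

text \<open>
  The remainder is kept as a circle integral, so that it depends holomorphically on parameters of the
  integrand.
\<close>

lemma Taylor_circlepath_remainder:
  assumes h: "h holomorphic_on cball 0 r" and w: "norm w < r"
  shows "h w = (\<Sum>i<m. (deriv ^^ i) h 0 / fact i * w ^ i) +
    w ^ m * (1 / (2 * of_real pi * \<i>) * contour_integral (circlepath 0 r) (\<lambda>u. h u * (1 / u ^ m) / (u - w) ^ 1))"
proof -
  have r: "0 < r" using w norm_ge_zero[of w] by linarith
  let ?c = "2 * of_real pi * \<i>"
  have c: "?c \<noteq> 0" by simp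
  have ch: "continuous_on (cball 0 r) h" "h holomorphic_on ball 0 r"
    using h holomorphic_on_imp_continuous_on holomorphic_on_subset ball_subset_cball by blast+
  have D: "((\<lambda>u. h u / u ^ Suc i) has_contour_integral ?c / fact i * (deriv ^^ i) h 0) (circlepath 0 r)" for i
    using Cauchy_has_contour_integral_higher_derivative_circlepath[OF ch, of 0 i] r by simp
  have C: "((\<lambda>u. h u / (u - w)) has_contour_integral ?c * h w) (circlepath 0 r)"
    using Cauchy_integral_circlepath_simple[OF h, of w] w by simp
  have "((\<lambda>u. h u / (u - w) - (\<Sum>i<m. w ^ i * (h u / u ^ Suc i))) has_contour_integral
      ?c * h w - (\<Sum>i<m. w ^ i * (?c / fact i * (deriv ^^ i) h 0))) (circlepath 0 r)"
    by (intro has_contour_integral_diff C has_contour_integral_sum has_contour_integral_lmul D) auto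
  then have "((\<lambda>u. w ^ m * (h u * (1 / u ^ m) / (u - w) ^ 1)) has_contour_integral
      ?c * h w - (\<Sum>i<m. w ^ i * (?c / fact i * (deriv ^^ i) h 0))) (circlepath 0 r)"
  proof (rule has_contour_integral_eq)
    fix u assume "u \<in> path_image (circlepath 0 r)"
    then have u: "norm u = r" "u \<noteq> 0" "u - w \<noteq> 0" using r w by auto
    have "(\<Sum>i<m. w ^ i * (1 / u ^ Suc i)) * (u - w) = 1 - w ^ m / u ^ m"
    proof (induction m)
      case (Suc m)
      have "w ^ m * (1 / u ^ Suc m) * (u - w) = w ^ m / u ^ m - w ^ Suc m / u ^ Suc m"
        using u(2) by (simp add: field_simps)
      with Suc show ?case by (simp add: distrib_right)
    qed simp
    then have "(\<Sum>i<m. w ^ i * (1 / u ^ Suc i)) = (1 - w ^ m / u ^ m) / (u - w)"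
      using u(3) by (simp add: field_simps)
    moreover have "(\<Sum>i<m. w ^ i * (h u / u ^ Suc i)) = h u * (\<Sum>i<m. w ^ i * (1 / u ^ Suc i))"
      by (subst sum_distrib_left) (simp add: mult.commute)
    ultimately have "(\<Sum>i<m. w ^ i * (h u / u ^ Suc i)) = h u * ((1 - w ^ m / u ^ m) / (u - w))"
      by simp
    then show "h u / (u - w) - (\<Sum>i<m. w ^ i * (h u / u ^ Suc i)) = w ^ m * (h u * (1 / u ^ m) / (u - w) ^ 1)"
      using u by (simp add: diff_divide_distrib right_diff_distrib)
  qed
  then have "w ^ m * contour_integral (circlepath 0 r) (\<lambda>u. h u * (1 / u ^ m) / (u - w) ^ 1)
     = ?c * h w - (\<Sum>i<m. w ^ i * (?c / fact i * (deriv ^^ i) h 0))" (is "w ^ m * ?I = _")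
  proof (cases "w ^ m = 0")
    case False
    assume *: "((\<lambda>u. w ^ m * (h u * (1 / u ^ m) / (u - w) ^ 1)) has_contour_integral
      ?c * h w - (\<Sum>i<m. w ^ i * (?c / fact i * (deriv ^^ i) h 0))) (circlepath 0 r)"
    have "(\<lambda>u. 1 / w ^ m * (w ^ m * (h u * (1 / u ^ m) / (u - w) ^ 1))) = (\<lambda>u. h u * (1 / u ^ m) / (u - w) ^ 1)"
      using False by (simp add: fun_eq_iff)
    from has_contour_integral_lmul[OF *, of "1 / w ^ m", unfolded this]
    have "((\<lambda>u. h u * (1 / u ^ m) / (u - w) ^ 1) has_contour_integral
      1 / w ^ m * (?c * h w - (\<Sum>i<m. w ^ i * (?c / fact i * (deriv ^^ i) h 0)))) (circlepath 0 r)" .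
    from contour_integral_unique[OF this] False show ?thesis by simp
  next
    case True
    assume *: "((\<lambda>u. w ^ m * (h u * (1 / u ^ m) / (u - w) ^ 1)) has_contour_integral
      ?c * h w - (\<Sum>i<m. w ^ i * (?c / fact i * (deriv ^^ i) h 0))) (circlepath 0 r)"
    from contour_integral_unique[OF *] True show ?thesis by (simp add: True)
  qed
  also have "(\<Sum>i<m. w ^ i * (?c / fact i * (deriv ^^ i) h 0)) = ?c * (\<Sum>i<m. (deriv ^^ i) h 0 / fact i * w ^ i)"
    by (simp add: sum_distrib_left mult_ac)
  finally have "?c * h w = ?c * (\<Sum>i<m. (deriv ^^ i) h 0 / fact i * w ^ i) + w ^ m * ?I" by (simp add: algebra_simps)
  then have "?c * h w / ?c = (?c * (\<Sum>i<m. (deriv ^^ i) h 0 / fact i * w ^ i) + w ^ m * ?I) / ?c" by simp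
  then show ?thesis using c unfolding add_divide_distrib by simp
qed

section \<open>Puiseux branches\<close>

lemma higher_deriv_poly: "(deriv ^^ k) (poly p) = poly ((pderiv ^^ k) p)" for p :: "complex poly"
proof (induction k)
  case (Suc k)
  have "deriv (poly p) = poly (pderiv p)" for p :: "complex poly"
    by (auto intro!: DERIV_imp_deriv poly_DERIV)
  then show ?case using Suc by simp
qed simp

lemma order_iterated_pderiv:
  fixes p :: "complex poly"
  assumes "p \<noteq> 0" "k \<le> order x p"
  shows "(pderiv ^^ k) p \<noteq> 0 \<and> order x ((pderiv ^^ k) p) = order x p - k"
  using assms(2)
proof (induction k)
  case (Suc k)
  let ?q = "(pderiv ^^ k) p"
  have q: "?q \<noteq> 0" "order x ?q = order x p - k" using Suc by auto
  then have o: "order x ?q \<noteq> 0" using Suc.prems by simp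
  then have "degree ?q \<noteq> 0" using q order_degree[OF q(1), of x] by linarith
  then have "pderiv ?q \<noteq> 0" by (simp add: pderiv_eq_0_iff)
  then show ?case using order_pderiv[of ?q x] q o by (simp add: order_root)
qed (use assms in simp)

lemma iterated_deriv_poly_at_root:
  fixes p :: "complex poly"
  assumes "p \<noteq> 0"
  shows "(deriv ^^ order x p) (poly p) x \<noteq> 0" "i < order x p \<Longrightarrow> (deriv ^^ i) (poly p) x = 0"
proof -
  show "(deriv ^^ order x p) (poly p) x \<noteq> 0"
    using order_iterated_pderiv[OF assms, of "order x p" x] by (simp add: higher_deriv_poly order_root)
  assume "i < order x p"
  then show "(deriv ^^ i) (poly p) x = 0"
    using order_iterated_pderiv[OF assms, of i x] by (simp add: higher_deriv_poly order_root)
qed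

text \<open>
  The vanishing of the second highest coefficient (the Tschirnhaus condition) rules out a power $(y -
  w)^m$ with $w \<noteq> 0$, and a nonzero lower coefficient rules out $w = 0$. This makes Newton's
  algorithm terminate.
\<close>

lemma exists_root_of_smaller_order:
  fixes T :: "complex poly"
  assumes deg: "degree T = m" and tr: "coeff T (m - 1) = 0" and i: "i < m" "coeff T i \<noteq> 0"
  shows "\<exists>w. poly T w = 0 \<and> order w T < m"
proof (rule ccontr)
  assume neg: "\<not> ?thesis"
  have "T \<noteq> 0" using i by auto
  have "\<not> constant (poly T)" using deg i by (simp add: constant_degree)
  then obtain w where w: "poly T w = 0" using fundamental_theorem_of_algebra by blast
  with neg have "m \<le> order w T" by auto
  then have "[:- w, 1:] ^ m dvd T"
    using order_1[of w T] power_le_dvd by blast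
  then obtain q where q: "T = [:- w, 1:] ^ m * q" by (elim dvdE)
  have "q \<noteq> 0" using q \<open>T \<noteq> 0\<close> by auto
  have "degree T = m + degree q"
    unfolding q by (subst degree_mult_eq) (use \<open>q \<noteq> 0\<close> in \<open>auto simp: degree_linear_power\<close>)
  then have "degree q = 0" using deg by simp
  then obtain c where c: "q = [:c:]" by (rule degree_eq_zeroE)
  have "c \<noteq> 0" using c \<open>q \<noteq> 0\<close> by auto
  have cf: "coeff T k = c * (of_nat (m choose k) * (- w) ^ (m - k))" if "k \<le> m" for k
    using that unfolding q c by (simp add: coeff_linear_power mult.commute coeff_linear_poly_power)
  have "of_nat m * w = 0" using cf[of "m - 1"] tr i \<open>c \<noteq> 0\<close>
    by (cases m) (auto simp: binomial_symmetric[of _ "Suc _"])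
  then have "w = 0" using i by simp
  then show False using cf[of i] i by simp
qed

text \<open>
  Chooses the steepest side of the Newton polygon, with the slope inequality cleared of denominators.
\<close>

lemma Newton_slope:
  fixes n :: "nat \<Rightarrow> nat" and m :: nat
  assumes "finite I" "I \<noteq> {}" "\<And>i. i \<in> I \<Longrightarrow> i < m"
  obtains i0 where "i0 \<in> I" "\<And>i. i \<in> I \<Longrightarrow> n i0 * (m - i) \<le> n i * (m - i0)"
proof -
  obtain i0 where i0: "i0 \<in> I" "\<And>i. i \<in> I \<Longrightarrow> real (n i0) / real (m - i0) \<le> real (n i) / real (m - i)"
    using assms(1,2) arg_min_if_finite(1)[of I "\<lambda>i. real (n i) / real (m - i)"]
      arg_min_least[of I _ "\<lambda>i. real (n i) / real (m - i)"] that by blast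
  show thesis
  proof (rule that[OF i0(1)])
    fix i assume i: "i \<in> I"
    have "real (m - i0) > 0" "real (m - i) > 0" using assms(3) i i0(1) by auto
    then have "real (n i0) * real (m - i) \<le> real (n i) * real (m - i0)"
      using i0(2)[OF i] by (simp add: field_simps)
    then show "n i0 * (m - i) \<le> n i * (m - i0)"
      by (metis of_nat_le_iff of_nat_mult)
  qed
qed

lemma holomorphic_factor_or_zero:
  assumes g: "g holomorphic_on ball 0 \<delta>" and \<delta>: "0 < \<delta>" and g0: "g 0 = (0::complex)"
  obtains (zero) "\<And>t. t \<in> ball 0 \<delta> \<Longrightarrow> g t = 0"
  | (factor) u r n where "0 < r" "0 < n" "u holomorphic_on ball 0 r" "u 0 \<noteq> 0"
      "\<And>t. t \<in> ball 0 r \<Longrightarrow> g t = t ^ n * u t"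
proof (cases "g constant_on ball 0 \<delta>")
  case True
  then show ?thesis using zero \<delta> g0 unfolding constant_on_def by (metis centre_in_ball)
next
  case False
  show ?thesis
  proof (rule holomorphic_factor_zero_nonconstant[OF g open_ball connected_ball _ g0 False])
    show "0 \<in> ball (0::complex) \<delta>" using \<delta> by simp
    fix u r n
    assume *: "0 < n" "0 < r" "ball 0 r \<subseteq> ball 0 \<delta>" "u holomorphic_on ball 0 r"
      "\<And>w. w \<in> ball 0 r \<Longrightarrow> g w = (w - 0) ^ n * u w" "\<And>w. w \<in> ball 0 r \<Longrightarrow> u w \<noteq> 0"
    then show ?thesis by (intro factor[of r n u]) auto
  qed
qed

text \<open>
  Newton's algorithm by induction on the order $m$ of $G(0,v)$ at $v_0$. The implicit function theorem
  gives a curve $c$ on which the derivative of order $m - 1$ vanishes; after translating $v$ by $c$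
  the coefficient of $v^{m-1}$ is zero. If the constant coefficient vanishes too, $c$ is a branch.
  Otherwise the substitution $t = s^e$, $v = c + s^p w$ along a side of the Newton polygon and
  division by a power of $s$ give a function whose restriction to $s = 0$ is a polynomial in $w$ of
  degree $m$ that is not an $m$-th power, so it has a root of order less than $m$, and the induction
  hypothesis applies there.
\<close>

lemma Puiseux_branch:
  fixes G :: "complex \<times> complex \<Rightarrow> complex"
  assumes "holomorphic2_on G S" "open S" "(0, v0) \<in> S" "0 < m"
    and "\<And>i. i < m \<Longrightarrow> (deriv ^^ i) (\<lambda>v. G (0, v)) v0 = 0" "(deriv ^^ m) (\<lambda>v. G (0, v)) v0 \<noteq> 0"
  shows "\<exists>e v \<delta>. 0 < e \<and> 0 < \<delta> \<and> v holomorphic_on ball 0 \<delta> \<and> v 0 = v0 \<and>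
    (\<forall>s\<in>ball 0 \<delta>. (s ^ e, v s) \<in> S \<and> G (s ^ e, v s) = 0)"
  using assms
proof (induction m arbitrary: G S v0 rule: less_induct)
  case (less m)
  note G = less.prems(1) and S = less.prems(2,3) and m = less.prems(4)
    and low = less.prems(5) and top = less.prems(6)
  let ?K = "(partial2 ^^ (m - 1)) G"
  obtain c \<delta>0 where \<delta>0: "0 < \<delta>0" and c: "c holomorphic_on ball 0 \<delta>0" and c0: "c 0 = v0"
    and cK: "\<And>t. t \<in> ball 0 \<delta>0 \<Longrightarrow> (t, c t) \<in> S \<and> ?K (t, c t) = 0"
  proof (rule holomorphic_implicit_function[of ?K S 0 v0])
    show "holomorphic2_on ?K S" by (rule holomorphic2_on_iterated_partial2[OF G S(1)])
    show "?K (0, v0) = 0" using low[of "m - 1"] m by (simp add: iterated_partial2)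
    have "partial2 ?K = (partial2 ^^ m) G" using m by (cases m) auto
    then show "partial2 ?K (0, v0) \<noteq> 0" using top by (simp add: iterated_partial2)
  qed (use S in auto)
  define g where "g i t = (partial2 ^^ i) G (t, c t) / fact i" for i t
  have ghol: "g i holomorphic_on ball 0 \<delta>0" for i
    unfolding g_def
    by (intro holomorphic_intros
        holomorphic2_on_curve[OF holomorphic2_on_iterated_partial2[OF G S(1)] _ c]) (use cK in auto)
  have g0: "g i 0 = 0" if "i < m" for i
    using low[OF that] by (simp add: g_def c0 iterated_partial2)
  have gm1: "g (m - 1) t = 0" if "t \<in> ball 0 \<delta>0" for t
    using cK[OF that] by (simp add: g_def)
  show ?case
  proof (cases "\<forall>t\<in>ball 0 \<delta>0. g 0 t = 0")
    case True
    then have "\<forall>s\<in>ball 0 \<delta>0. (s ^ 1, c s) \<in> S \<and> G (s ^ 1, c s) = 0"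
      using cK by (auto simp: g_def)
    then show ?thesis using \<delta>0 c c0 by (intro exI[of _ 1] exI[of _ c] exI[of _ \<delta>0]) auto
  next
    case False
    define I where "I = {i. i < m \<and> (\<exists>t\<in>ball 0 \<delta>0. g i t \<noteq> 0)}"
    have I: "finite I" "0 \<in> I" "\<And>i. i \<in> I \<Longrightarrow> i < m" "m - 1 \<notin> I"
      using False m gm1 by (auto simp: I_def)
    have "\<exists>u r n. 0 < r \<and> 0 < n \<and> u holomorphic_on ball 0 r \<and> u 0 \<noteq> 0 \<and>
        (\<forall>t\<in>ball 0 r. g i t = t ^ n * u t)" if i: "i \<in> I" for i
    proof (rule holomorphic_factor_or_zero[OF ghol[of i] \<delta>0 g0[of i]])
      show "i < m" using I(3) i .
      assume "\<And>t. t \<in> ball 0 \<delta>0 \<Longrightarrow> g i t = 0"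
      then show ?thesis using i unfolding I_def by blast
    qed blast
    then obtain u r n where u: "\<And>i. i \<in> I \<Longrightarrow> 0 < r i" "\<And>i. i \<in> I \<Longrightarrow> 0 < (n i :: nat)"
        "\<And>i. i \<in> I \<Longrightarrow> u i holomorphic_on ball 0 (r i)" "\<And>i. i \<in> I \<Longrightarrow> u i 0 \<noteq> (0::complex)"
        "\<And>i t. i \<in> I \<Longrightarrow> t \<in> ball 0 (r i) \<Longrightarrow> g i t = t ^ n i * u i t"
      by metis
    obtain i0 where i0: "i0 \<in> I" "\<And>i. i \<in> I \<Longrightarrow> n i0 * (m - i) \<le> n i * (m - i0)"
      using Newton_slope[of I m n] I by blast
    define e p where "e = m - i0" and "p = n i0"
    have ep: "0 < e" "0 < p" using I(3)[OF i0(1)] u(2)[OF i0(1)] by (auto simp: e_def p_def)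
    define k where "k i = e * n i - p * (m - i)" for i
    have k: "e * n i + p * i = p * m + k i" if "i \<in> I" for i
    proof -
      have "p * (m - i) \<le> e * n i" using i0(2)[OF that] by (simp add: e_def p_def mult.commute)
      moreover have "p * (m - i) + p * i = p * m"
        using I(3)[OF that] by (simp flip: distrib_left)
      ultimately show ?thesis unfolding k_def by linarith
    qed
    obtain R where R: "0 < R" "R \<le> \<delta>0" "\<And>i. i \<in> I \<Longrightarrow> R \<le> r i"
    proof
      show "0 < Min (insert \<delta>0 (r ` I))" "Min (insert \<delta>0 (r ` I)) \<le> \<delta>0"
        "\<And>i. i \<in> I \<Longrightarrow> Min (insert \<delta>0 (r ` I)) \<le> r i"
        using I(1) u(1) \<delta>0 by auto
    qed
    define G1 where "G1 z = G (fst z, c (fst z) + snd z)" for z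
    define S1 where "S1 = {z \<in> ball 0 R \<times> UNIV. (fst z, c (fst z) + snd z) \<in> S}"
    have cR: "c holomorphic_on ball 0 R" using c R(2) by (rule holomorphic_on_subset[OF _ subset_ball])
    have S1: "open S1"
    proof -
      have eq: "S1 = (ball 0 R \<times> UNIV) \<inter> (\<lambda>z. (fst z, c (fst z) + snd z)) -` S" by (auto simp: S1_def)
      show ?thesis unfolding eq
        by (rule continuous_open_preimage)
           (auto intro!: continuous_intros continuous_on_compose2[OF holomorphic_on_imp_continuous_on[OF cR]] S(1) open_Times)
    qed
    have G1: "holomorphic2_on G1 S1"
      unfolding G1_def
      by (rule holomorphic2_on_compose[OF G])
         (auto intro!: holomorphic2_intros holomorphic2_on_compose1[OF cR] simp: S1_def)
    obtain \<rho> where \<rho>: "0 < \<rho>" "cball 0 \<rho> \<times> cball 0 \<rho> \<subseteq> S1"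
      using open_polydisc[OF S1, of "(0, 0)"] S R(1) c0 by (auto simp: S1_def)
    have \<rho>R: "ball 0 \<rho> \<subseteq> ball (0::complex) R"
    proof
      fix t :: complex assume "t \<in> ball 0 \<rho>"
      then have "(t, 0) \<in> cball 0 \<rho> \<times> cball 0 \<rho>" using \<rho>(1) by auto
      from subsetD[OF \<rho>(2) this] show "t \<in> ball 0 R" by (simp add: S1_def)
    qed
    define U where "U z = 1 / (2 * of_real pi * \<i>) *
        contour_integral (circlepath 0 \<rho>) (\<lambda>w. G1 (fst z, w) * (1 / w ^ m) / (w - snd z) ^ 1)" for z
    have U: "holomorphic2_on U (ball 0 \<rho> \<times> ball 0 \<rho>)"
      unfolding U_def
      by (rule holomorphic2_on_mult[OF holomorphic2_on_const holomorphic2_Cauchy_kernel[OF G1 S1]])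
         (use \<rho>(1) in \<open>auto intro!: continuous_intros subsetD[OF \<rho>(2)]\<close>)
    have G1hol: "(\<lambda>w. G1 (t, w)) holomorphic_on cball 0 \<rho>" if "t \<in> ball 0 \<rho>" for t
    proof -
      have "open ((\<lambda>w. (t, w)) -` S1)" by (rule open_vimage[OF S1]) (intro continuous_intros)
      then have "(\<lambda>w. G1 (t, w)) holomorphic_on ((\<lambda>w. (t, w)) -` S1)"
        by (rule holomorphic2_on_slice2[OF G1]) auto
      then show ?thesis by (rule holomorphic_on_subset) (use that in \<open>auto intro!: subsetD[OF \<rho>(2)]\<close>)
    qed
    have dG1: "(deriv ^^ i) (\<lambda>w. G1 (t, w)) 0 = fact i * g i t" for i t
      unfolding G1_def g_def iterated_partial2
      using higher_deriv_shift_0[of i "\<lambda>w. G (t, w)" "c t"] by (simp add: o_def)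
    have Taylor: "G1 (t, w) = (\<Sum>i\<in>I. g i t * w ^ i) + w ^ m * U (t, w)"
      if "t \<in> ball 0 \<rho>" "w \<in> ball 0 \<rho>" for t w
    proof -
      have "G1 (t, w) = (\<Sum>i<m. g i t * w ^ i) + w ^ m * U (t, w)"
        using Taylor_circlepath_remainder[OF G1hol[OF that(1)], of w m] that(2)
        by (simp add: U_def dG1)
      also have "(\<Sum>i<m. g i t * w ^ i) = (\<Sum>i\<in>I. g i t * w ^ i)"
      proof (rule sum.mono_neutral_right)
        have "t \<in> ball 0 \<delta>0" using subsetD[OF \<rho>R that(1)] R(2) by auto
        then show "\<forall>i\<in>{..<m} - I. g i t * w ^ i = 0" by (auto simp: I_def)
      qed (auto simp: I_def)
      finally show ?thesis .
    qed
    have U0: "U (0, 0) \<noteq> 0"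
    proof -
      have "((\<lambda>u. G1 (0, u) / (u - 0) ^ Suc m) has_contour_integral
          (2 * pi * \<i>) / (fact m) * (deriv ^^ m) (\<lambda>w. G1 (0, w)) 0) (circlepath 0 \<rho>)"
        using G1hol[of 0] \<rho>(1)
        by (intro Cauchy_has_contour_integral_higher_derivative_circlepath)
           (auto intro: holomorphic_on_imp_continuous_on holomorphic_on_subset[OF _ ball_subset_cball])
      then have "((\<lambda>w. G1 (0, w) * (1 / w ^ m) / (w - 0) ^ 1) has_contour_integral
          (2 * pi * \<i>) / (fact m) * (fact m * g m 0)) (circlepath 0 \<rho>)"
        by (simp add: dG1 mult.commute)
      from contour_integral_unique[OF this] have "U (0, 0) = g m 0" by (simp add: U_def)
      then show ?thesis using top by (simp add: g_def c0 iterated_partial2)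
    qed
    define \<rho>' where "\<rho>' = min 1 \<rho>"
    have \<rho>': "0 < \<rho>'" "\<rho>' \<le> 1" "\<rho>' \<le> \<rho>" using \<rho>(1) by (auto simp: \<rho>'_def)
    have \<rho>'R: "t \<in> ball 0 R" if "t \<in> ball 0 \<rho>'" for t :: complex
      using \<rho>' that by (intro subsetD[OF \<rho>R]) auto
    have pw: "t ^ e \<in> ball 0 \<rho>'" if "t \<in> ball 0 \<rho>'" for t :: complex
    proof -
      have "norm t ^ e \<le> norm t ^ 1" using that \<rho>' ep(1) by (intro power_decreasing) auto
      then show ?thesis using that by (simp add: norm_power)
    qed
    define S2 where "S2 = {z \<in> ball 0 \<rho>' \<times> UNIV. fst z ^ p * snd z \<in> ball (0::complex) \<rho>}"
    \<comment> \<open>\<open>G2\<close> is $G(s^e, c + s^p w)$ divided by $s^{p m}$, written so that it makes sense at $s = 0$.\<close>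
    define G2 where "G2 z = (\<Sum>i\<in>I. fst z ^ k i * u i (fst z ^ e) * snd z ^ i) +
        snd z ^ m * U (fst z ^ e, fst z ^ p * snd z)" for z
    have S2: "open S2"
    proof -
      have eq: "S2 = (ball 0 \<rho>' \<times> UNIV) \<inter> (\<lambda>z. fst z ^ p * snd z) -` ball (0::complex) \<rho>" by (auto simp: S2_def)
      show ?thesis unfolding eq
        by (rule continuous_open_preimage) (auto intro!: continuous_intros open_Times)
    qed
    have pS2: "fst z ^ e \<in> ball 0 \<rho>'" if "z \<in> S2" for z using pw that by (auto simp: S2_def)
    have uS2: "holomorphic2_on (\<lambda>z. u i (fst z ^ e)) S2" if i: "i \<in> I" for i
    proof (rule holomorphic2_on_compose1[where g = "u i" and A = "ball 0 R" and p = "\<lambda>z. fst z ^ e"])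
      show "u i holomorphic_on ball 0 R"
        by (rule holomorphic_on_subset[OF u(3)[OF i]]) (use R(3)[OF i] in auto)
      show "holomorphic2_on (\<lambda>z. fst z ^ e) S2" by (intro holomorphic2_intros)
      show "fst z ^ e \<in> ball 0 R" if "z \<in> S2" for z by (rule \<rho>'R[OF pS2[OF that]])
    qed auto
    have US2: "holomorphic2_on (\<lambda>z. U (fst z ^ e, fst z ^ p * snd z)) S2"
    proof (rule holomorphic2_on_compose[OF U, where p = "\<lambda>z. fst z ^ e" and q = "\<lambda>z. fst z ^ p * snd z"])
      show "(fst z ^ e, fst z ^ p * snd z) \<in> ball 0 \<rho> \<times> ball 0 \<rho>" if "z \<in> S2" for z
        using pS2[OF that] \<rho>' that by (auto simp: S2_def)
    qed (intro holomorphic2_intros)+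
    have G2: "holomorphic2_on G2 S2"
      unfolding G2_def by (intro holomorphic2_intros uS2 US2)
    have GG2: "G (s ^ e, c (s ^ e) + s ^ p * w) = s ^ (p * m) * G2 (s, w)" if "(s, w) \<in> S2" for s w
    proof -
      have s: "s ^ e \<in> ball 0 \<rho>'" and w: "s ^ p * w \<in> ball 0 \<rho>" using that pw by (auto simp: S2_def)
      have "G (s ^ e, c (s ^ e) + s ^ p * w) = G1 (s ^ e, s ^ p * w)" by (simp add: G1_def)
      also have "\<dots> = (\<Sum>i\<in>I. g i (s ^ e) * (s ^ p * w) ^ i) + (s ^ p * w) ^ m * U (s ^ e, s ^ p * w)"
        using s w \<rho>' by (intro Taylor) auto
      also have "(\<Sum>i\<in>I. g i (s ^ e) * (s ^ p * w) ^ i) = (\<Sum>i\<in>I. s ^ (p * m) * (s ^ k i * u i (s ^ e) * w ^ i))"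
      proof (rule sum.cong)
        fix i assume i: "i \<in> I"
        have "s ^ e \<in> ball 0 R" by (rule \<rho>'R[OF s])
        then have "g i (s ^ e) = (s ^ e) ^ n i * u i (s ^ e)" using R(3)[OF i] by (intro u(5)[OF i]) auto
        then have "g i (s ^ e) * (s ^ p * w) ^ i = s ^ (e * n i + p * i) * u i (s ^ e) * w ^ i"
          by (simp add: power_mult_distrib power_add power_mult)
        then show "g i (s ^ e) * (s ^ p * w) ^ i = s ^ (p * m) * (s ^ k i * u i (s ^ e) * w ^ i)"
          by (simp add: k[OF i] power_add)
      qed simp
      finally show ?thesis
        by (simp add: G2_def sum_distrib_left power_mult_distrib power_mult distrib_left)
    qed
    define T where "T = (\<Sum>i\<in>{i\<in>I. k i = 0}. monom (u i 0) i) + monom (U (0, 0)) m"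
    have cT: "coeff T j = (if j \<in> I \<and> k j = 0 then u j 0 else 0) + (if j = m then U (0, 0) else 0)" for j
    proof -
      have "coeff T j = (\<Sum>i\<in>{i\<in>I. k i = 0}. if i = j then u i 0 else 0) + (if m = j then U (0, 0) else 0)"
        by (simp only: T_def coeff_add coeff_sum coeff_monom)
      also have "(\<Sum>i\<in>{i\<in>I. k i = 0}. if i = j then u i 0 else 0) = (if j \<in> {i\<in>I. k i = 0} then u j 0 else 0)"
        by (rule sum.delta) (use I(1) in auto)
      finally show ?thesis by auto
    qed
    have T: "G2 (0, w) = poly T w" for w
    proof -
      have "(\<Sum>i\<in>I. 0 ^ k i * u i (0 ^ e) * w ^ i) = (\<Sum>i\<in>{i\<in>I. k i = 0}. u i 0 * w ^ i)"
        using I(1) ep by (intro sum.mono_neutral_cong_right) (auto simp: power_0_left)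
      then show ?thesis using ep by (simp add: G2_def T_def poly_sum poly_monom mult.commute power_0_left)
    qed
    have "degree T = m"
    proof (rule antisym)
      show "degree T \<le> m" by (intro degree_le) (auto simp: cT dest: I(3))
      show "m \<le> degree T" using U0 by (intro le_degree) (auto simp: cT dest: I(3))
    qed
    moreover have "coeff T (m - 1) = 0" using I(4) m by (auto simp: cT)
    moreover have "i0 < m" using I(3) i0(1) by blast
    moreover from this have "coeff T i0 \<noteq> 0"
      using i0(1) u(4) by (auto simp: cT k_def e_def p_def mult.commute)
    ultimately obtain w0 where w0: "poly T w0 = 0" "order w0 T < m"
      using exists_root_of_smaller_order by blast
    have "T \<noteq> 0" using \<open>coeff T i0 \<noteq> 0\<close> by auto
    have slice: "(\<lambda>v. G2 (0, v)) = poly T" using T by (simp add: fun_eq_iff)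
    have "\<exists>e' w \<delta>'. 0 < e' \<and> 0 < \<delta>' \<and> w holomorphic_on ball 0 \<delta>' \<and> w 0 = w0 \<and>
      (\<forall>s\<in>ball 0 \<delta>'. (s ^ e', w s) \<in> S2 \<and> G2 (s ^ e', w s) = 0)"
    proof (rule less.IH[OF w0(2) G2 S2])
      show "(0, w0) \<in> S2" using \<rho>' \<rho>(1) ep by (simp add: S2_def power_0_left)
      show "0 < order w0 T" using w0(1) \<open>T \<noteq> 0\<close> by (simp add: order_root)
    qed (unfold slice, use iterated_deriv_poly_at_root[OF \<open>T \<noteq> 0\<close>] in auto)
    then obtain e' w \<delta>' where w: "0 < e'" "0 < \<delta>'" "w holomorphic_on ball 0 \<delta>'"
      "\<And>s. s \<in> ball 0 \<delta>' \<Longrightarrow> (s ^ e', w s) \<in> S2 \<and> G2 (s ^ e', w s) = 0" by blast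
    let ?v = "\<lambda>s. c ((s ^ e') ^ e) + (s ^ e') ^ p * w s"
    have in1: "(s ^ e') ^ e \<in> ball 0 R" if "s \<in> ball 0 \<delta>'" for s :: complex
    proof -
      have *: "s ^ e' \<in> ball 0 \<rho>'" using w(4)[OF that] by (auto simp: S2_def)
      show ?thesis by (rule \<rho>'R[OF pw[OF *]])
    qed
    have "?v holomorphic_on ball 0 \<delta>'"
    proof (intro holomorphic_intros w(3))
      have "(c \<circ> (\<lambda>s. (s ^ e') ^ e)) holomorphic_on ball 0 \<delta>'"
        by (rule holomorphic_on_compose_gen[OF _ cR]) (use in1 in \<open>auto intro!: holomorphic_intros\<close>)
      then show "(\<lambda>s. c ((s ^ e') ^ e)) holomorphic_on ball 0 \<delta>'" by (simp add: o_def)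
    qed
    moreover have "?v 0 = v0" using w(1) ep c0 by (simp add: power_0_left)
    moreover have "(s ^ (e' * e), ?v s) \<in> S \<and> G (s ^ (e' * e), ?v s) = 0" if s: "s \<in> ball 0 \<delta>'" for s
    proof
      have S2s: "(s ^ e', w s) \<in> S2" using w(4)[OF s] by blast
      then have "(s ^ e') ^ e \<in> ball 0 \<rho>'" "(s ^ e') ^ p * w s \<in> ball 0 \<rho>"
        using pw[of "s ^ e'"] by (auto simp: S2_def)
      then have "((s ^ e') ^ e, (s ^ e') ^ p * w s) \<in> S1" using \<rho>' by (intro subsetD[OF \<rho>(2)]) auto
      then show "(s ^ (e' * e), ?v s) \<in> S" by (auto simp: S1_def power_mult)
      show "G (s ^ (e' * e), ?v s) = 0"
        using GG2[OF S2s] w(4)[OF s] by (simp add: power_mult)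
    qed
    ultimately show ?thesis using w(1,2) ep(1)
      by (intro exI[of _ "e' * e"] exI[of _ ?v] exI[of _ \<delta>']) auto
  qed
qed

section \<open>Equivalence of germs and quasi-homogeneous polynomials\<close>

lemma biholomorphic_germ_inverse:
  assumes "biholomorphic_germ \<Phi>"
  obtains U V \<Psi> where "open U" "open V" "0 \<in> U" "0 \<in> V" "homeomorphism U V \<Phi> \<Psi>" "\<Phi> 0 = 0" "\<Psi> 0 = 0"
    "holomorphic2_on (fst \<circ> \<Phi>) U" "holomorphic2_on (snd \<circ> \<Phi>) U"
    "holomorphic2_on (fst \<circ> \<Psi>) V" "holomorphic2_on (snd \<circ> \<Psi>) V" "biholomorphic_germ \<Psi>"
proof -
  obtain U V \<Psi> where *: "\<Phi> 0 = 0" "open U" "open V" "0 \<in> U" "homeomorphism U V \<Phi> \<Psi>"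
      "holomorphic2_on (fst \<circ> \<Phi>) U" "holomorphic2_on (snd \<circ> \<Phi>) U"
      "holomorphic2_on (fst \<circ> \<Psi>) V" "holomorphic2_on (snd \<circ> \<Psi>) V"
    using assms unfolding biholomorphic_germ_def by blast
  have "\<Psi> 0 = 0" using *(1,4,5) unfolding homeomorphism_def by metis
  moreover have "0 \<in> V" using *(1,4,5) unfolding homeomorphism_def by (metis imageI)
  moreover from calculation have "biholomorphic_germ \<Psi>"
    unfolding biholomorphic_germ_def using * homeomorphism_symD by blast
  ultimately show thesis using that * by blast
qed

lemma homeomorphism_tendsto_0:
  fixes \<Phi> :: "complex \<times> complex \<Rightarrow> complex \<times> complex"
  assumes "homeomorphism U V \<Phi> \<Psi>" "open U" "0 \<in> U" "\<Phi> 0 = 0"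
  shows "filterlim \<Phi> (nhds 0) (nhds 0)" "filterlim \<Phi> (at 0) (at 0)"
proof -
  have "isCont \<Phi> 0" using assms continuous_on_eq_continuous_at homeomorphism_def by metis
  then have 1: "(\<Phi> \<longlongrightarrow> 0) (at 0)" using assms(4) by (simp add: isCont_def)
  then show "filterlim \<Phi> (nhds 0) (nhds 0)" using assms(4) by (simp add: tendsto_nhds_iff)
  have "\<forall>\<^sub>F z in at 0. z \<in> U \<and> z \<noteq> 0"
    using eventually_at_in_open[OF assms(2,3)] by eventually_elim auto
  then have "\<forall>\<^sub>F z in at 0. \<Phi> z \<noteq> 0"
  proof eventually_elim
    case (elim z)
    then show ?case using assms unfolding homeomorphism_def by metis
  qed
  with 1 show "filterlim \<Phi> (at 0) (at 0)" by (simp add: filterlim_at)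
qed

lemma analytically_equivalent_sym:
  assumes "analytically_equivalent f g" shows "analytically_equivalent g f"
proof -
  obtain \<Phi> where \<Phi>: "biholomorphic_germ \<Phi>" "\<forall>\<^sub>F z in nhds 0. g z = f (\<Phi> z)"
    using assms unfolding analytically_equivalent_def by blast
  obtain U V \<Psi> where *: "open U" "open V" "0 \<in> U" "0 \<in> V" "homeomorphism U V \<Phi> \<Psi>" "\<Phi> 0 = 0" "\<Psi> 0 = 0"
     "biholomorphic_germ \<Psi>"
    using biholomorphic_germ_inverse[OF \<Phi>(1)] by metis
  have "filterlim \<Psi> (nhds 0) (nhds 0)"
    using homeomorphism_tendsto_0(1)[OF homeomorphism_symD[OF *(5)] *(2,4,7)] .
  from eventually_compose_filterlim[OF \<Phi>(2) this]
  have "\<forall>\<^sub>F z in nhds 0. g (\<Psi> z) = f (\<Phi> (\<Psi> z))" .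
  moreover have "\<forall>\<^sub>F z in nhds 0. z \<in> V" using *(2,4) by (rule eventually_nhds_in_open)
  ultimately have "\<forall>\<^sub>F z in nhds 0. f z = g (\<Psi> z)"
  proof eventually_elim
    case (elim z)
    then show ?case using *(5) unfolding homeomorphism_def by metis
  qed
  then show ?thesis unfolding analytically_equivalent_def using *(8) by blast
qed

lemma biholomorphic_germ_compose:
  assumes "biholomorphic_germ \<Phi>1" "biholomorphic_germ \<Phi>2"
  shows "biholomorphic_germ (\<Phi>1 \<circ> \<Phi>2)"
proof -
  obtain U1 V1 \<Psi>1 where 1: "open U1" "open V1" "0 \<in> U1" "0 \<in> V1" "homeomorphism U1 V1 \<Phi>1 \<Psi>1" "\<Phi>1 0 = 0" "\<Psi>1 0 = 0"
    "holomorphic2_on (fst \<circ> \<Phi>1) U1" "holomorphic2_on (snd \<circ> \<Phi>1) U1"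
    "holomorphic2_on (fst \<circ> \<Psi>1) V1" "holomorphic2_on (snd \<circ> \<Psi>1) V1"
    using biholomorphic_germ_inverse[OF assms(1)] by metis
  obtain U2 V2 \<Psi>2 where 2: "open U2" "open V2" "0 \<in> U2" "0 \<in> V2" "homeomorphism U2 V2 \<Phi>2 \<Psi>2" "\<Phi>2 0 = 0" "\<Psi>2 0 = 0"
    "holomorphic2_on (fst \<circ> \<Phi>2) U2" "holomorphic2_on (snd \<circ> \<Phi>2) U2"
    "holomorphic2_on (fst \<circ> \<Psi>2) V2" "holomorphic2_on (snd \<circ> \<Psi>2) V2"
    using biholomorphic_germ_inverse[OF assms(2)] by metis
  define U V where "U = U2 \<inter> \<Phi>2 -` U1" and "V = V1 \<inter> \<Psi>1 -` V2"
  have c: "continuous_on U2 \<Phi>2" "continuous_on V1 \<Psi>1"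
    using 1(5) 2(5) unfolding homeomorphism_def by auto
  have UV: "open U" "open V" "0 \<in> U"
    unfolding U_def V_def using c 1 2 by (auto intro!: continuous_open_preimage)
  have h: "homeomorphism U V (\<Phi>1 \<circ> \<Phi>2) (\<Psi>2 \<circ> \<Psi>1)"
  proof (rule homeomorphism_compose)
    let ?W = "V2 \<inter> U1"
    have "\<Phi>2 ` U = ?W" using 2(5) unfolding U_def homeomorphism_def by (auto simp: image_iff)
    then show "homeomorphism U ?W \<Phi>2 \<Psi>2"
      using homeomorphism_of_subsets[OF 2(5), of U ?W] unfolding U_def by auto
    have "\<Phi>1 ` ?W = V" using 1(5) unfolding V_def homeomorphism_def by (auto simp: image_iff)
    then show "homeomorphism ?W V \<Phi>1 \<Psi>1"
      using homeomorphism_of_subsets[OF 1(5), of ?W V] unfolding V_def by auto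
  qed
  have "holomorphic2_on (G \<circ> (\<Phi>1 \<circ> \<Phi>2)) U" if "holomorphic2_on (G \<circ> \<Phi>1) U1" for G :: "complex \<times> complex \<Rightarrow> complex"
    using holomorphic2_on_compose[OF that holomorphic2_on_mono[OF 2(8)] holomorphic2_on_mono[OF 2(9)], of U]
    unfolding U_def by (auto simp: o_def)
  moreover have "holomorphic2_on (G \<circ> (\<Psi>2 \<circ> \<Psi>1)) V" if "holomorphic2_on (G \<circ> \<Psi>2) V2" for G :: "complex \<times> complex \<Rightarrow> complex"
    using holomorphic2_on_compose[OF that holomorphic2_on_mono[OF 1(10)] holomorphic2_on_mono[OF 1(11)], of V]
    unfolding V_def by (auto simp: o_def)
  ultimately show ?thesis unfolding biholomorphic_germ_def using UV h 1 2
    by (intro conjI exI[of _ U] exI[of _ V] exI[of _ "\<Psi>2 \<circ> \<Psi>1"]) auto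
qed

lemma analytically_equivalent_trans:
  assumes "analytically_equivalent f g" "analytically_equivalent g h"
  shows "analytically_equivalent f h"
proof -
  obtain \<Phi> where \<Phi>: "biholomorphic_germ \<Phi>" "\<forall>\<^sub>F z in nhds 0. g z = f (\<Phi> z)"
    using assms(1) unfolding analytically_equivalent_def by blast
  obtain \<Theta> where \<Theta>: "biholomorphic_germ \<Theta>" "\<forall>\<^sub>F z in nhds 0. h z = g (\<Theta> z)"
    using assms(2) unfolding analytically_equivalent_def by blast
  obtain U V \<Psi> where *: "open U" "0 \<in> U" "homeomorphism U V \<Theta> \<Psi>" "\<Theta> 0 = 0"
    using biholomorphic_germ_inverse[OF \<Theta>(1)] by metis
  from eventually_compose_filterlim[OF \<Phi>(2) homeomorphism_tendsto_0(1)[OF *(3,1,2,4)]] \<Theta>(2)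
  have "\<forall>\<^sub>F z in nhds 0. h z = f ((\<Phi> \<circ> \<Theta>) z)" by eventually_elim simp
  then show ?thesis unfolding analytically_equivalent_def
    using biholomorphic_germ_compose[OF \<Phi>(1) \<Theta>(1)] by blast
qed

lemma analytically_equivalent_global:
  assumes "\<And>z. g z = f (\<Phi> z)" and "\<Phi> 0 = 0" "\<And>z. \<Psi> (\<Phi> z) = z" "\<And>z. \<Phi> (\<Psi> z) = z"
    and hol: "holomorphic2_on (fst \<circ> \<Phi>) UNIV" "holomorphic2_on (snd \<circ> \<Phi>) UNIV"
    "holomorphic2_on (fst \<circ> \<Psi>) UNIV" "holomorphic2_on (snd \<circ> \<Psi>) UNIV"
  shows "analytically_equivalent f g"
proof -
  have c: "continuous_on UNIV A"
    if "holomorphic2_on (fst \<circ> A) UNIV" "holomorphic2_on (snd \<circ> A) UNIV" for A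
    using continuous_on_Pair[OF that[THEN holomorphic2_on_imp_continuous_on]] by simp
  have "homeomorphism UNIV UNIV \<Phi> \<Psi>"
    unfolding homeomorphism_def using assms(3,4) c hol by (metis UNIV_I surjI)
  then have "biholomorphic_germ \<Phi>" unfolding biholomorphic_germ_def using assms
    by (intro conjI exI[of _ UNIV] exI[of _ \<Psi>]) auto
  then show ?thesis unfolding analytically_equivalent_def using assms(1) by auto
qed

lemma analytically_equivalent_swap: "analytically_equivalent f (\<lambda>z. f (snd z, fst z))"
proof (rule analytically_equivalent_global[where \<Phi> = "\<lambda>z. (snd z, fst z)" and \<Psi> = "\<lambda>z. (snd z, fst z)"])
  show "holomorphic2_on (fst \<circ> (\<lambda>z. (snd z, fst z))) UNIV" "holomorphic2_on (snd \<circ> (\<lambda>z. (snd z, fst z))) UNIV"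
    using holomorphic2_on_fst holomorphic2_on_snd by (simp_all add: o_def)
  then show "holomorphic2_on (fst \<circ> (\<lambda>z. (snd z, fst z))) UNIV" "holomorphic2_on (snd \<circ> (\<lambda>z. (snd z, fst z))) UNIV" .
qed (simp_all add: prod_eq_iff)

lemma analytically_equivalent_shear:
  assumes "\<And>x y. g (x, y) = f (\<alpha> * x, \<beta> * y + \<gamma> * x ^ r)" "\<alpha> \<noteq> 0" "\<beta> \<noteq> 0" "0 < r"
  shows "analytically_equivalent f g"
proof (rule analytically_equivalent_global[where \<Phi> = "\<lambda>z. (\<alpha> * fst z, \<beta> * snd z + \<gamma> * fst z ^ r)"
      and \<Psi> = "\<lambda>z. (1 / \<alpha> * fst z, 1 / \<beta> * snd z + (- \<gamma> / \<beta>) * (1 / \<alpha> * fst z) ^ r)"])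
  show "g z = f (\<alpha> * fst z, \<beta> * snd z + \<gamma> * fst z ^ r)" for z
    using assms(1)[of "fst z" "snd z"] by simp
  show "holomorphic2_on (fst \<circ> (\<lambda>z. (\<alpha> * fst z, \<beta> * snd z + \<gamma> * fst z ^ r))) UNIV"
    "holomorphic2_on (snd \<circ> (\<lambda>z. (\<alpha> * fst z, \<beta> * snd z + \<gamma> * fst z ^ r))) UNIV"
    "holomorphic2_on (fst \<circ> (\<lambda>z. (1 / \<alpha> * fst z, 1 / \<beta> * snd z + (- \<gamma> / \<beta>) * (1 / \<alpha> * fst z) ^ r))) UNIV"
    "holomorphic2_on (snd \<circ> (\<lambda>z. (1 / \<alpha> * fst z, 1 / \<beta> * snd z + (- \<gamma> / \<beta>) * (1 / \<alpha> * fst z) ^ r))) UNIV"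
    by (simp_all only: o_def fst_conv snd_conv) (intro holomorphic2_intros)+
qed (use assms(2-) in \<open>auto simp: prod_eq_iff field_simps\<close>)

text \<open>
  A biholomorphism carries critical points to critical points.
\<close>

lemma isolated_singularity_analytically_equivalent:
  assumes "isolated_singularity f" "analytically_equivalent f g"
  shows "isolated_singularity g"
proof -
  obtain \<Phi> where \<Phi>: "biholomorphic_germ \<Phi>" "\<forall>\<^sub>F z in nhds 0. f z = g (\<Phi> z)"
    using analytically_equivalent_sym[OF assms(2)] unfolding analytically_equivalent_def by blast
  obtain U V \<Psi> where *: "open U" "open V" "0 \<in> U" "0 \<in> V" "homeomorphism U V \<Phi> \<Psi>" "\<Phi> 0 = 0" "\<Psi> 0 = 0"
    "holomorphic2_on (fst \<circ> \<Phi>) U" "holomorphic2_on (snd \<circ> \<Phi>) U"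
    using biholomorphic_germ_inverse[OF \<Phi>(1)] by metis
  obtain W where W: "open W" "0 \<in> W" "\<And>z. z \<in> W \<Longrightarrow> f z = g (\<Phi> z)"
    using \<Phi>(2) unfolding eventually_nhds by blast
  have "\<forall>\<^sub>F z in at 0. z \<in> U \<inter> W \<and> \<not> (f has_derivative (\<lambda>_. 0)) (at z)"
    using assms(1) unfolding isolated_singularity_def
    using eventually_at_in_open'[of "U \<inter> W" 0] *(1,3) W(1,2) by (simp add: eventually_conj_iff open_Int)
  then have "\<forall>\<^sub>F z in at 0. \<not> (g has_derivative (\<lambda>_. 0)) (at (\<Phi> z))"
  proof eventually_elim
    case (elim z)
    show ?case
    proof
      assume g: "(g has_derivative (\<lambda>_. 0)) (at (\<Phi> z))"
      obtain D1 D2 where D: "((fst \<circ> \<Phi>) has_derivative D1) (at z)" "((snd \<circ> \<Phi>) has_derivative D2) (at z)"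
        using *(8,9) elim unfolding holomorphic2_on_def by (metis IntD1)
      have "(\<Phi> has_derivative (\<lambda>h. (D1 h, D2 h))) (at z)"
        using has_derivative_Pair[OF D] by simp
      from has_derivative_compose[OF this g]
      have "((\<lambda>z. g (\<Phi> z)) has_derivative (\<lambda>_. 0)) (at z)" .
      then have "(f has_derivative (\<lambda>_. 0)) (at z)"
        by (rule has_derivative_transform_within_open[OF _ W(1)]) (use elim W(3) in auto)
      then show False using elim by blast
    qed
  qed
  from eventually_compose_filterlim[OF this homeomorphism_tendsto_0(2)[OF homeomorphism_symD[OF *(5)] *(2,4,7)]]
  have "\<forall>\<^sub>F z in at 0. \<not> (g has_derivative (\<lambda>_. 0)) (at (\<Phi> (\<Psi> z)))" .
  moreover have "\<forall>\<^sub>F z in at 0. z \<in> V" using eventually_at_in_open'[OF *(2,4)] .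
  ultimately show ?thesis unfolding isolated_singularity_def
  proof eventually_elim
    case (elim z)
    moreover have "\<Phi> (\<Psi> z) = z" using *(5) elim(2) unfolding homeomorphism_def by blast
    ultimately show ?case by simp
  qed
qed

text \<open>
  A polynomial $R(y) = P(1,y)$ comes from a quasi-homogeneous $P$ of weights $a, b$ and degree $d$
  exactly when each exponent $j$ that occurs can be completed by a power of $x$ to the weighted degree
  $d$.
\<close>

definition weighted :: "nat \<Rightarrow> nat \<Rightarrow> nat \<Rightarrow> complex poly \<Rightarrow> bool"
  where "weighted a b d R \<longleftrightarrow> (\<forall>j. coeff R j \<noteq> 0 \<longrightarrow> b * j \<le> d \<and> a dvd (d - b * j))"

text \<open>
  The quasi-homogeneous polynomial $P$ with $P(1,y) = R(y)$. The integer division is exact on the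
  support of $R$ when \<open>weighted a b d R\<close> holds.
\<close>

definition homogenization :: "nat \<Rightarrow> nat \<Rightarrow> nat \<Rightarrow> complex poly \<Rightarrow> complex \<times> complex \<Rightarrow> complex"
  where "homogenization a b d R z = (\<Sum>j\<le>degree R. coeff R j * fst z ^ ((d - b * j) div a) * snd z ^ j)"

lemma quasi_homogeneous_polyE:
  assumes "quasi_homogeneous_poly a b d P"
  obtains R where "weighted a b d R" "P = homogenization a b d R" "0 < a" "0 < b"
proof -
  obtain c where ab: "0 < a" "0 < b"
    and c: "\<And>x y. P (x, y) = (\<Sum>(i, j)\<in>{(i, j). a * i + b * j = d}. c i j * x ^ i * y ^ j)"
    using assms unfolding quasi_homogeneous_poly_def by blast
  define J where "J = {j. b * j \<le> d \<and> a dvd (d - b * j)}"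
  define k where "k j = (d - b * j) div a" for j
  have "J \<subseteq> {..d}" using ab by (auto simp: J_def) (metis One_nat_def Suc_leI le_trans mult_le_mono1 nat_mult_1)
  then have J: "finite J" using finite_subset by blast
  have k: "a * k j + b * j = d" if "j \<in> J" for j using that by (auto simp: J_def k_def)
  define R where "R = (\<Sum>j\<in>J. monom (c (k j) j) j)"
  have cR: "coeff R j = (if j \<in> J then c (k j) j else 0)" for j
    unfolding R_def coeff_sum coeff_monom using sum.delta[OF J, of j "\<lambda>j. c (k j) j"] by simp
  have "P (x, y) = homogenization a b d R (x, y)" for x y
  proof -
    have "P (x, y) = (\<Sum>j\<in>J. c (k j) j * x ^ k j * y ^ j)"
      unfolding c
    proof (rule sum.reindex_bij_witness[of _ "\<lambda>j. (k j, j)" snd])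
      fix z assume z: "z \<in> {(i, j). a * i + b * j = d}"
      then obtain i j where ij: "z = (i, j)" "a * i + b * j = d" by auto
      then have "d - b * j = a * i" by auto
      then have "k j = i" "j \<in> J" using ab ij(2) by (auto simp: k_def J_def)
      then show "(k (snd z), snd z) = z" "snd z \<in> J"
        "c (k (snd z)) (snd z) * x ^ k (snd z) * y ^ snd z = (case z of (i, j) \<Rightarrow> c i j * x ^ i * y ^ j)"
        using ij by auto
    qed (use k in auto)
    also have "\<dots> = (\<Sum>j\<in>J. coeff R j * x ^ k j * y ^ j)" by (simp add: cR)
    also have "\<dots> = (\<Sum>j\<in>J \<union> {..degree R}. coeff R j * x ^ k j * y ^ j)"
      using J by (intro sum.mono_neutral_left) (auto simp: cR)
    also have "\<dots> = (\<Sum>j\<le>degree R. coeff R j * x ^ k j * y ^ j)"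
      using J by (intro sum.mono_neutral_right) (auto simp: coeff_eq_0)
    finally show ?thesis by (simp add: homogenization_def k_def)
  qed
  moreover have "weighted a b d R" unfolding weighted_def by (auto simp: cR J_def split: if_splits)
  ultimately show thesis using that ab by (metis prod.exhaust ext)
qed

lemma homogenization_scale:
  assumes "weighted a b d R"
  shows "homogenization a b d R (s ^ a * x, s ^ b * y) = s ^ d * homogenization a b d R (x, y)"
proof -
  have *: "coeff R j * (s ^ a * x) ^ ((d - b * j) div a) * (s ^ b * y) ^ j =
      s ^ d * (coeff R j * x ^ ((d - b * j) div a) * y ^ j)" for j
  proof (cases "coeff R j = 0")
    case False
    then have "a * ((d - b * j) div a) + b * j = d"
      using assms unfolding weighted_def by (metis dvd_mult_div_cancel le_add_diff_inverse2)
    then have "s ^ d = (s ^ a) ^ ((d - b * j) div a) * (s ^ b) ^ j"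
      by (metis power_add power_mult)
    then show ?thesis by (simp add: power_mult_distrib)
  qed simp
  show ?thesis unfolding homogenization_def sum_distrib_left fst_conv snd_conv * ..
qed

lemma homogenization_1: "homogenization a b d R (1, y) = poly R y"
  by (simp add: homogenization_def poly_altdef)

lemma homogenization_curve:
  "weighted a b d R \<Longrightarrow> homogenization a b d R (s ^ a, s ^ b * v) = s ^ d * poly R v"
  using homogenization_scale[of a b d R s 1 v] by (simp add: homogenization_1)

lemma holomorphic2_homogenization: "holomorphic2_on (homogenization a b d R) S"
  unfolding homogenization_def[abs_def] by (intro holomorphic2_intros)

text \<open>
  Differentiating $P(s^a, s^b v) = s^d R(v)$ in $v$ gives the first identity; the derivative in $s$,
  combined with it, gives the second, which is Euler's relation.
\<close>

lemma homogenization_partials: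
  assumes "weighted a b d R"
  shows "s ^ b * partial2 (homogenization a b d R) (s ^ a, s ^ b * v) = s ^ d * poly (pderiv R) v"
    and "of_nat a * (s ^ a * partial1 (homogenization a b d R) (s ^ a, s ^ b * v)) =
      s ^ d * poly (smult (of_nat d) R - smult (of_nat b) ([:0, 1:] * pderiv R)) v"
proof -
  let ?P = "homogenization a b d R" and ?z = "(s ^ a, s ^ b * v)"
  have D: "(?P has_derivative (\<lambda>(u, w). partial1 ?P ?z * u + partial2 ?P ?z * w)) (at ?z)"
    using holomorphic2_on_has_derivative[OF holomorphic2_homogenization[of a b d R UNIV]] by simp
  have "((\<lambda>v. ?P (s ^ a, s ^ b * v)) has_field_derivative partial1 ?P ?z * 0 + partial2 ?P ?z * s ^ b) (at v)"
    by (rule has_field_derivative_along_curve[where p = "\<lambda>_. s ^ a" and q = "\<lambda>v. s ^ b * v" and s = v, OF D])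
       (auto intro!: derivative_eq_intros)
  moreover have "((\<lambda>v. s ^ d * poly R v) has_field_derivative s ^ d * poly (pderiv R) v) (at v)"
    by (intro DERIV_cmult poly_DERIV)
  ultimately show 2: "s ^ b * partial2 ?P ?z = s ^ d * poly (pderiv R) v"
    unfolding homogenization_curve[OF assms] using DERIV_unique by (fastforce simp: mult.commute)
  have "((\<lambda>s. ?P (s ^ a, s ^ b * v)) has_field_derivative
      partial1 ?P ?z * (of_nat a * s ^ (a - 1)) + partial2 ?P ?z * (of_nat b * s ^ (b - 1) * v)) (at s)"
    by (rule has_field_derivative_along_curve[where p = "\<lambda>s. s ^ a" and q = "\<lambda>s. s ^ b * v" and s = s, OF D])
       (auto intro!: derivative_eq_intros)
  moreover have "((\<lambda>s. s ^ d * poly R v) has_field_derivative of_nat d * s ^ (d - 1) * poly R v) (at s)"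
    by (auto intro!: derivative_eq_intros)
  ultimately have e: "partial1 ?P ?z * (of_nat a * s ^ (a - 1)) + partial2 ?P ?z * (of_nat b * s ^ (b - 1) * v)
      = of_nat d * s ^ (d - 1) * poly R v"
    unfolding homogenization_curve[OF assms] using DERIV_unique by blast
  have p: "s * (of_nat n * s ^ (n - 1)) = of_nat n * s ^ n" for n by (cases n) auto
  have "partial1 ?P ?z * (s * (of_nat a * s ^ (a - 1))) + partial2 ?P ?z * ((s * (of_nat b * s ^ (b - 1))) * v)
      = (s * (of_nat d * s ^ (d - 1))) * poly R v"
    using arg_cong[OF e, of "(*) s"] by (simp add: algebra_simps)
  then have "of_nat a * (s ^ a * partial1 ?P ?z) + of_nat b * v * (s ^ b * partial2 ?P ?z) = of_nat d * s ^ d * poly R v"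
    unfolding p by (simp add: mult_ac)
  then have "of_nat a * (s ^ a * partial1 ?P ?z) = of_nat d * s ^ d * poly R v - of_nat b * v * (s ^ d * poly (pderiv R) v)"
    unfolding 2 by (simp add: eq_diff_eq)
  then show "of_nat a * (s ^ a * partial1 ?P ?z) = s ^ d * poly (smult (of_nat d) R - smult (of_nat b) ([:0, 1:] * pderiv R)) v"
    by (simp add: algebra_simps)
qed

lemma not_isolated_singularityI:
  assumes "\<And>s. s \<noteq> 0 \<Longrightarrow> (f has_derivative (\<lambda>_. 0)) (at (p s, q s))"
    and "p holomorphic_on UNIV" "q holomorphic_on UNIV" "p 0 = 0" "q 0 = (0::complex)"
    and "\<And>s. s \<noteq> 0 \<Longrightarrow> (p s, q s) \<noteq> 0"
  shows "\<not> isolated_singularity f"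
proof
  assume "isolated_singularity f"
  moreover have "filterlim (\<lambda>s. (p s, q s)) (at 0) (at (0::complex))"
  proof -
    have "(p \<longlongrightarrow> p 0) (at 0)" "(q \<longlongrightarrow> q 0) (at 0)"
      using assms(2,3)[THEN holomorphic_on_imp_continuous_on]
      by (simp_all add: continuous_on_eq_continuous_at isCont_def)
    then have "((\<lambda>s. (p s, q s)) \<longlongrightarrow> 0) (at 0)" using assms(4,5) by (auto simp: zero_prod_def intro!: tendsto_Pair)
    moreover have "\<forall>\<^sub>F s in at 0. (p s, q s) \<noteq> 0"
      using eventually_at_in_open'[of UNIV "0::complex"] assms(6) by (auto simp: eventually_at_filter)
    ultimately show ?thesis by (simp add: filterlim_at)
  qed
  ultimately have "\<forall>\<^sub>F s in at (0::complex). \<not> (f has_derivative (\<lambda>_. 0)) (at (p s, q s))"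
    unfolding isolated_singularity_def by (rule eventually_compose_filterlim)
  moreover have "\<forall>\<^sub>F s in at (0::complex). s \<noteq> 0" by (simp add: eventually_at_filter)
  ultimately have "\<forall>\<^sub>F s in at (0::complex). False" by eventually_elim (use assms(1) in blast)
  then show False by simp
qed

text \<open>
  A common zero of $R$ and its derivative gives a critical curve $y = x^{b/a}\<kappa>$, and a factor
  $x^2$ of $P$ makes the axis $x = 0$ critical. So $R$ is squarefree and its top monomial carries at
  most the first power of $x$; since $a i < b$ for $i \<le> 1$, this determines the degree of $R$ from
  $a, b, d$.
\<close>

lemma isolated_homogenization:
  assumes iso: "isolated_singularity (homogenization a b d R)" and w: "weighted a b d R"
    and ab: "0 < a" "a < b"
  shows "R \<noteq> 0" and "0 < d" and "\<And>x. poly R x = 0 \<Longrightarrow> poly (pderiv R) x \<noteq> 0"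
    and "\<exists>i\<le>1. d = a * i + b * degree R"
proof -
  let ?P = "homogenization a b d R"
  have D: "(?P has_derivative (\<lambda>(u, w). partial1 ?P z * u + partial2 ?P z * w)) (at z)" for z
    using holomorphic2_on_has_derivative[OF holomorphic2_homogenization[of a b d R UNIV]] by simp
  show sqf: "poly (pderiv R) x \<noteq> 0" if x: "poly R x = 0" for x
  proof
    assume x': "poly (pderiv R) x = 0"
    have "(?P has_derivative (\<lambda>_. 0)) (at (s ^ a, s ^ b * x))" if "s \<noteq> 0" for s
    proof -
      have "partial1 ?P (s ^ a, s ^ b * x) = 0" "partial2 ?P (s ^ a, s ^ b * x) = 0"
        using homogenization_partials[OF w, of s x] x x' that ab by auto
      then show ?thesis using D[of "(s ^ a, s ^ b * x)"] by (simp add: case_prod_unfold)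
    qed
    then have "\<not> isolated_singularity ?P"
      by (rule not_isolated_singularityI) (use ab in \<open>auto intro!: holomorphic_intros simp: zero_prod_def\<close>)
    then show False using iso by blast
  qed
  show R: "R \<noteq> 0" using sqf[of 0] by auto
  then have N: "b * degree R \<le> d" "a dvd (d - b * degree R)"
    using w unfolding weighted_def by (auto dest: spec[of _ "degree R"])
  define i where "i = (d - b * degree R) div a"
  have d: "d = a * i + b * degree R" using N by (simp add: i_def)
  have "i \<le> 1"
  proof (rule ccontr)
    assume i: "\<not> i \<le> 1"
    define W where "W z = (\<Sum>j\<le>degree R. coeff R j * fst z ^ ((d - b * j) div a - 2) * snd z ^ j)" for z
    have P: "?P z = fst z ^ 2 * W z" for z
    proof -
      have "coeff R j * fst z ^ ((d - b * j) div a) * snd z ^ j =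
          fst z ^ 2 * (coeff R j * fst z ^ ((d - b * j) div a - 2) * snd z ^ j)" if "j \<le> degree R" for j
      proof -
        have "d - b * degree R \<le> d - b * j" using that by (simp add: diff_le_mono2)
        then have "i \<le> (d - b * j) div a" unfolding i_def by (rule div_le_mono)
        then have "(d - b * j) div a = 2 + ((d - b * j) div a - 2)" using i by simp
        then have "fst z ^ ((d - b * j) div a) = fst z ^ 2 * fst z ^ ((d - b * j) div a - 2)"
          by (metis power_add)
        then show ?thesis by (simp add: mult_ac)
      qed
      then show ?thesis unfolding homogenization_def W_def sum_distrib_left by (intro sum.cong) auto
    qed
    have W: "holomorphic2_on W UNIV" unfolding W_def[abs_def] by (intro holomorphic2_intros)
    have "(?P has_derivative (\<lambda>_. 0)) (at (0, s))" for s
    proof -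
      have "(W has_derivative (\<lambda>(u, v). partial1 W (0, s) * u + partial2 W (0, s) * v)) (at (0, s))"
        using holomorphic2_on_has_derivative[OF W] by simp
      then have "((\<lambda>z. fst z ^ 2 * W z) has_derivative (\<lambda>_. 0)) (at (0, s))"
        by (auto intro!: derivative_eq_intros)
      then show ?thesis by (simp add: P[abs_def])
    qed
    then have "\<not> isolated_singularity ?P"
      by (intro not_isolated_singularityI[where p = "\<lambda>_. 0" and q = "\<lambda>s. s"])
         (auto intro!: holomorphic_intros simp: zero_prod_def)
    then show False using iso by blast
  qed
  then show "\<exists>i\<le>1. d = a * i + b * degree R" using d by blast
  show "0 < d"
  proof (rule ccontr)
    assume "\<not> 0 < d"
    then have "degree R = 0" "d = 0" using d ab by auto
    then have "?P = (\<lambda>_. coeff R 0)" by (simp add: homogenization_def fun_eq_iff)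
    then have "\<not> isolated_singularity ?P"
      by (intro not_isolated_singularityI[where p = "\<lambda>_. 0" and q = "\<lambda>s. s"])
         (auto intro!: holomorphic_intros simp: zero_prod_def)
    then show False using iso by blast
  qed
qed

text \<open>
  An affine substitution in $R$ is induced by $(x,y) \<mapsto> (\<mu>^a x, \<beta> y + \<gamma>
  x^{b/a})$, where $\<mu>^d = \<xi>$ absorbs the factor. The identity is checked at $x = s^a \<noteq>
  0$ and extends to $x = 0$ by continuity.
\<close>

lemma analytically_equivalent_homogenization:
  assumes w: "weighted a b d R1" "weighted a b d R2" and pos: "0 < a" "0 < b" "0 < d"
    and e: "\<And>y. poly R2 y = \<xi> * poly R1 (\<eta> * y + \<gamma>)" and nz: "\<xi> \<noteq> 0" "\<eta> \<noteq> 0"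
    and \<gamma>: "\<gamma> \<noteq> 0 \<Longrightarrow> a dvd b"
  shows "analytically_equivalent (homogenization a b d R1) (homogenization a b d R2)"
proof -
  let ?P1 = "homogenization a b d R1" and ?P2 = "homogenization a b d R2"
  obtain \<mu> where \<mu>: "\<xi> = \<mu> ^ d" using exists_complex_root[of d \<xi>] pos by auto
  have \<mu>0: "\<mu> \<noteq> 0" using \<mu> nz pos by auto
  obtain r where r: "0 < r" "\<gamma> \<noteq> 0 \<Longrightarrow> a * r = b"
  proof (cases "\<gamma> = 0")
    case False
    then obtain r where "b = a * r" using \<gamma> unfolding dvd_def by blast
    then show ?thesis using that[of r] pos by auto
  qed (use that[of 1] in auto)
  have ne: "?P2 (x, y) = ?P1 (\<mu> ^ a * x, (\<mu> ^ b * \<eta>) * y + (\<mu> ^ b * \<gamma>) * x ^ r)" if "x \<noteq> 0" for x y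
  proof -
    obtain s where s: "x = s ^ a" using exists_complex_root[of a x] pos by auto
    then have s0: "s \<noteq> 0" using that pos by auto
    have "?P2 (x, y) = ?P2 (s ^ a, s ^ b * (y / s ^ b))" using s s0 by simp
    also have "\<dots> = (\<mu> * s) ^ d * poly R1 (\<eta> * (y / s ^ b) + \<gamma>)"
      unfolding homogenization_curve[OF w(2)] e \<mu> by (simp add: power_mult_distrib)
    also have "\<dots> = ?P1 ((\<mu> * s) ^ a, (\<mu> * s) ^ b * (\<eta> * (y / s ^ b) + \<gamma>))"
      by (rule homogenization_curve[OF w(1), symmetric])
    also have "(\<mu> * s) ^ b * (\<eta> * (y / s ^ b) + \<gamma>) = (\<mu> ^ b * \<eta>) * y + (\<mu> ^ b * \<gamma>) * x ^ r"
      using s0 r(2) s by (cases "\<gamma> = 0") (auto simp: field_simps simp flip: power_mult)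
    finally show ?thesis by (simp add: s power_mult_distrib)
  qed
  show ?thesis
  proof (rule analytically_equivalent_shear[where \<alpha> = "\<mu> ^ a" and \<beta> = "\<mu> ^ b * \<eta>" and \<gamma> = "\<mu> ^ b * \<gamma>" and r = r])
    fix x y
    let ?g = "\<lambda>x. ?P1 (\<mu> ^ a * x, (\<mu> ^ b * \<eta>) * y + (\<mu> ^ b * \<gamma>) * x ^ r)"
    have c: "continuous_on UNIV (homogenization a b d R)" for R
      by (rule holomorphic2_on_imp_continuous_on[OF holomorphic2_homogenization])
    have 1: "isCont (\<lambda>x. ?P2 (x, y)) 0"
      using continuous_on_compose2[OF c, of UNIV "\<lambda>x. (x, y)"]
      by (simp add: continuous_on_eq_continuous_at continuous_intros)
    have 2: "isCont ?g 0"
      using continuous_on_compose2[OF c, of UNIV "\<lambda>x. (\<mu> ^ a * x, (\<mu> ^ b * \<eta>) * y + (\<mu> ^ b * \<gamma>) * x ^ r)"]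
      by (simp add: continuous_on_eq_continuous_at continuous_intros)
    have "\<forall>\<^sub>F x in at 0. ?P2 (x, y) = ?g x" using ne by (simp add: eventually_at_filter)
    then have "(?g \<longlongrightarrow> ?P2 (0, y)) (at 0)"
      using 1 unfolding isCont_def by (rule Lim_transform_eventually[rotated])
    then have "?P2 (0, y) = ?g 0" using 2 LIM_unique unfolding isCont_def by blast
    then show "?P2 (x, y) = ?g x" using ne by (cases "x = 0") auto
  qed (use nz \<mu>0 r in auto)
qed

section \<open>Weighted limits along arcs\<close>

lemma has_derivative_along_scaled_arc:
  fixes X :: "complex \<times> complex \<Rightarrow> complex"
  assumes X: "(X has_derivative (\<lambda>(u, v). x1 * u + x2 * v)) (at 0)" "X 0 = 0"
    and p: "((\<lambda>s. p s / w s) \<longlongrightarrow> u) F" and q: "((\<lambda>s. q s / w s) \<longlongrightarrow> v) F"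
    and w: "(w \<longlongrightarrow> 0) F" and nz: "\<forall>\<^sub>F s in F. w s \<noteq> 0"
  shows "((\<lambda>s. X (p s, q s) / w s) \<longlongrightarrow> x1 * u + x2 * v) F"
proof -
  have lim0: "((\<lambda>s. (p s, q s)) \<longlongrightarrow> 0) F"
  proof -
    have "((\<lambda>s. p s / w s * w s) \<longlongrightarrow> 0) F" "((\<lambda>s. q s / w s * w s) \<longlongrightarrow> 0) F"
      using tendsto_mult[OF p w] tendsto_mult[OF q w] by auto
    moreover have "\<forall>\<^sub>F s in F. p s / w s * w s = p s" "\<forall>\<^sub>F s in F. q s / w s * w s = q s"
      using nz by (eventually_elim, simp)+
    ultimately have "(p \<longlongrightarrow> 0) F" "(q \<longlongrightarrow> 0) F"
      using Lim_transform_eventually by blast+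
    then show ?thesis by (auto simp: zero_prod_def intro: tendsto_Pair)
  qed
  define r where "r z = X z - (x1 * fst z + x2 * snd z)" for z
  have "((\<lambda>s. r (p s, q s) / w s) \<longlongrightarrow> 0) F"
  proof (rule tendstoI)
    fix e :: real assume e: "e > 0"
    define C where "C = norm u + norm v + 2"
    have C: "C > 0" by (simp add: C_def add_nonneg_pos)
    have "\<exists>\<delta>>0. \<forall>z. norm z < \<delta> \<longrightarrow> norm (r z) \<le> e / (2 * C) * norm z"
    proof -
      have "\<forall>e>0. \<exists>\<delta>>0. \<forall>z. norm z < \<delta> \<longrightarrow> norm (r z) \<le> e * norm z"
        using X unfolding has_derivative_at_alt r_def by (simp add: case_prod_unfold)
      moreover have "e / (2 * C) > 0" using e C by simp
      ultimately show ?thesis by blast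
    qed
    then obtain \<delta> where \<delta>: "\<delta> > 0" "\<And>z. norm z < \<delta> \<Longrightarrow> norm (r z) \<le> e / (2 * C) * norm z" by blast
    have "\<forall>\<^sub>F s in F. norm (p s, q s) < \<delta>" using tendstoD[OF lim0 \<delta>(1)] by (simp add: dist_norm)
    moreover have "\<forall>\<^sub>F s in F. dist (p s / w s) u < 1" "\<forall>\<^sub>F s in F. dist (q s / w s) v < 1"
      using tendstoD[OF p, of 1] tendstoD[OF q, of 1] by auto
    ultimately show "\<forall>\<^sub>F s in F. dist (r (p s, q s) / w s) 0 < e" using nz
    proof eventually_elim
      case (elim s)
      have "norm (p s / w s) < norm u + 1" "norm (q s / w s) < norm v + 1"
        using elim(2,3) norm_triangle_ineq2[of "p s / w s" u] norm_triangle_ineq2[of "q s / w s" v]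
        by (auto simp: dist_norm)
      then have "norm (p s) + norm (q s) \<le> C * norm (w s)"
        using elim(4) by (simp add: C_def norm_divide field_simps)
      moreover have "norm (p s, q s) \<le> norm (p s) + norm (q s)" by (rule norm_Pair_le)
      ultimately have "norm (p s, q s) \<le> C * norm (w s)" by linarith
      then have "norm (r (p s, q s)) \<le> e / (2 * C) * (C * norm (w s))"
        using \<delta>(2)[OF elim(1)] e C by (meson divide_nonneg_pos mult_left_mono mult_pos_pos order_trans zero_less_numeral less_imp_le)
      also have "\<dots> = e / 2 * norm (w s)" using C by simp
      also have "\<dots> < e * norm (w s)" using e elim(4) by simp
      finally show ?case using elim(4) by (simp add: norm_divide field_simps)
    qed
  qed
  moreover have "((\<lambda>s. x1 * (p s / w s) + x2 * (q s / w s)) \<longlongrightarrow> x1 * u + x2 * v) F"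
    by (intro tendsto_intros p q)
  ultimately have "((\<lambda>s. r (p s, q s) / w s + (x1 * (p s / w s) + x2 * (q s / w s))) \<longlongrightarrow> 0 + (x1 * u + x2 * v)) F"
    by (rule tendsto_add)
  then show ?thesis by (simp add: r_def diff_divide_distrib add_divide_distrib)
qed

text \<open>
  Write $x(s) = s^M u(s)$ with $u(0) = u_1 \<noteq> 0$ and invert the map $s u(s)^{1/M}$. The
  prescribed number $r_0$ selects one of the $M$-th roots.
\<close>

lemma reparametrisation:
  assumes x: "x holomorphic_on ball 0 \<delta>" "0 < \<delta>" "0 < M"
    and lim: "((\<lambda>s. x s / s ^ M) \<longlongrightarrow> u1) (at 0)" and r0: "r0 ^ M * u1 = 1"
  obtains \<psi> \<epsilon> where "0 < \<epsilon>" "\<psi> holomorphic_on ball 0 \<epsilon>" "\<psi> 0 = 0" "\<And>s. s \<in> ball 0 \<epsilon> \<Longrightarrow> \<psi> s \<in> ball 0 \<delta>"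
    "\<And>s. s \<in> ball 0 \<epsilon> \<Longrightarrow> x (\<psi> s) = s ^ M" "\<And>s. s \<in> ball 0 \<epsilon> \<Longrightarrow> s \<noteq> 0 \<Longrightarrow> \<psi> s \<noteq> 0"
    "((\<lambda>s. \<psi> s / s) \<longlongrightarrow> r0) (at 0)"
proof -
  have u1: "u1 \<noteq> 0" and r0n: "r0 \<noteq> 0" using r0 x(3) by (auto simp: power_0_left)
  have cx: "isCont x 0" using x(1,2) holomorphic_on_imp_continuous_on continuous_on_eq_continuous_at
    by (metis centre_in_ball open_ball)
  have "((\<lambda>s. x s / s ^ M * s ^ M) \<longlongrightarrow> u1 * 0 ^ M) (at 0)" by (intro tendsto_intros lim)
  moreover have "\<forall>\<^sub>F s in at 0. x s / s ^ M * s ^ M = x s" by (simp add: eventually_at_filter)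
  ultimately have "(x \<longlongrightarrow> u1 * 0 ^ M) (at 0)" by (rule Lim_transform_eventually)
  then have x0: "x 0 = 0" using cx x(3) LIM_unique unfolding isCont_def by fastforce
  obtain u r n where u: "0 < r" "0 < n" "u holomorphic_on ball 0 r" "u 0 \<noteq> 0" "\<And>t. t \<in> ball 0 r \<Longrightarrow> x t = t ^ n * u t"
  proof (rule holomorphic_factor_or_zero[OF x(1,2) x0])
    assume z: "\<And>t. t \<in> ball 0 \<delta> \<Longrightarrow> x t = 0"
    have "\<forall>\<^sub>F s in at 0. s \<in> ball 0 \<delta>" using x(2) by (intro eventually_at_in_open') auto
    then have "\<forall>\<^sub>F s in at 0. x s / s ^ M = 0" by eventually_elim (simp add: z)
    then have "((\<lambda>s. x s / s ^ M) \<longlongrightarrow> 0) (at 0)" by (simp add: tendsto_eventually)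
    then show thesis using lim u1 LIM_unique by blast
  qed blast
  have cu: "(u \<longlongrightarrow> u 0) (at 0)"
    using u(1,3) holomorphic_on_imp_continuous_on continuous_on_eq_continuous_at
    by (metis centre_in_ball open_ball isCont_def)
  have ev: "\<forall>\<^sub>F s in at 0. s \<in> ball 0 r \<and> s \<noteq> (0::complex)"
    using u(1) eventually_at_in_open[of "ball 0 r" "0::complex"] by auto
  have nM: "n = M"
  proof (rule ccontr)
    assume "n \<noteq> M"
    then consider "M < n" | "n < M" by linarith
    then show False
    proof cases
      case 1
      have "((\<lambda>s. s ^ (n - M) * u s) \<longlongrightarrow> 0 ^ (n - M) * u 0) (at 0)" by (intro tendsto_intros cu)
      moreover have "\<forall>\<^sub>F s in at 0. s ^ (n - M) * u s = x s / s ^ M"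
        using ev by eventually_elim (use 1 u(5) in \<open>auto simp: power_diff field_simps\<close>)
      ultimately have "((\<lambda>s. x s / s ^ M) \<longlongrightarrow> 0 ^ (n - M) * u 0) (at 0)" by (rule Lim_transform_eventually)
      then show False using LIM_unique[OF lim] u1 1 by auto
    next
      case 2
      have "((\<lambda>s. s ^ (M - n) * (x s / s ^ M)) \<longlongrightarrow> 0 ^ (M - n) * u1) (at 0)" by (intro tendsto_intros lim)
      moreover have "\<forall>\<^sub>F s in at 0. s ^ (M - n) * (x s / s ^ M) = u s"
        using ev by eventually_elim (use 2 u(5) in \<open>auto simp: power_diff field_simps\<close>)
      ultimately have "(u \<longlongrightarrow> 0 ^ (M - n) * u1) (at 0)" by (rule Lim_transform_eventually)
      then show False using LIM_unique[OF cu] u(4) 2 by auto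
    qed
  qed
  have "\<forall>\<^sub>F s in at 0. u s = x s / s ^ M" using ev by eventually_elim (use u(5) nM in auto)
  then have "((\<lambda>s. x s / s ^ M) \<longlongrightarrow> u 0) (at 0)" using cu by (rule Lim_transform_eventually[rotated])
  then have u0: "u 0 = u1" using LIM_unique[OF lim] by blast
  \<comment> \<open>On a small disc $u / u_1$ avoids the cut of the principal logarithm.\<close>
  have "isCont (\<lambda>s. u s / u1) 0" using cu u1 unfolding isCont_def by (intro tendsto_intros)
  then have "\<exists>\<rho>>0. \<forall>s. dist s 0 < \<rho> \<longrightarrow> dist (u s / u1) (u 0 / u1) < 1"
    unfolding continuous_at_eps_delta by (metis zero_less_one)
  then obtain \<rho>0 where \<rho>0: "\<rho>0 > 0" "\<And>s. norm s < \<rho>0 \<Longrightarrow> norm (u s / u1 - 1) < 1"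
    using u0 u1 by (auto simp: dist_norm)
  define \<rho> where "\<rho> = min (min \<rho>0 r) \<delta>"
  have \<rho>: "0 < \<rho>" "\<rho> \<le> \<rho>0" "\<rho> \<le> r" "\<rho> \<le> \<delta>" using \<rho>0 u(1) x(2) by (auto simp: \<rho>_def)
  have nonpos: "u s / u1 \<notin> \<real>\<^sub>\<le>\<^sub>0" if "s \<in> ball 0 \<rho>" for s
  proof
    assume "u s / u1 \<in> \<real>\<^sub>\<le>\<^sub>0"
    then obtain t where t: "u s / u1 = of_real t" "t \<le> 0" by (auto elim: nonpos_Reals_cases)
    then have "norm (u s / u1 - 1) = \<bar>t - 1\<bar>" by (metis norm_of_real of_real_1 of_real_diff)
    then show False using \<rho>0(2)[of s] \<rho>(2) that t by auto
  qed
  define ch where "ch s = s * (1 / r0 * exp (Ln (u s / u1) / of_nat M))" for s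
  have hol: "ch holomorphic_on ball 0 \<rho>"
    unfolding ch_def using nonpos \<rho>(3) u1 r0n x(3)
    by (intro holomorphic_intros holomorphic_on_subset[OF u(3)]) auto
  have chM: "ch s ^ M = x s" if "s \<in> ball 0 \<rho>" for s
  proof -
    have "u s / u1 \<noteq> 0" using nonpos[OF that] by auto
    then have "exp (Ln (u s / u1) / of_nat M) ^ M = u s / u1"
      using x(3) by (simp flip: exp_of_nat_mult)
    then have "ch s ^ M = s ^ M * (1 / r0 ^ M * (u s / u1))"
      by (simp add: ch_def power_mult_distrib power_divide)
    also have "1 / r0 ^ M = u1" using r0 r0n by (simp add: field_simps)
    finally show ?thesis using u(5)[of s] that \<rho>(3) nM u1 by auto
  qed
  have "((\<lambda>s. 1 / r0 * exp (Ln (u s / u1) / of_nat M)) \<longlongrightarrow> 1 / r0 * exp (Ln (u 0 / u1) / of_nat M)) (at 0)"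
    using cu u1 u0 x(3) r0n by (intro tendsto_intros) auto
  moreover have "\<forall>\<^sub>F s in at 0. 1 / r0 * exp (Ln (u s / u1) / of_nat M) = ch s / s"
    by (simp add: eventually_at_filter ch_def)
  ultimately have "((\<lambda>s. ch s / s) \<longlongrightarrow> 1 / r0 * exp (Ln (u 0 / u1) / of_nat M)) (at 0)"
    by (rule Lim_transform_eventually)
  then have "((\<lambda>s. ch s / s) \<longlongrightarrow> 1 / r0) (at 0)" using u0 u1 by simp
  then have D: "(ch has_field_derivative 1 / r0) (at 0)"
    by (simp add: has_field_derivative_iff ch_def)
  then have dch: "deriv ch 0 \<noteq> 0" using r0n by (simp add: DERIV_imp_deriv)
  have "(0::complex) \<in> ball 0 \<rho>" using \<rho>(1) by simp
  from has_complex_derivative_locally_invertible[OF hol this open_ball dch]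
  obtain \<rho>1 where \<rho>1: "\<rho>1 > 0" "ball (0::complex) \<rho>1 \<subseteq> ball 0 \<rho>" "open (ch ` ball 0 \<rho>1)" "inj_on ch (ball 0 \<rho>1)"
    by metis
  have hol1: "ch holomorphic_on ball 0 \<rho>1" using hol \<rho>1(2) by (rule holomorphic_on_subset)
  obtain \<psi> where \<psi>: "\<psi> holomorphic_on ch ` ball 0 \<rho>1" "\<And>z. z \<in> ball 0 \<rho>1 \<Longrightarrow> deriv ch z * deriv \<psi> (ch z) = 1"
      "\<And>z. z \<in> ball 0 \<rho>1 \<Longrightarrow> \<psi> (ch z) = z"
  proof (rule holomorphic_has_inverse[OF hol1 open_ball \<rho>1(4)])
    fix g assume "g holomorphic_on ch ` ball 0 \<rho>1" "\<And>z. z \<in> ball 0 \<rho>1 \<Longrightarrow> deriv ch z * deriv g (ch z) = 1"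
      "\<And>z. z \<in> ball 0 \<rho>1 \<Longrightarrow> g (ch z) = z"
    then show thesis by (rule that)
  qed
  have ch0: "ch 0 = 0" by (simp add: ch_def)
  have "0 \<in> ch ` ball 0 \<rho>1" using ch0 \<rho>1(1) by (metis centre_in_ball imageI)
  then obtain \<epsilon> where \<epsilon>: "\<epsilon> > 0" "ball (0::complex) \<epsilon> \<subseteq> ch ` ball 0 \<rho>1" using \<rho>1(3) openE by blast
  have inv: "\<psi> s \<in> ball 0 \<rho>1 \<and> ch (\<psi> s) = s" if "s \<in> ball 0 \<epsilon>" for s
    using that \<epsilon>(2) \<psi>(3) by fastforce
  have \<psi>0: "\<psi> 0 = 0" using \<psi>(3)[of 0] ch0 \<rho>1(1) by simp
  show thesis
  proof (rule that[OF \<epsilon>(1)])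
    show "\<psi> holomorphic_on ball 0 \<epsilon>" using \<psi>(1) \<epsilon>(2) by (rule holomorphic_on_subset)
    show "\<psi> 0 = 0" by fact
    fix s :: complex assume s: "s \<in> ball 0 \<epsilon>"
    show "\<psi> s \<in> ball 0 \<delta>" using inv[OF s] subsetD[OF \<rho>1(2)] \<rho>(4) by fastforce
    show "x (\<psi> s) = s ^ M" using chM[of "\<psi> s"] inv[OF s] \<rho>1(2) by auto
    show "\<psi> s \<noteq> 0" if "s \<noteq> 0" using inv[OF s] that ch0 by auto
  next
    have "deriv \<psi> 0 = r0" using \<psi>(2)[of 0] \<rho>1(1) ch0 DERIV_imp_deriv[OF D] r0n by (simp add: field_simps)
    moreover have "\<psi> field_differentiable at 0"
      using \<psi>(1) \<rho>1(3) \<open>0 \<in> ch ` ball 0 \<rho>1\<close> holomorphic_on_imp_differentiable_at by blast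
    ultimately have "(\<psi> has_field_derivative r0) (at 0)" by (metis field_differentiable_derivI)
    then show "((\<lambda>s. \<psi> s / s) \<longlongrightarrow> r0) (at 0)" by (simp add: has_field_derivative_iff \<psi>0)
  qed
qed

lemma homogenization_tendsto_quasi:
  assumes w: "weighted a b d R" and X: "((\<lambda>s. X s / w s ^ a) \<longlongrightarrow> u) F" "((\<lambda>s. Y s / w s ^ b) \<longlongrightarrow> v) F"
    and nz: "\<forall>\<^sub>F s in F. w s \<noteq> 0"
  shows "((\<lambda>s. homogenization a b d R (X s, Y s) / w s ^ d) \<longlongrightarrow> homogenization a b d R (u, v)) F"
proof -
  have "isCont (homogenization a b d R) (u, v)"
    using holomorphic2_on_imp_continuous_on[OF holomorphic2_homogenization[of a b d R UNIV]]
    by (simp add: continuous_on_eq_continuous_at)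
  then have "((\<lambda>s. homogenization a b d R (X s / w s ^ a, Y s / w s ^ b)) \<longlongrightarrow> homogenization a b d R (u, v)) F"
    by (rule isCont_tendsto_compose) (intro tendsto_Pair X)
  moreover have "\<forall>\<^sub>F s in F. homogenization a b d R (X s / w s ^ a, Y s / w s ^ b) = homogenization a b d R (X s, Y s) / w s ^ d"
    using nz
  proof eventually_elim
    case (elim s)
    then show ?case using homogenization_scale[OF w, of "w s" "X s / w s ^ a" "Y s / w s ^ b"] by simp
  qed
  ultimately show ?thesis by (rule Lim_transform_eventually)
qed

text \<open>
  For weights $p, q$ with $q/p < b/a$ the monomial of largest degree in $y$ is the only one of minimal
  weight.
\<close>

lemma homogenization_tendsto_top:
  assumes w: "weighted a b d R" and X: "((\<lambda>s. X s / w s ^ p) \<longlongrightarrow> u) F" "((\<lambda>s. Y s / w s ^ q) \<longlongrightarrow> v) F"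
    and nz: "\<forall>\<^sub>F s in F. w s \<noteq> 0" and w0: "(w \<longlongrightarrow> 0) F"
    and d: "d = a * i + b * degree R" and pq: "a * q < b * p" and a: "0 < a"
  shows "((\<lambda>s. homogenization a b d R (X s, Y s) / w s ^ (p * i + q * degree R)) \<longlongrightarrow> lead_coeff R * u ^ i * v ^ degree R) F"
proof -
  let ?N = "degree R"
  let ?k = "\<lambda>j. (d - b * j) div a"
  let ?D = "p * i + q * ?N"
  have exps: "?D \<le> p * ?k j + q * j \<and> (j < ?N \<longrightarrow> ?D < p * ?k j + q * j)"
    if c: "coeff R j \<noteq> 0" and jN: "j \<le> ?N" for j
  proof -
    have e: "a * ?k j + b * j = d"
      using w c unfolding weighted_def by (metis dvd_mult_div_cancel le_add_diff_inverse2)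
    obtain l where l: "?N = j + l" using jN le_Suc_ex by blast
    have *: "a * ?k j = a * i + b * l" using e d l by (simp add: algebra_simps)
    have "a * (p * ?k j + q * j) = a * ?D + (b * p * l - a * q * l)"
    proof -
      have "a * (p * ?k j + q * j) = p * (a * ?k j) + a * q * j" by (simp add: algebra_simps)
      also have "\<dots> = p * (a * i) + b * p * l + a * q * j" by (simp add: * algebra_simps)
      also have "\<dots> = a * ?D + (b * p * l - a * q * l)"
        using pq l mult_le_mono1[of "a * q" "b * p" l] by (simp add: algebra_simps)
      finally show ?thesis .
    qed
    moreover have "l > 0 \<Longrightarrow> a * q * l < b * p * l" using pq by simp
    ultimately have "a * ?D \<le> a * (p * ?k j + q * j)" "l > 0 \<Longrightarrow> a * ?D < a * (p * ?k j + q * j)"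
      by linarith+
    then show ?thesis using a l by auto
  qed
  have "((\<lambda>s. coeff R j * (X s) ^ ?k j * (Y s) ^ j / w s ^ ?D) \<longlongrightarrow>
      (if j = ?N then lead_coeff R * u ^ i * v ^ ?N else 0)) F" if j: "j \<le> ?N" for j
  proof (cases "coeff R j = 0")
    case True
    then show ?thesis using j by auto
  next
    case False
    let ?e = "p * ?k j + q * j - ?D"
    have "((\<lambda>s. coeff R j * (X s / w s ^ p) ^ ?k j * (Y s / w s ^ q) ^ j * w s ^ ?e) \<longlongrightarrow>
        coeff R j * u ^ ?k j * v ^ j * 0 ^ ?e) F"
      by (intro tendsto_intros X w0)
    moreover have "\<forall>\<^sub>F s in F. coeff R j * (X s / w s ^ p) ^ ?k j * (Y s / w s ^ q) ^ j * w s ^ ?e =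
        coeff R j * (X s) ^ ?k j * (Y s) ^ j / w s ^ ?D"
      using nz
    proof eventually_elim
      case (elim s)
      have "w s ^ ?e = w s ^ (p * ?k j) * w s ^ (q * j) / w s ^ ?D"
        using exps[OF False j] elim by (simp add: power_diff power_add)
      then show ?case using elim by (simp add: power_divide power_mult)
    qed
    ultimately have "((\<lambda>s. coeff R j * (X s) ^ ?k j * (Y s) ^ j / w s ^ ?D) \<longlongrightarrow> coeff R j * u ^ ?k j * v ^ j * 0 ^ ?e) F"
      by (rule Lim_transform_eventually)
    moreover have "coeff R j * u ^ ?k j * v ^ j * 0 ^ ?e = (if j = ?N then lead_coeff R * u ^ i * v ^ ?N else 0)"
    proof (cases "j = ?N")
      case True
      then have "?k j = i" using d a by simp
      then show ?thesis using True by simp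
    next
      case False
      then have "?e > 0" using exps[OF \<open>coeff R j \<noteq> 0\<close> j] j by auto
      then show ?thesis using False by simp
    qed
    ultimately show ?thesis by simp
  qed
  then have "((\<lambda>s. \<Sum>j\<le>?N. coeff R j * (X s) ^ ?k j * (Y s) ^ j / w s ^ ?D) \<longlongrightarrow>
      (\<Sum>j\<le>?N. if j = ?N then lead_coeff R * u ^ i * v ^ ?N else 0)) F"
    by (intro tendsto_sum) auto
  then show ?thesis by (simp add: homogenization_def sum_divide_distrib)
qed

section \<open>Tangent cone and polar equation\<close>

lemma initial_form_unique:
  assumes "initial_form f \<nu> F" "initial_form f \<nu>' F'"
  shows "\<nu> = \<nu>'" "F = F'"
proof -
  have le: "\<not> \<nu> < \<nu>'" if A: "initial_form f \<nu> F" "initial_form f \<nu>' F'" for \<nu> \<nu>' F F'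
  proof
    assume l: "\<nu> < \<nu>'"
    have "F (x, y) = 0" for x y
    proof -
      have "((\<lambda>\<tau>. f (\<tau> * x, \<tau> * y) / \<tau> ^ \<nu>' * \<tau> ^ (\<nu>' - \<nu>)) \<longlongrightarrow> F' (x, y) * 0 ^ (\<nu>' - \<nu>)) (at 0)"
        using A(2) unfolding initial_form_def by (intro tendsto_intros) auto
      moreover have "\<forall>\<^sub>F \<tau> in at 0. f (\<tau> * x, \<tau> * y) / \<tau> ^ \<nu>' * \<tau> ^ (\<nu>' - \<nu>) = f (\<tau> * x, \<tau> * y) / \<tau> ^ \<nu>"
        using l by (auto simp: eventually_at_filter power_diff)
      ultimately have "((\<lambda>\<tau>. f (\<tau> * x, \<tau> * y) / \<tau> ^ \<nu>) \<longlongrightarrow> F' (x, y) * 0 ^ (\<nu>' - \<nu>)) (at 0)"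
        by (rule Lim_transform_eventually)
      moreover have "((\<lambda>\<tau>. f (\<tau> * x, \<tau> * y) / \<tau> ^ \<nu>) \<longlongrightarrow> F (x, y)) (at 0)"
        using A(1) unfolding initial_form_def by blast
      ultimately show "F (x, y) = 0" using LIM_unique l by fastforce
    qed
    then show False using A(1) unfolding initial_form_def by auto
  qed
  show "\<nu> = \<nu>'" using le[OF assms] le[OF assms(2,1)] by simp
  then have "F (x, y) = F' (x, y)" for x y
    using assms LIM_unique unfolding initial_form_def by blast
  then show "F = F'" by auto
qed

text \<open>
  The setting of the next sections: a miniregular germ $f = P \<circ> \<Phi>$, where $P$ is the
  homogenization of $R$ and $\<Phi> = (X,Y)$ has the inverse $(X',Y')$. The bound on the degree of $R$
  leaves out the smooth germs and the Morse germs $x y$.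
\<close>

locale weighted_germ =
  fixes a b d :: nat and R :: "complex poly" and f :: "complex \<times> complex \<Rightarrow> complex"
    and X Y X' Y' :: "complex \<times> complex \<Rightarrow> complex" and U V :: "(complex \<times> complex) set"
  assumes ab: "0 < a" "a < b" and w: "weighted a b d R"
    and iso: "isolated_singularity (homogenization a b d R)" and N: "2 \<le> degree R"
    and UV: "open U" "open V" "0 \<in> U" "0 \<in> V"
    and hol: "holomorphic2_on X U" "holomorphic2_on Y U" "holomorphic2_on X' V" "holomorphic2_on Y' V"
    and maps: "\<And>z. z \<in> U \<Longrightarrow> (X z, Y z) \<in> V" "\<And>z. z \<in> V \<Longrightarrow> (X' z, Y' z) \<in> U"
    and inv: "\<And>z. z \<in> U \<Longrightarrow> (X' (X z, Y z), Y' (X z, Y z)) = z"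
      "\<And>z. z \<in> V \<Longrightarrow> (X (X' z, Y' z), Y (X' z, Y' z)) = z"
    and zero: "X 0 = 0" "Y 0 = 0" "X' 0 = 0" "Y' 0 = 0"
    and f: "\<And>z. z \<in> U \<Longrightarrow> f z = homogenization a b d R (X z, Y z)"
    and mini: "miniregular f"
begin

abbreviation "P \<equiv> homogenization a b d R"
text \<open>
  The linear part of $\<Phi>$ is $(x_1 x + x_2 y, y_1 x + y_2 y)$.
\<close>

definition "x1 = partial1 X 0"
definition "x2 = partial2 X 0"
definition "y1 = partial1 Y 0"
definition "y2 = partial2 Y 0"
text \<open>
  The slope of the preimage of the line $Y = 0$ under the linear part of $\<Phi>$.
\<close>

definition "slope = - y1 / y2"
definition "i0 = (SOME i. i \<le> 1 \<and> d = a * i + b * degree R)"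

lemma i0: "i0 \<le> 1" "d = a * i0 + b * degree R"
  using someI_ex[of "\<lambda>i. i \<le> 1 \<and> d = a * i + b * degree R"] isolated_homogenization(4)[OF iso w ab]
  unfolding i0_def by auto

lemma d_pos: "0 < d" using isolated_homogenization(2)[OF iso w ab] .

lemma DX: "(X has_derivative (\<lambda>(u, v). x1 * u + x2 * v)) (at 0)"
  and DY: "(Y has_derivative (\<lambda>(u, v). y1 * u + y2 * v)) (at 0)"
  unfolding x1_def x2_def y1_def y2_def
  using holomorphic2_on_has_derivative[OF hol(1) UV(3)] holomorphic2_on_has_derivative[OF hol(2) UV(3)] by auto

lemma linear_part_invertible:
  obtains u1 u2 w1 w2 where "u1 * x1 + u2 * y1 = 1" "u1 * x2 + u2 * y2 = 0"
    "w1 * x1 + w2 * y1 = 0" "w1 * x2 + w2 * y2 = 1" "x1 * y2 - x2 * y1 \<noteq> 0"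
    "(X' has_derivative (\<lambda>(u, v). u1 * u + u2 * v)) (at 0)" "(Y' has_derivative (\<lambda>(u, v). w1 * u + w2 * v)) (at 0)"
proof -
  have D: "((\<lambda>z. (X z, Y z)) has_derivative (\<lambda>h. ((\<lambda>(u, v). x1 * u + x2 * v) h, (\<lambda>(u, v). y1 * u + y2 * v) h))) (at 0)"
    by (intro has_derivative_Pair DX DY)
  define u1 u2 w1 w2 where "u1 = partial1 X' 0" and "u2 = partial2 X' 0" and "w1 = partial1 Y' 0" and "w2 = partial2 Y' 0"
  have X': "(X' has_derivative (\<lambda>(u, v). u1 * u + u2 * v)) (at 0)" and Y': "(Y' has_derivative (\<lambda>(u, v). w1 * u + w2 * v)) (at 0)"
    unfolding u1_def u2_def w1_def w2_def
    using holomorphic2_on_has_derivative[OF hol(3) UV(4)] holomorphic2_on_has_derivative[OF hol(4) UV(4)] by auto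
  have at: "at (X 0, Y 0) = at (0 :: complex \<times> complex)" using zero by (simp add: zero_prod_def)
  have "((\<lambda>z. X' (X z, Y z)) has_derivative (\<lambda>h. (\<lambda>(u, v). u1 * u + u2 * v) ((\<lambda>(u, v). x1 * u + x2 * v) h, (\<lambda>(u, v). y1 * u + y2 * v) h))) (at 0)"
    by (rule has_derivative_compose[OF D]) (use X' at in simp)
  then have "(fst has_derivative (\<lambda>h. (\<lambda>(u, v). u1 * u + u2 * v) ((\<lambda>(u, v). x1 * u + x2 * v) h, (\<lambda>(u, v). y1 * u + y2 * v) h))) (at 0)"
    by (rule has_derivative_transform_within_open[OF _ UV(1,3)]) (use inv(1) in \<open>metis fst_conv\<close>)
  moreover have "(fst has_derivative fst) (at (0 :: complex \<times> complex))" by (auto intro!: derivative_eq_intros)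
  ultimately have "(\<lambda>h. (\<lambda>(u, v). u1 * u + u2 * v) ((\<lambda>(u, v). x1 * u + x2 * v) h, (\<lambda>(u, v). y1 * u + y2 * v) h)) = fst"
    by (rule has_derivative_unique)
  from fun_cong[OF this, of "(1, 0)"] fun_cong[OF this, of "(0, 1)"]
  have 1: "u1 * x1 + u2 * y1 = 1" "u1 * x2 + u2 * y2 = 0" by auto
  have "((\<lambda>z. Y' (X z, Y z)) has_derivative (\<lambda>h. (\<lambda>(u, v). w1 * u + w2 * v) ((\<lambda>(u, v). x1 * u + x2 * v) h, (\<lambda>(u, v). y1 * u + y2 * v) h))) (at 0)"
    by (rule has_derivative_compose[OF D]) (use Y' at in simp)
  then have "(snd has_derivative (\<lambda>h. (\<lambda>(u, v). w1 * u + w2 * v) ((\<lambda>(u, v). x1 * u + x2 * v) h, (\<lambda>(u, v). y1 * u + y2 * v) h))) (at 0)"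
    by (rule has_derivative_transform_within_open[OF _ UV(1,3)]) (use inv(1) in \<open>metis snd_conv\<close>)
  moreover have "(snd has_derivative snd) (at (0 :: complex \<times> complex))" by (auto intro!: derivative_eq_intros)
  ultimately have "(\<lambda>h. (\<lambda>(u, v). w1 * u + w2 * v) ((\<lambda>(u, v). x1 * u + x2 * v) h, (\<lambda>(u, v). y1 * u + y2 * v) h)) = snd"
    by (rule has_derivative_unique)
  from fun_cong[OF this, of "(1, 0)"] fun_cong[OF this, of "(0, 1)"]
  have 2: "w1 * x1 + w2 * y1 = 0" "w1 * x2 + w2 * y2 = 1" by auto
  have "(u1 * w2 - u2 * w1) * (x1 * y2 - x2 * y1) =
      (u1 * x1 + u2 * y1) * (w1 * x2 + w2 * y2) - (u1 * x2 + u2 * y2) * (w1 * x1 + w2 * y1)"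
    by (simp add: algebra_simps)
  then have "(u1 * w2 - u2 * w1) * (x1 * y2 - x2 * y1) = 1" unfolding 1 2 by simp
  then have "x1 * y2 - x2 * y1 \<noteq> 0" by auto
  then show thesis using that 1 2 X' Y' by blast
qed

lemma linear_part_surj:
  obtains g h where "x1 * g + x2 * h = u" "y1 * g + y2 * h = v"
proof -
  have ne: "x1 * y2 - x2 * y1 \<noteq> 0" using linear_part_invertible by metis
  let ?g = "(u * y2 - v * x2) / (x1 * y2 - x2 * y1)" and ?h = "(x1 * v - y1 * u) / (x1 * y2 - x2 * y1)"
  have "x1 * ?g + x2 * ?h = (x1 * (u * y2 - v * x2) + x2 * (x1 * v - y1 * u)) / (x1 * y2 - x2 * y1)"
    by (simp add: add_divide_distrib)
  also have "x1 * (u * y2 - v * x2) + x2 * (x1 * v - y1 * u) = u * (x1 * y2 - x2 * y1)" by (simp add: algebra_simps)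
  finally have 1: "x1 * ?g + x2 * ?h = u" using ne by simp
  have "y1 * ?g + y2 * ?h = (y1 * (u * y2 - v * x2) + y2 * (x1 * v - y1 * u)) / (x1 * y2 - x2 * y1)"
    by (simp add: add_divide_distrib)
  also have "y1 * (u * y2 - v * x2) + y2 * (x1 * v - y1 * u) = v * (x1 * y2 - x2 * y1)" by (simp add: algebra_simps)
  finally have 2: "y1 * ?g + y2 * ?h = v" using ne by simp
  show thesis using that[OF 1 2] .
qed

text \<open>
  The initial form of $f$; it is the top monomial of $P$ composed with the linear part of $\<Phi>$.
\<close>

definition "F z = lead_coeff R * (x1 * fst z + x2 * snd z) ^ i0 * (y1 * fst z + y2 * snd z) ^ degree R"

lemma f_along_scaled_arc:
  assumes "((\<lambda>s. p s / w s) \<longlongrightarrow> u) H" "((\<lambda>s. q s / w s) \<longlongrightarrow> v) H" "(w \<longlongrightarrow> 0) H" "\<forall>\<^sub>F s in H. w s \<noteq> 0"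
  shows "((\<lambda>s. X (p s, q s) / w s) \<longlongrightarrow> x1 * u + x2 * v) H" "((\<lambda>s. Y (p s, q s) / w s) \<longlongrightarrow> y1 * u + y2 * v) H"
  using has_derivative_along_scaled_arc[OF DX zero(1) assms] has_derivative_along_scaled_arc[OF DY zero(2) assms] by auto

lemma eventually_in_U:
  assumes "(p \<longlongrightarrow> 0) H" "(q \<longlongrightarrow> (0::complex)) H"
  shows "\<forall>\<^sub>F s in H. (p s, q s) \<in> U"
proof -
  have "((\<lambda>s. (p s, q s)) \<longlongrightarrow> 0) H" using tendsto_Pair[OF assms] by (simp add: zero_prod_def)
  then show ?thesis using UV(1,3) by (rule topological_tendstoD)
qed

lemma lead: "lead_coeff R \<noteq> 0" using N by auto

text \<open>
  Since $a < b$, the top monomial of $P$ has the smallest ordinary degree.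
\<close>

lemma initial_form_f: "initial_form f (i0 + degree R) F"
  unfolding initial_form_def
proof (intro conjI allI)
  fix x y :: complex
  have id: "((\<lambda>\<tau>::complex. \<tau>) \<longlongrightarrow> 0) (at 0)" "\<forall>\<^sub>F \<tau> in at 0. \<tau> \<noteq> (0::complex)"
    by (auto simp: eventually_at_filter)
  have c: "((\<lambda>\<tau>::complex. \<tau> * x / \<tau>) \<longlongrightarrow> x) (at 0)" for x
    by (rule tendsto_eventually) (simp add: eventually_at_filter)
  have "((\<lambda>\<tau>. P (X (\<tau> * x, \<tau> * y), Y (\<tau> * x, \<tau> * y)) / \<tau> ^ (1 * i0 + 1 * degree R)) \<longlongrightarrow>
      lead_coeff R * (x1 * x + x2 * y) ^ i0 * (y1 * x + y2 * y) ^ degree R) (at 0)"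
    by (rule homogenization_tendsto_top[OF w _ _ id(2,1) i0(2)])
       (use f_along_scaled_arc[OF c c id] ab in auto)
  moreover have "\<forall>\<^sub>F \<tau> in at 0. (\<tau> * x, \<tau> * y) \<in> U"
    by (rule eventually_in_U) (auto intro!: tendsto_eq_intros)
  then have "\<forall>\<^sub>F \<tau> in at 0. P (X (\<tau> * x, \<tau> * y), Y (\<tau> * x, \<tau> * y)) / \<tau> ^ (1 * i0 + 1 * degree R) =
      f (\<tau> * x, \<tau> * y) / \<tau> ^ (i0 + degree R)"
    by eventually_elim (simp add: f)
  ultimately show "((\<lambda>\<tau>. f (\<tau> * x, \<tau> * y) / \<tau> ^ (i0 + degree R)) \<longlongrightarrow> F (x, y)) (at 0)"
    unfolding F_def fst_conv snd_conv by (rule Lim_transform_eventually)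
next
  obtain g h where "x1 * g + x2 * h = 1" "y1 * g + y2 * h = 1" by (rule linear_part_surj)
  then have "F (g, h) \<noteq> 0" using lead by (simp add: F_def)
  then show "\<exists>z. F z \<noteq> 0" by blast
qed

lemma miniregular_linear_part: "F (0, 1) \<noteq> 0" "y2 \<noteq> 0"
proof -
  obtain \<nu> F' where "initial_form f \<nu> F'" "F' (0, 1) \<noteq> 0" using mini unfolding miniregular_def by blast
  then show "F (0, 1) \<noteq> 0" using initial_form_unique[OF initial_form_f] by metis
  then show "y2 \<noteq> 0" using N by (auto simp: F_def)
qed

lemma slope: "y1 + y2 * slope = 0" using miniregular_linear_part(2) by (simp add: slope_def)

text \<open>
  The ratio $X/x$ along arcs tangent to the line of slope \<open>slope\<close>; its powers are the
  common factor in the values of $f$ along polar arcs.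
\<close>

definition "\<alpha> = x1 + x2 * slope"

lemma \<alpha>: "\<alpha> \<noteq> 0"
proof -
  have "\<alpha> * y2 = x1 * y2 - x2 * y1" using miniregular_linear_part(2) by (simp add: \<alpha>_def slope_def field_simps)
  then show ?thesis using linear_part_invertible by (metis mult_zero_left)
qed

text \<open>
  By invertibility the linear part of $\<Phi>$ is a pair of coordinates in which the initial form is a
  constant times $X^{i_0} Y^N$ with $N \<ge> 2$ and $i_0 \<le> 1$, and this is critical exactly on $Y
  = 0$.
\<close>

lemma singular_tangent_iff: "singular_tangent f m \<longleftrightarrow> m = slope"
proof
  assume "singular_tangent f m"
  then obtain \<nu> F' where "initial_form f \<nu> F'" "(F' has_derivative (\<lambda>_. 0)) (at (1, m))"
    unfolding singular_tangent_def by blast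
  then have D: "(F has_derivative (\<lambda>_. 0)) (at (1, m))" using initial_form_unique[OF initial_form_f] by metis
  define u v where "u = x1 + x2 * m" and "v = y1 + y2 * m"
  have dir: "((\<lambda>t. F (1 + t * g, m + t * h)) has_field_derivative 0) (at 0)" for g h
  proof -
    have "((\<lambda>t. 1 + t * g) has_field_derivative g) (at 0)" "((\<lambda>t. m + t * h) has_field_derivative h) (at 0)"
      by (auto intro!: derivative_eq_intros)
    from has_field_derivative_along_curve[OF _ this, of F 0 0] D
    show ?thesis by (simp add: case_prod_unfold)
  qed
  have "v = 0"
  proof (cases "i0 = 0")
    case True
    obtain g h where gh: "x1 * g + x2 * h = 0" "y1 * g + y2 * h = 1" by (rule linear_part_surj)
    have "F (1 + t * g, m + t * h) = lead_coeff R * (v + t) ^ degree R" for t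
    proof -
      have "y1 * (1 + t * g) + y2 * (m + t * h) = v + t * (y1 * g + y2 * h)" by (simp add: v_def algebra_simps)
      then show ?thesis using True gh by (simp add: F_def)
    qed
    then have "((\<lambda>t. lead_coeff R * (v + t) ^ degree R) has_field_derivative 0) (at 0)" using dir[of g h] by simp
    moreover have "((\<lambda>t. lead_coeff R * (v + t) ^ degree R) has_field_derivative lead_coeff R * (of_nat (degree R) * v ^ (degree R - 1))) (at 0)"
      by (auto intro!: derivative_eq_intros)
    ultimately have "lead_coeff R * (of_nat (degree R) * v ^ (degree R - 1)) = 0" using DERIV_unique by blast
    then show ?thesis using lead N by auto
  next
    case False
    then have i: "i0 = 1" using i0(1) by simp
    obtain g h where gh: "x1 * g + x2 * h = 1" "y1 * g + y2 * h = 0" by (rule linear_part_surj)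
    have "F (1 + t * g, m + t * h) = lead_coeff R * (u + t) * v ^ degree R" for t
    proof -
      have "y1 * (1 + t * g) + y2 * (m + t * h) = v + t * (y1 * g + y2 * h)"
        "x1 * (1 + t * g) + x2 * (m + t * h) = u + t * (x1 * g + x2 * h)" by (simp_all add: u_def v_def algebra_simps)
      then show ?thesis using i gh by (simp add: F_def)
    qed
    then have "((\<lambda>t. lead_coeff R * (u + t) * v ^ degree R) has_field_derivative 0) (at 0)" using dir[of g h] by simp
    moreover have "((\<lambda>t. lead_coeff R * (u + t) * v ^ degree R) has_field_derivative lead_coeff R * v ^ degree R) (at 0)"
      by (auto intro!: derivative_eq_intros)
    ultimately have "lead_coeff R * v ^ degree R = 0" using DERIV_unique by blast
    then show ?thesis using lead by auto
  qed
  then show "m = slope" using miniregular_linear_part(2) by (simp add: v_def slope_def field_simps eq_neg_iff_add_eq_0)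
next
  assume m: "m = slope"
  define W where "W z = lead_coeff R * (x1 * fst z + x2 * snd z) ^ i0 * (y1 * fst z + y2 * snd z) ^ (degree R - 2)" for z
  have W: "holomorphic2_on W UNIV" unfolding W_def[abs_def] by (intro holomorphic2_intros)
  have "(y1 * fst z + y2 * snd z) ^ degree R = (y1 * fst z + y2 * snd z) ^ 2 * (y1 * fst z + y2 * snd z) ^ (degree R - 2)" for z
  proof -
    obtain k where k: "degree R = 2 + k" using N le_Suc_ex by blast
    show ?thesis by (simp only: k power_add diff_add_inverse)
  qed
  then have "F z = (y1 * fst z + y2 * snd z) ^ 2 * W z" for z
    unfolding F_def W_def by (simp only: mult_ac)
  then have F: "F = (\<lambda>z. (y1 * fst z + y2 * snd z) ^ 2 * W z)" by blast
  have "(W has_derivative (\<lambda>(g, h). partial1 W (1, m) * g + partial2 W (1, m) * h)) (at (1, m))"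
    using holomorphic2_on_has_derivative[OF W] by simp
  then have "(F has_derivative (\<lambda>_. 0)) (at (1, m))"
    unfolding F by (auto intro!: derivative_eq_intros simp: m slope)
  then show "singular_tangent f m" unfolding singular_tangent_def using initial_form_f by blast
qed

lemma polar_equation:
  assumes "z \<in> U"
  shows "((\<lambda>y. f (fst z, y)) has_field_derivative
    partial1 P (X z, Y z) * partial2 X z + partial2 P (X z, Y z) * partial2 Y z) (at (snd z))"
proof -
  have "(P has_derivative (\<lambda>(u, v). partial1 P (X z, Y z) * u + partial2 P (X z, Y z) * v)) (at (X z, Y z))"
    using holomorphic2_on_has_derivative[OF holomorphic2_homogenization[of a b d R UNIV]] by simp
  moreover have "((\<lambda>y. X (fst z, y)) has_field_derivative partial2 X z) (at (snd z))"
    "((\<lambda>y. Y (fst z, y)) has_field_derivative partial2 Y z) (at (snd z))"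
    using holomorphic2_on_partial_diff(2)[OF hol(1) assms] holomorphic2_on_partial_diff(2)[OF hol(2) assms] by auto
  ultimately have "((\<lambda>y. P (X (fst z, y), Y (fst z, y))) has_field_derivative
    partial1 P (X z, Y z) * partial2 X z + partial2 P (X z, Y z) * partial2 Y z) (at (snd z))"
    by (intro has_field_derivative_along_curve) auto
  moreover have "open ((\<lambda>y. (fst z, y)) -` U)" by (rule open_vimage[OF UV(1)]) (intro continuous_intros)
  ultimately show ?thesis
    by (rule has_field_derivative_transform_within_open) (use assms f in auto)
qed

text \<open>
  By Euler's relation $a s^a$ times the $x$-derivative of $P$ at $(s^a, s^b v)$ is $s^d S(v)$.
\<close>

definition "S = smult (of_nat d) R - smult (of_nat b) ([:0, 1:] * pderiv R)"

text \<open>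
  In the coordinates $X = T^a$, $Y = T^b v$ the polar equation is a perturbation of $R'(v) = 0$: the
  second term carries the factor $T^{b-a}$.
\<close>

lemma polar_equation_weighted:
  assumes z: "z \<in> U" and T: "T \<noteq> 0" "X z = T ^ a" "Y z = T ^ b * v"
  shows "deriv (\<lambda>y. f (fst z, y)) (snd z) = 0 \<longleftrightarrow>
    of_nat a * poly (pderiv R) v * partial2 Y z + T ^ (b - a) * poly S v * partial2 X z = 0"
proof -
  let ?p1 = "partial1 P (T ^ a, T ^ b * v)" and ?p2 = "partial2 P (T ^ a, T ^ b * v)"
  have 1: "T ^ b * ?p2 = T ^ d * poly (pderiv R) v" and 2: "of_nat a * (T ^ a * ?p1) = T ^ d * poly S v"
    unfolding S_def by (rule homogenization_partials[OF w])+
  have "deriv (\<lambda>y. f (fst z, y)) (snd z) = ?p1 * partial2 X z + ?p2 * partial2 Y z" (is "?D = _")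
    using DERIV_imp_deriv[OF polar_equation[OF z]] T by simp
  then have "of_nat a * T ^ b * ?D = T ^ (b - a) * (of_nat a * (T ^ a * ?p1)) * partial2 X z + of_nat a * (T ^ b * ?p2) * partial2 Y z"
  proof -
    have "T ^ b = T ^ (b - a) * T ^ a" using ab by (simp flip: power_add)
    then show ?thesis unfolding \<open>?D = _\<close> by (simp add: algebra_simps)
  qed
  also have "\<dots> = T ^ d * (of_nat a * poly (pderiv R) v * partial2 Y z + T ^ (b - a) * poly S v * partial2 X z)"
    unfolding 1 2 by (simp add: algebra_simps)
  finally have e: "of_nat a * T ^ b * ?D = T ^ d * (of_nat a * poly (pderiv R) v * partial2 Y z + T ^ (b - a) * poly S v * partial2 X z)" .
  have "?D = 0 \<longleftrightarrow> of_nat a * T ^ b * ?D = 0" using ab T(1) by simp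
  then show ?thesis unfolding e using T(1) by simp
qed

end

section \<open>Values along polar arcs\<close>

lemma poly_over_power_at_infinity:
  fixes p :: "complex poly"
  assumes "degree p \<le> n"
  shows "((\<lambda>x. poly p x / x ^ n) \<longlongrightarrow> coeff p n) at_infinity"
proof -
  have nz: "\<forall>\<^sub>F x in at_infinity. x \<noteq> (0::complex)"
    unfolding eventually_at_infinity by (intro exI[of _ 1]) auto
  have "((\<lambda>x. coeff p j * x ^ j / x ^ n) \<longlongrightarrow> (if j = n then coeff p n else 0)) at_infinity" if "j \<le> n" for j
  proof -
    have "((\<lambda>x. coeff p j * inverse x ^ (n - j)) \<longlongrightarrow> coeff p j * 0 ^ (n - j)) at_infinity"
      by (intro tendsto_intros tendsto_inverse_0)
    moreover have "\<forall>\<^sub>F x in at_infinity. coeff p j * inverse x ^ (n - j) = coeff p j * x ^ j / x ^ n"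
      using nz by eventually_elim (use that in \<open>simp add: power_diff power_inverse field_simps\<close>)
    ultimately have "((\<lambda>x. coeff p j * x ^ j / x ^ n) \<longlongrightarrow> coeff p j * 0 ^ (n - j)) at_infinity"
      by (rule Lim_transform_eventually)
    then show ?thesis using that by (cases "j = n") (auto simp: power_0_left)
  qed
  then have "((\<lambda>x. \<Sum>j\<le>n. coeff p j * x ^ j / x ^ n) \<longlongrightarrow> (\<Sum>j\<le>n. if j = n then coeff p n else 0)) at_infinity"
    by (intro tendsto_sum) auto
  moreover have "poly p x = (\<Sum>j\<le>n. coeff p j * x ^ j)" for x
    unfolding poly_altdef using assms by (intro sum.mono_neutral_left) (auto simp: coeff_eq_0)
  ultimately show ?thesis by (simp add: sum_divide_distrib)
qed

text \<open>
  Passing to finer filters instead of subsequences keeps the limits that are already known.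
\<close>

lemma sequence_limit_cases:
  fixes v :: "nat \<Rightarrow> complex"
  obtains (infinite) H where "H \<noteq> bot" "H \<le> sequentially" "filterlim v at_infinity H"
  | (finite) H l where "H \<noteq> bot" "H \<le> sequentially" "(v \<longlongrightarrow> l) H"
proof (cases "bounded (range v)")
  case True
  then obtain l r where "strict_mono (r::nat\<Rightarrow>nat)" "((v \<circ> r) \<longlongrightarrow> l) sequentially"
    using bounded_imp_convergent_subsequence by blast
  moreover have "filtermap r sequentially \<le> sequentially"
    using filterlim_subseq[OF \<open>strict_mono r\<close>] by (simp add: filterlim_def)
  ultimately show ?thesis
    by (intro finite[of "filtermap r sequentially" l]) (auto simp: filtermap_bot_iff filterlim_filtermap o_def)
next
  case False
  let ?H = "inf sequentially (filtercomap v at_infinity)"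
  have "?H \<noteq> bot"
  proof
    assume "?H = bot"
    then have "eventually (\<lambda>_. False) ?H" by simp
    then obtain Q1 Q2 where Q: "eventually Q1 sequentially" "eventually Q2 (filtercomap v at_infinity)" "\<And>n. Q1 n \<and> Q2 n \<Longrightarrow> False"
      unfolding eventually_inf by blast
    then obtain Q3 where Q3: "eventually Q3 at_infinity" "\<And>n. Q3 (v n) \<Longrightarrow> Q2 n"
      unfolding eventually_filtercomap by blast
    then obtain B where B: "\<And>x. norm x \<ge> B \<Longrightarrow> Q3 x" unfolding eventually_at_infinity by blast
    have "\<forall>\<^sub>F n in sequentially. norm (v n) \<le> max B 1"
      using Q(1)
    proof eventually_elim
      case (elim n)
      then have "\<not> Q3 (v n)" using Q(3) Q3(2) by blast
      then show ?case using B[of "v n"] by (cases "B \<le> norm (v n)") auto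
    qed
    then have "Bseq v" unfolding Bfun_def by (intro exI[of _ "max B 1"]) auto
    then show False using False Bseq_eq_bounded by blast
  qed
  moreover have "filterlim v at_infinity ?H"
    using filterlim_filtercomap[of v at_infinity] by (meson filterlim_mono inf_le2 order_refl)
  ultimately show ?thesis by (intro infinite[of ?H]) auto
qed

context weighted_germ
begin

lemma partial2_tendsto:
  assumes "(p \<longlongrightarrow> 0) H" "(q \<longlongrightarrow> 0) H"
  shows "((\<lambda>s. partial2 X (p s, q s)) \<longlongrightarrow> x2) H" "((\<lambda>s. partial2 Y (p s, q s)) \<longlongrightarrow> y2) H"
proof -
  have "((\<lambda>s. (p s, q s)) \<longlongrightarrow> 0) H" using tendsto_Pair[OF assms] by (simp add: zero_prod_def)
  moreover have "isCont (partial2 X) 0" "isCont (partial2 Y) 0"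
    using holomorphic2_continuous_partials(2)[OF hol(1) UV(1)] holomorphic2_continuous_partials(2)[OF hol(2) UV(1)] UV(1,3)
    by (auto simp: continuous_on_eq_continuous_at)
  ultimately show "((\<lambda>s. partial2 X (p s, q s)) \<longlongrightarrow> x2) H" "((\<lambda>s. partial2 Y (p s, q s)) \<longlongrightarrow> y2) H"
    unfolding x2_def y2_def by (auto intro: isCont_tendsto_compose)
qed

lemma degree_S: "degree S \<le> degree R"
proof (rule degree_le, intro allI impI)
  fix j assume j: "degree R < j"
  then obtain k where k: "j = Suc k" by (cases j) auto
  then show "coeff S j = 0" using j by (simp add: S_def coeff_pderiv coeff_eq_0)
qed

text \<open>
  Along a polar arc write $X = T^a$ and $Y = T^b v$. If $v$ tended to infinity, the polar equation
  divided by $v^{N-1}$ would have the nonzero limit $a N r y_2$, with $r$ the leading coefficient of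
  $R$: its second term is $T^{b-a} v = Y / T^a$ times a bounded factor, and $Y / T^a$ tends to zero
  because the arc is tangent to the singular line. So $v$ accumulates at some $\<kappa>$, the limit of
  the polar equation is $R'(\<kappa>) = 0$, and $f = T^d R(v)$ with $R(\<kappa>) \<noteq> 0$ gives
  exponent and coefficient.
\<close>

lemma polar_arc_value:
  assumes arc: "polar_arc f M \<phi>" and lim: "((\<lambda>s. f (s ^ M, \<phi> s) / s ^ k) \<longlongrightarrow> c) (at 0)" and c: "c \<noteq> 0"
    and A: "A ^ a = \<alpha>"
  shows "k * a = d * M" "\<exists>\<kappa>. poly (pderiv R) \<kappa> = 0 \<and> c = A ^ d * poly R \<kappa>"
proof -
  have M: "0 < M" and \<phi>: "((\<lambda>s. \<phi> s / s ^ M) \<longlongrightarrow> slope) (at 0)"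
    and crit: "\<forall>\<^sub>F s in nhds 0. deriv (\<lambda>y. f (s ^ M, y)) (\<phi> s) = 0"
    using arc singular_tangent_iff unfolding polar_arc_def by auto
  have A0: "A \<noteq> 0" using A \<alpha> ab by (auto simp: power_0_left)
  define \<sigma> :: "nat \<Rightarrow> complex" where "\<sigma> n = inverse (of_nat (Suc n))" for n
  have \<sigma>0: "\<sigma> n \<noteq> 0" for n unfolding \<sigma>_def by (simp del: of_nat_Suc)
  have \<sigma>: "\<sigma> \<longlonglongrightarrow> 0" unfolding \<sigma>_def by (rule LIMSEQ_Suc[OF lim_inverse_n])
  define s where "s n = \<sigma> n ^ a" for n
  have s: "filterlim s (at 0) sequentially"
    unfolding filterlim_at s_def using \<sigma>0 tendsto_power[OF \<sigma>, of a] ab by (auto simp: power_0_left)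
  define W where "W n = s n ^ M" for n
  have W0: "W n \<noteq> 0" for n using \<sigma>0 by (simp add: W_def s_def)
  have W: "W \<longlonglongrightarrow> 0"
    using tendsto_power[of s 0 sequentially M] s M by (simp add: W_def[abs_def] filterlim_at power_0_left)
  let ?z = "\<lambda>n. (s n ^ M, \<phi> (s n))"
  have pq: "(\<lambda>n. s n ^ M / W n) \<longlonglongrightarrow> 1" "(\<lambda>n. \<phi> (s n) / W n) \<longlonglongrightarrow> slope"
  proof -
    have "s n \<noteq> 0" for n using \<sigma>0 by (simp add: s_def)
    then show "(\<lambda>n. s n ^ M / W n) \<longlonglongrightarrow> 1" by (simp add: W_def)
    show "(\<lambda>n. \<phi> (s n) / W n) \<longlonglongrightarrow> slope" using filterlim_compose[OF \<phi> s] by (simp add: W_def)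
  qed
  have XY: "(\<lambda>n. X (?z n) / W n) \<longlonglongrightarrow> \<alpha>" "(\<lambda>n. Y (?z n) / W n) \<longlonglongrightarrow> 0"
    using f_along_scaled_arc[OF pq W] W0 slope by (simp_all add: \<alpha>_def)
  have q0: "(\<lambda>n. \<phi> (s n)) \<longlonglongrightarrow> 0"
    using tendsto_mult[OF pq(2) W] W0 by simp
  have p0: "(\<lambda>n. s n ^ M) \<longlonglongrightarrow> 0" using W by (simp add: W_def[abs_def])
  have inU: "\<forall>\<^sub>F n in sequentially. ?z n \<in> U" by (rule eventually_in_U[OF p0 q0])
  define Z where "Z n = X (?z n) / W n / \<alpha>" for n
  have Z: "Z \<longlonglongrightarrow> 1" using tendsto_divide[OF XY(1) tendsto_const[of \<alpha>] \<alpha>] \<alpha> by (simp add: Z_def[abs_def])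
  have Zne: "\<forall>\<^sub>F n in sequentially. Z n \<noteq> 0" using tendsto_imp_eventually_ne[OF Z] by simp
  \<comment> \<open>An $a$-th root \<open>T\<close> of $X$ along the arc, with $T / \<sigma>_n^M$ tending to \<open>A\<close>; to extract it, the parameter is taken to be $\<sigma>_n^a$.\<close>
  define g where "g n = A * exp (Ln (Z n) / of_nat a)" for n
  have g: "g \<longlonglongrightarrow> A"
  proof -
    have "g \<longlonglongrightarrow> A * exp (Ln 1 / of_nat a)" unfolding g_def by (intro tendsto_intros Z) (use ab in auto)
    then show ?thesis by simp
  qed
  define T where "T n = \<sigma> n ^ M * g n" for n
  have T0: "T n \<noteq> 0" for n using \<sigma>0 A0 by (simp add: T_def g_def)
  have TX: "\<forall>\<^sub>F n in sequentially. X (?z n) = T n ^ a"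
    using Zne
  proof eventually_elim
    case (elim n)
    have "exp (Ln (Z n) / of_nat a) ^ a = Z n" using elim ab by (simp flip: exp_of_nat_mult)
    then have "T n ^ a = W n * \<alpha> * Z n"
      by (simp add: T_def g_def power_mult_distrib A W_def s_def mult_ac flip: power_mult)
    then show ?case using \<alpha> W0 by (simp add: Z_def)
  qed
  have Tlim: "T \<longlonglongrightarrow> 0"
  proof -
    have "T \<longlonglongrightarrow> 0 ^ M * A" unfolding T_def by (intro tendsto_intros \<sigma> g)
    then show ?thesis using M by (simp add: power_0_left)
  qed
  define v where "v n = Y (?z n) / T n ^ b" for n
  have vT: "Y (?z n) = T n ^ b * v n" for n using T0 by (simp add: v_def)
  have vT0: "(\<lambda>n. T n ^ (b - a) * v n) \<longlonglongrightarrow> 0"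
  proof -
    have "(\<lambda>n. (Y (?z n) / W n) / (X (?z n) / W n)) \<longlonglongrightarrow> 0 / \<alpha>" by (intro tendsto_intros XY \<alpha>)
    moreover have "\<forall>\<^sub>F n in sequentially. (Y (?z n) / W n) / (X (?z n) / W n) = T n ^ (b - a) * v n"
      using TX
    proof eventually_elim
      case (elim n)
      have "T n ^ b = T n ^ (b - a) * T n ^ a" using ab by (simp flip: power_add)
      then show ?case using T0 W0 unfolding elim by (simp add: vT)
    qed
    ultimately show ?thesis using Lim_transform_eventually by fastforce
  qed
  have crit': "\<forall>\<^sub>F n in sequentially.
      of_nat a * poly (pderiv R) (v n) * partial2 Y (?z n) + T n ^ (b - a) * poly S (v n) * partial2 X (?z n) = 0"
  proof -
    have "filterlim s (nhds 0) sequentially" using s by (simp add: filterlim_at)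
    from eventually_compose_filterlim[OF crit this] inU TX show ?thesis
    proof eventually_elim
      case (elim n)
      then show ?case using polar_equation_weighted[OF elim(2) T0[of n], of "v n"] vT by simp
    qed
  qed
  note partials = partial2_tendsto[OF p0 q0]
  show "k * a = d * M" "\<exists>\<kappa>. poly (pderiv R) \<kappa> = 0 \<and> c = A ^ d * poly R \<kappa>"
  proof -
    have "k * a = d * M \<and> (\<exists>\<kappa>. poly (pderiv R) \<kappa> = 0 \<and> c = A ^ d * poly R \<kappa>)"
    proof (rule sequence_limit_cases[of v])
      fix H assume H: "H \<noteq> bot" "H \<le> sequentially" "filterlim v at_infinity H"
      let ?N = "degree R"
      have "degree (pderiv R) \<le> ?N - 1" by (simp add: degree_pderiv)
      from filterlim_compose[OF poly_over_power_at_infinity[OF this] H(3)]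
      have 1: "((\<lambda>n. poly (pderiv R) (v n) / v n ^ (?N - 1)) \<longlongrightarrow> coeff (pderiv R) (?N - 1)) H" .
      from filterlim_compose[OF poly_over_power_at_infinity[OF degree_S] H(3)]
      have 2: "((\<lambda>n. poly S (v n) / v n ^ ?N) \<longlongrightarrow> coeff S ?N) H" .
      have "((\<lambda>n. of_nat a * (poly (pderiv R) (v n) / v n ^ (?N - 1)) * partial2 Y (?z n) +
          (T n ^ (b - a) * v n) * (poly S (v n) / v n ^ ?N) * partial2 X (?z n)) \<longlongrightarrow>
          of_nat a * coeff (pderiv R) (?N - 1) * y2 + 0 * coeff S ?N * x2) H"
        by (intro tendsto_intros 1 2 tendsto_mono[OF H(2)] partials vT0)
      moreover have "\<forall>\<^sub>F n in H. of_nat a * (poly (pderiv R) (v n) / v n ^ (?N - 1)) * partial2 Y (?z n) +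
          (T n ^ (b - a) * v n) * (poly S (v n) / v n ^ ?N) * partial2 X (?z n) = 0"
      proof -
        have "\<forall>\<^sub>F n in H. v n \<noteq> 0"
          using filterlim_at_infinity_imp_eventually_ne[OF H(3)] .
        with filter_leD[OF H(2) crit'] show ?thesis
        proof eventually_elim
          case (elim n)
          have "v n ^ ?N = v n * v n ^ (?N - 1)" using N by (simp flip: power_Suc)
          then have "of_nat a * (poly (pderiv R) (v n) / v n ^ (?N - 1)) * partial2 Y (?z n) +
              (T n ^ (b - a) * v n) * (poly S (v n) / v n ^ ?N) * partial2 X (?z n) =
            (of_nat a * poly (pderiv R) (v n) * partial2 Y (?z n) + T n ^ (b - a) * poly S (v n) * partial2 X (?z n)) / v n ^ (?N - 1)"
            using elim(2) by (simp add: add_divide_distrib)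
          then show ?case using elim(1) by simp
        qed
      qed
      ultimately have "of_nat a * coeff (pderiv R) (?N - 1) * y2 = 0"
        using tendsto_unique[OF H(1)] tendsto_eventually by fastforce
      moreover have "coeff (pderiv R) (?N - 1) = of_nat ?N * lead_coeff R" using N by (simp add: coeff_pderiv)
      ultimately show ?thesis using ab N lead miniregular_linear_part(2) by auto
    next
      fix H \<kappa> assume H: "H \<noteq> bot" "H \<le> sequentially" "(v \<longlongrightarrow> \<kappa>) H"
      note mono = tendsto_mono[OF H(2)]
      have "((\<lambda>n. of_nat a * poly (pderiv R) (v n) * partial2 Y (?z n) + T n ^ (b - a) * poly S (v n) * partial2 X (?z n))
          \<longlongrightarrow> of_nat a * poly (pderiv R) \<kappa> * y2 + 0 ^ (b - a) * poly S \<kappa> * x2) H"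
        by (intro tendsto_intros mono partials Tlim H(3))
      moreover have "((\<lambda>n. of_nat a * poly (pderiv R) (v n) * partial2 Y (?z n) + T n ^ (b - a) * poly S (v n) * partial2 X (?z n))
          \<longlongrightarrow> 0) H"
        by (rule tendsto_eventually[OF filter_leD[OF H(2) crit']])
      ultimately have "of_nat a * poly (pderiv R) \<kappa> * y2 + 0 ^ (b - a) * poly S \<kappa> * x2 = 0"
        using tendsto_unique[OF H(1)] by blast
      then have \<kappa>: "poly (pderiv R) \<kappa> = 0" using ab miniregular_linear_part(2) by (auto simp: power_0_left)
      define L where "L = A ^ d * poly R \<kappa>"
      have L: "L \<noteq> 0" using isolated_homogenization(3)[OF iso w ab, of \<kappa>] \<kappa> A0 by (auto simp: L_def)
      have gl: "((\<lambda>n. g n ^ d * poly R (v n)) \<longlongrightarrow> L) H"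
        unfolding L_def by (intro tendsto_intros mono g H(3))
      have "((\<lambda>n. f (?z n) / s n ^ k) \<longlongrightarrow> c) H" using mono[OF filterlim_compose[OF lim s]] .
      then have "((\<lambda>n. f (?z n) / s n ^ k / (g n ^ d * poly R (v n))) \<longlongrightarrow> c / L) H"
        by (intro tendsto_intros gl L)
      moreover have "\<forall>\<^sub>F n in H. f (?z n) / s n ^ k / (g n ^ d * poly R (v n)) = \<sigma> n ^ (M * d) / \<sigma> n ^ (a * k)"
      proof -
        have "\<forall>\<^sub>F n in H. g n ^ d * poly R (v n) \<noteq> 0" by (rule tendsto_imp_eventually_ne[OF gl L])
        with filter_leD[OF H(2) inU] filter_leD[OF H(2) TX] show ?thesis
        proof eventually_elim
          case (elim n)
          have "f (?z n) = T n ^ d * poly R (v n)"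
            using f[OF elim(1)] homogenization_curve[OF w, of "T n" "v n"] elim(2) vT by simp
          also have "\<dots> = \<sigma> n ^ (M * d) * (g n ^ d * poly R (v n))"
            by (simp add: T_def power_mult_distrib power_mult)
          finally have "f (?z n) = \<sigma> n ^ (M * d) * (g n ^ d * poly R (v n))" .
          then show ?case using elim(3) by (simp add: s_def flip: power_mult)
        qed
      qed
      ultimately have r: "((\<lambda>n. \<sigma> n ^ (M * d) / \<sigma> n ^ (a * k)) \<longlongrightarrow> c / L) H"
        by (rule Lim_transform_eventually)
      have \<sigma>H: "(\<sigma> \<longlongrightarrow> 0) H" by (rule mono[OF \<sigma>])
      have eq: "M * d = a * k"
      proof (rule ccontr)
        assume "M * d \<noteq> a * k"
        then consider "a * k < M * d" | "M * d < a * k" by linarith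
        then show False
        proof cases
          case 1
          have "((\<lambda>n. \<sigma> n ^ (M * d - a * k)) \<longlongrightarrow> 0 ^ (M * d - a * k)) H" by (intro tendsto_intros \<sigma>H)
          then have "((\<lambda>n. \<sigma> n ^ (M * d) / \<sigma> n ^ (a * k)) \<longlongrightarrow> 0) H"
            using 1 \<sigma>0 by (simp add: power_diff power_0_left)
          from tendsto_unique[OF H(1) r this] show False using c L by auto
        next
          case 2
          have "((\<lambda>n. \<sigma> n ^ (a * k - M * d)) \<longlongrightarrow> 0 ^ (a * k - M * d)) H" by (intro tendsto_intros \<sigma>H)
          then have "((\<lambda>n. \<sigma> n ^ (a * k) / \<sigma> n ^ (M * d)) \<longlongrightarrow> 0) H"
            using 2 \<sigma>0 by (simp add: power_diff power_0_left)
          from tendsto_mult[OF this r] have "((\<lambda>n::nat. 1::complex) \<longlongrightarrow> 0) H" using \<sigma>0 by simp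
          then show False using tendsto_const_iff[OF H(1), of "1::complex" 0] by simp
        qed
      qed
      then have "((\<lambda>n::nat. 1::complex) \<longlongrightarrow> c / L) H" using r \<sigma>0 by simp
      then have "c / L = 1" using tendsto_const_iff[OF H(1), of "1::complex" "c / L"] by simp
      then have "c = L" using L by simp
      then show ?thesis using eq \<kappa> by (auto simp: L_def mult.commute)
    qed
    then show "k * a = d * M" "\<exists>\<kappa>. poly (pderiv R) \<kappa> = 0 \<and> c = A ^ d * poly R \<kappa>" by auto
  qed
qed

end

section \<open>Existence of polar arcs\<close>

context weighted_germ
begin

lemma inverse_linear_part:
  obtains u1 u2 w1 w2 where
    "(X' has_derivative (\<lambda>(u, v). u1 * u + u2 * v)) (at 0)" "(Y' has_derivative (\<lambda>(u, v). w1 * u + w2 * v)) (at 0)"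
    "u1 * \<alpha> = 1" "w1 = u1 * slope"
proof -
  obtain u1 u2 w1 w2 where uw: "u1 * x1 + u2 * y1 = 1" "u1 * x2 + u2 * y2 = 0"
    "w1 * x1 + w2 * y1 = 0" "w1 * x2 + w2 * y2 = 1"
    "(X' has_derivative (\<lambda>(u, v). u1 * u + u2 * v)) (at 0)" "(Y' has_derivative (\<lambda>(u, v). w1 * u + w2 * v)) (at 0)"
    by (rule linear_part_invertible)
  have "u1 * \<alpha> = (u1 * x1 + u2 * y1) + slope * (u1 * x2 + u2 * y2) - u2 * (y1 + y2 * slope)"
    by (simp add: \<alpha>_def algebra_simps)
  then have u: "u1 * \<alpha> = 1" by (simp add: uw slope)
  have "w1 * \<alpha> = (w1 * x1 + w2 * y1) + slope * (w1 * x2 + w2 * y2) - w2 * (y1 + y2 * slope)"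
    by (simp add: \<alpha>_def algebra_simps)
  then have "w1 * \<alpha> = slope" by (simp add: uw slope)
  also have "slope = slope * (u1 * \<alpha>)" using u by simp
  finally have "w1 * \<alpha> = u1 * slope * \<alpha>" by (simp only: mult_ac)
  then have "w1 = u1 * slope" using \<alpha> by simp
  then show thesis using that uw(5,6) u by blast
qed

text \<open>
  The image under the inverse of $\<Phi>$ of the arc $(s^p, s^q v(s))$, reparametrised so that its
  first coordinate is again a pure power.
\<close>

lemma curve_in_domain:
  assumes v: "v holomorphic_on ball 0 \<delta>" "0 < \<delta>" and D: "\<And>s. s \<in> ball 0 \<delta> \<Longrightarrow> (s ^ p, s ^ q * v s) \<in> V"
    and pq: "0 < p" "p < q" and r0: "r0 ^ p = \<alpha>"
  obtains \<psi> \<phi> \<epsilon> where "0 < \<epsilon>" "\<psi> holomorphic_on ball 0 \<epsilon>" "\<phi> holomorphic_on ball 0 \<epsilon>" "\<psi> 0 = 0" "\<phi> 0 = 0"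
    "\<And>s. s \<in> ball 0 \<epsilon> \<Longrightarrow> \<psi> s \<in> ball 0 \<delta>" "\<And>s. s \<in> ball 0 \<epsilon> \<Longrightarrow> s \<noteq> 0 \<Longrightarrow> \<psi> s \<noteq> 0"
    "\<And>s. s \<in> ball 0 \<epsilon> \<Longrightarrow> (s ^ p, \<phi> s) \<in> U \<and> X (s ^ p, \<phi> s) = \<psi> s ^ p \<and> Y (s ^ p, \<phi> s) = \<psi> s ^ q * v (\<psi> s)"
    "((\<lambda>s. \<psi> s / s) \<longlongrightarrow> r0) (at 0)" "((\<lambda>s. \<phi> s / s ^ p) \<longlongrightarrow> slope) (at 0)"
proof -
  obtain u1 u2 w1 w2 where
    D': "(X' has_derivative (\<lambda>(u, v). u1 * u + u2 * v)) (at 0)" "(Y' has_derivative (\<lambda>(u, v). w1 * u + w2 * v)) (at 0)"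
    and u: "u1 * \<alpha> = 1" "w1 = u1 * slope" by (rule inverse_linear_part)
  define x y where "x s = X' (s ^ p, s ^ q * v s)" and "y s = Y' (s ^ p, s ^ q * v s)" for s
  have hol: "x holomorphic_on ball 0 \<delta>" "y holomorphic_on ball 0 \<delta>"
    unfolding x_def y_def
    by (rule holomorphic2_on_curve[OF hol(3)] holomorphic2_on_curve[OF hol(4)]; use D v in \<open>auto intro!: holomorphic_intros\<close>)+
  have cv: "(v \<longlongrightarrow> v 0) (at 0)"
    using v holomorphic_on_imp_continuous_on continuous_on_eq_continuous_at
    by (metis centre_in_ball open_ball isCont_def)
  have nz: "\<forall>\<^sub>F s in at 0. s \<noteq> (0::complex)" by (simp add: eventually_at_filter)
  have wp: "((\<lambda>s::complex. s ^ p) \<longlongrightarrow> 0) (at 0)" using pq by (auto intro!: tendsto_eq_intros simp: power_0_left)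
  have wne: "\<forall>\<^sub>F s in at 0. s ^ p \<noteq> (0::complex)" using nz by eventually_elim simp
  have "\<forall>\<^sub>F s in at 0. s ^ p / s ^ p = (1::complex)" using nz by eventually_elim simp
  then have l1: "((\<lambda>s. s ^ p / s ^ p) \<longlongrightarrow> (1::complex)) (at 0)" by (rule tendsto_eventually)
  have "((\<lambda>s. s ^ (q - p) * v s) \<longlongrightarrow> 0 ^ (q - p) * v 0) (at 0)" by (intro tendsto_intros cv)
  moreover have "\<forall>\<^sub>F s in at 0. s ^ (q - p) * v s = s ^ q * v s / s ^ p"
    using nz by eventually_elim (use pq in \<open>simp add: power_diff\<close>)
  ultimately have "((\<lambda>s. s ^ q * v s / s ^ p) \<longlongrightarrow> 0 ^ (q - p) * v 0) (at 0)" by (rule Lim_transform_eventually)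
  then have l2: "((\<lambda>s. s ^ q * v s / s ^ p) \<longlongrightarrow> 0) (at 0)" using pq by (simp add: power_0_left)
  have lx: "((\<lambda>s. x s / s ^ p) \<longlongrightarrow> u1) (at 0)" and ly: "((\<lambda>s. y s / s ^ p) \<longlongrightarrow> w1) (at 0)"
    unfolding x_def y_def
    using has_derivative_along_scaled_arc[OF D'(1) zero(3) l1 l2 wp wne] has_derivative_along_scaled_arc[OF D'(2) zero(4) l1 l2 wp wne]
    by auto
  have r0u: "r0 ^ p * u1 = 1" using u(1) r0 by (simp add: mult.commute)
  obtain \<psi> \<epsilon> where \<psi>: "0 < \<epsilon>" "\<psi> holomorphic_on ball 0 \<epsilon>" "\<psi> 0 = 0" "\<And>s. s \<in> ball 0 \<epsilon> \<Longrightarrow> \<psi> s \<in> ball 0 \<delta>"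
    "\<And>s. s \<in> ball 0 \<epsilon> \<Longrightarrow> x (\<psi> s) = s ^ p" "\<And>s. s \<in> ball 0 \<epsilon> \<Longrightarrow> s \<noteq> 0 \<Longrightarrow> \<psi> s \<noteq> 0"
    "((\<lambda>s. \<psi> s / s) \<longlongrightarrow> r0) (at 0)"
  proof (rule reparametrisation[OF hol(1) v(2) pq(1) lx r0u])
    fix \<psi> \<epsilon>
    assume "0 < \<epsilon>" "\<psi> holomorphic_on ball 0 \<epsilon>" "\<psi> 0 = 0" "\<And>s. s \<in> ball 0 \<epsilon> \<Longrightarrow> \<psi> s \<in> ball 0 \<delta>"
      "\<And>s. s \<in> ball 0 \<epsilon> \<Longrightarrow> x (\<psi> s) = s ^ p" "\<And>s. s \<in> ball 0 \<epsilon> \<Longrightarrow> s \<noteq> 0 \<Longrightarrow> \<psi> s \<noteq> 0"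
      "((\<lambda>s. \<psi> s / s) \<longlongrightarrow> r0) (at 0)"
    then show thesis by (rule that)
  qed
  define \<phi> where "\<phi> s = y (\<psi> s)" for s
  have hol\<phi>: "\<phi> holomorphic_on ball 0 \<epsilon>"
    unfolding \<phi>_def using holomorphic_on_compose_gen[OF \<psi>(2) hol(2)] \<psi>(4) by (auto simp: o_def image_subset_iff)
  have \<phi>0: "\<phi> 0 = 0" using pq zero(4) by (simp add: \<phi>_def y_def \<psi>(3) power_0_left zero_prod_def)
  have inball: "\<forall>\<^sub>F s in at 0. s \<in> ball 0 \<epsilon> \<and> s \<noteq> (0::complex)"
    using \<psi>(1) eventually_at_in_open[of "ball 0 \<epsilon>" "0::complex"] by auto
  have "isCont \<psi> 0" using \<psi>(1,2) holomorphic_on_imp_continuous_on continuous_on_eq_continuous_at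
    by (metis centre_in_ball open_ball)
  then have lpsi: "filterlim \<psi> (at 0) (at 0)"
    unfolding filterlim_at using inball \<psi>(3,6) by (auto simp: isCont_def elim!: eventually_mono)
  have "((\<lambda>s. (y (\<psi> s) / \<psi> s ^ p) / (x (\<psi> s) / \<psi> s ^ p)) \<longlongrightarrow> w1 / u1) (at 0)"
    by (rule tendsto_divide[OF filterlim_compose[OF ly lpsi] filterlim_compose[OF lx lpsi]]) (use u in auto)
  moreover have "\<forall>\<^sub>F s in at 0. (y (\<psi> s) / \<psi> s ^ p) / (x (\<psi> s) / \<psi> s ^ p) = \<phi> s / s ^ p"
    using inball by eventually_elim (use \<psi>(5,6) in \<open>auto simp: \<phi>_def\<close>)
  ultimately have "((\<lambda>s. \<phi> s / s ^ p) \<longlongrightarrow> w1 / u1) (at 0)" by (rule Lim_transform_eventually)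
  then have slim: "((\<lambda>s. \<phi> s / s ^ p) \<longlongrightarrow> slope) (at 0)" using u by (cases "u1 = 0") auto
  have pt: "(s ^ p, \<phi> s) \<in> U \<and> X (s ^ p, \<phi> s) = \<psi> s ^ p \<and> Y (s ^ p, \<phi> s) = \<psi> s ^ q * v (\<psi> s)" if s: "s \<in> ball 0 \<epsilon>" for s
  proof -
    let ?p = "(\<psi> s ^ p, \<psi> s ^ q * v (\<psi> s))"
    have "?p \<in> V" using D[OF \<psi>(4)[OF s]] .
    moreover have "(X' ?p, Y' ?p) = (s ^ p, \<phi> s)" using \<psi>(5)[OF s] by (simp add: x_def y_def \<phi>_def)
    ultimately show ?thesis using maps(2)[of ?p] inv(2)[of ?p] by simp
  qed
  show thesis by (rule that[OF \<psi>(1,2) hol\<phi> \<psi>(3) \<phi>0 \<psi>(4,6) pt \<psi>(7) slim])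
qed

lemma f_0: "f 0 = 0"
proof -
  have "P (0, 0) = P (0 ^ a * 0, 0 ^ b * 0)" by simp
  also have "\<dots> = 0" unfolding homogenization_scale[OF w] using d_pos by simp
  finally show ?thesis using f[OF UV(3)] zero by simp
qed

lemma deriv_f_at_0: "deriv (\<lambda>y. f (0, y)) 0 = 0"
proof -
  have "((\<lambda>\<tau>. f (\<tau> * 0, \<tau> * 1) / \<tau> ^ (i0 + degree R)) \<longlongrightarrow> F (0, 1)) (at 0)"
    using initial_form_f unfolding initial_form_def by blast
  then have "((\<lambda>\<tau>. f (0, \<tau>) / \<tau> ^ (i0 + degree R) * \<tau> ^ (i0 + degree R - 1)) \<longlongrightarrow> F (0, 1) * 0 ^ (i0 + degree R - 1)) (at 0)"
    by (intro tendsto_intros) simp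
  moreover have "\<forall>\<^sub>F \<tau> in at 0. f (0, \<tau>) / \<tau> ^ (i0 + degree R) * \<tau> ^ (i0 + degree R - 1) = (f (0, \<tau>) - f (0, 0)) / (\<tau> - 0)"
  proof -
    have "\<forall>\<^sub>F \<tau> in at 0. \<tau> \<noteq> (0::complex)" by (simp add: eventually_at_filter)
    then show ?thesis
    proof eventually_elim
      case (elim \<tau>)
      have "\<tau> ^ (i0 + degree R) = \<tau> * \<tau> ^ (i0 + degree R - 1)" using N by (simp flip: power_Suc)
      then show ?case using elim f_0 by (simp add: zero_prod_def)
    qed
  qed
  ultimately have "((\<lambda>\<tau>. (f (0, \<tau>) - f (0, 0)) / (\<tau> - 0)) \<longlongrightarrow> F (0, 1) * 0 ^ (i0 + degree R - 1)) (at 0)"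
    by (rule Lim_transform_eventually)
  then have "((\<lambda>\<tau>. (f (0, \<tau>) - f (0, 0)) / (\<tau> - 0)) \<longlongrightarrow> 0) (at 0)" using N by (simp add: power_0_left)
  then show ?thesis by (intro DERIV_imp_deriv) (simp add: has_field_derivative_iff)
qed

text \<open>
  Puiseux's theorem solves the polar equation in the coordinates $(T,v)$, starting at $T = 0$, $v =
  \<kappa>$; the arc is then transported to the source of $\<Phi>$. The choice of the root $r_0$ in
  the reparametrisation makes $T / s^e$ tend to the prescribed $A$.
\<close>

lemma polar_arc_exists:
  assumes \<kappa>: "poly (pderiv R) \<kappa> = 0" and A: "A ^ a = \<alpha>"
  shows "\<exists>M \<phi> k. polar_arc f M \<phi> \<and> k * a = d * M \<and> ((\<lambda>s. f (s ^ M, \<phi> s) / s ^ k) \<longlongrightarrow> A ^ d * poly R \<kappa>) (at 0)"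
proof -
  define S0 where "S0 = (\<lambda>z. (fst z ^ a, fst z ^ b * snd z)) -` V"
  have S0: "open S0" unfolding S0_def by (rule open_vimage[OF UV(2)]) (intro continuous_intros)
  define pX pY where "pX z = X' (fst z ^ a, fst z ^ b * snd z)" and "pY z = Y' (fst z ^ a, fst z ^ b * snd z)" for z
  have hp: "holomorphic2_on pX S0" "holomorphic2_on pY S0"
    unfolding pX_def pY_def
    by (rule holomorphic2_on_compose[OF hol(3)] holomorphic2_on_compose[OF hol(4)]; (intro holomorphic2_intros)?; simp add: S0_def)+
  have inU: "(pX z, pY z) \<in> U" if "z \<in> S0" for z
    using maps(2) that by (simp add: S0_def pX_def pY_def)
  \<comment> \<open>The left side of the polar equation as a function of $(T, v)$.\<close>
  define G where "G z = of_nat a * poly (pderiv R) (snd z) * partial2 Y (pX z, pY z) +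
      fst z ^ (b - a) * poly S (snd z) * (- 1) * ((- 1) * partial2 X (pX z, pY z))" for z
  have G: "holomorphic2_on G S0"
    unfolding G_def
    by (intro holomorphic2_intros holomorphic2_on_compose[OF holomorphic2_on_partial2[OF hol(1) UV(1)] hp]
        holomorphic2_on_compose[OF holomorphic2_on_partial2[OF hol(2) UV(1)] hp]
        holomorphic2_on_compose1[of "poly _" UNIV] inU) (auto intro!: holomorphic_intros)
  let ?q = "smult (of_nat a * y2) (pderiv R)"
  have pd: "pderiv R \<noteq> 0" using N by (auto simp: pderiv_eq_0_iff)
  then have q0: "?q \<noteq> 0" using ab miniregular_linear_part(2) by simp
  have G0: "(\<lambda>v. G (0, v)) = poly ?q"
  proof
    fix v
    have "pX (0, v) = 0" "pY (0, v) = 0"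
      using zero ab by (simp_all add: pX_def pY_def power_0_left zero_prod_def)
    then show "G (0, v) = poly ?q v"
      using ab by (simp add: G_def y2_def zero_prod_def power_0_left)
  qed
  have "\<exists>e v \<delta>. 0 < e \<and> 0 < \<delta> \<and> v holomorphic_on ball 0 \<delta> \<and> v 0 = \<kappa> \<and>
    (\<forall>s\<in>ball 0 \<delta>. (s ^ e, v s) \<in> S0 \<and> G (s ^ e, v s) = 0)"
  proof (rule Puiseux_branch[OF G S0, of _ "order \<kappa> ?q"])
    show "(0, \<kappa>) \<in> S0" using UV(4) ab by (simp add: S0_def power_0_left zero_prod_def)
    have "poly ?q \<kappa> = 0" using \<kappa> by simp
    then show "0 < order \<kappa> ?q" using q0 order_root[of ?q \<kappa>] by blast
  qed (unfold G0, use iterated_deriv_poly_at_root[OF q0] in auto)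
  then obtain e v \<delta> where e: "0 < e" "0 < \<delta>" "v holomorphic_on ball 0 \<delta>" "v 0 = \<kappa>"
    and vS: "\<And>s. s \<in> ball 0 \<delta> \<Longrightarrow> (s ^ e, v s) \<in> S0 \<and> G (s ^ e, v s) = 0" by blast
  obtain r0 where r0: "A = r0 ^ e" using exists_complex_root e(1) by (metis less_irrefl)
  define M where "M = e * a"
  have M: "0 < M" "M < e * b" using e(1) ab by (auto simp: M_def)
  have inV: "(s ^ M, s ^ (e * b) * v s) \<in> V" if "s \<in> ball 0 \<delta>" for s
    using vS[OF that] by (simp add: S0_def M_def power_mult)
  have r0M: "r0 ^ M = \<alpha>" using A by (simp add: M_def r0 power_mult)
  obtain \<psi> \<phi> \<epsilon> where c: "0 < \<epsilon>" "\<psi> holomorphic_on ball 0 \<epsilon>" "\<phi> holomorphic_on ball 0 \<epsilon>" "\<psi> 0 = 0" "\<phi> 0 = 0"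
    "\<And>s. s \<in> ball 0 \<epsilon> \<Longrightarrow> \<psi> s \<in> ball 0 \<delta>" "\<And>s. s \<in> ball 0 \<epsilon> \<Longrightarrow> s \<noteq> 0 \<Longrightarrow> \<psi> s \<noteq> 0"
    "\<And>s. s \<in> ball 0 \<epsilon> \<Longrightarrow> (s ^ M, \<phi> s) \<in> U \<and> X (s ^ M, \<phi> s) = \<psi> s ^ M \<and> Y (s ^ M, \<phi> s) = \<psi> s ^ (e * b) * v (\<psi> s)"
    "((\<lambda>s. \<psi> s / s) \<longlongrightarrow> r0) (at 0)" "((\<lambda>s. \<phi> s / s ^ M) \<longlongrightarrow> slope) (at 0)"
  proof (rule curve_in_domain[OF e(3,2) inV M r0M])
    fix \<psi> \<phi> \<epsilon>
    assume "0 < \<epsilon>" "\<psi> holomorphic_on ball 0 \<epsilon>" "\<phi> holomorphic_on ball 0 \<epsilon>" "\<psi> 0 = 0" "\<phi> 0 = 0"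
      "\<And>s. s \<in> ball 0 \<epsilon> \<Longrightarrow> \<psi> s \<in> ball 0 \<delta>" "\<And>s. s \<in> ball 0 \<epsilon> \<Longrightarrow> s \<noteq> 0 \<Longrightarrow> \<psi> s \<noteq> 0"
      "\<And>s. s \<in> ball 0 \<epsilon> \<Longrightarrow> (s ^ M, \<phi> s) \<in> U \<and> X (s ^ M, \<phi> s) = \<psi> s ^ M \<and> Y (s ^ M, \<phi> s) = \<psi> s ^ (e * b) * v (\<psi> s)"
      "((\<lambda>s. \<psi> s / s) \<longlongrightarrow> r0) (at 0)" "((\<lambda>s. \<phi> s / s ^ M) \<longlongrightarrow> slope) (at 0)"
    then show thesis by (rule that)
  qed
  have crit: "deriv (\<lambda>y. f (s ^ M, y)) (\<phi> s) = 0" if s: "s \<in> ball 0 \<epsilon>" for s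
  proof (cases "s = 0")
    case True
    then show ?thesis using deriv_f_at_0 M(1) c(5) by (simp add: power_0_left)
  next
    case False
    let ?T = "\<psi> s ^ e" and ?z = "(s ^ M, \<phi> s)"
    have T: "?T \<noteq> 0" using c(7)[OF s False] by simp
    have XY: "X ?z = ?T ^ a" "Y ?z = ?T ^ b * v (\<psi> s)" "?z \<in> U"
      using c(8)[OF s] by (auto simp: M_def power_mult)
    have "(pX (?T, v (\<psi> s)), pY (?T, v (\<psi> s))) = ?z"
      using inv(1)[OF XY(3)] XY by (simp add: pX_def pY_def)
    moreover have "G (?T, v (\<psi> s)) = 0" using vS[OF c(6)[OF s]] by blast
    ultimately have "of_nat a * poly (pderiv R) (v (\<psi> s)) * partial2 Y ?z + ?T ^ (b - a) * poly S (v (\<psi> s)) * partial2 X ?z = 0"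
      by (simp add: G_def)
    then show ?thesis using polar_equation_weighted[OF XY(3) T XY(1,2)] by simp
  qed
  have "polar_arc f M \<phi>"
    unfolding polar_arc_def
  proof (intro conjI)
    show "\<phi> analytic_on {0}" unfolding analytic_at using c(1,3) by (intro exI[of _ "ball 0 \<epsilon>"]) auto
    show "\<exists>m. ((\<lambda>s. \<phi> s / s ^ M) \<longlongrightarrow> m) (at 0) \<and> singular_tangent f m"
      using c(10) singular_tangent_iff by blast
    have "\<forall>\<^sub>F s in nhds 0. s \<in> ball (0::complex) \<epsilon>" using c(1) by (intro eventually_nhds_in_open) auto
    then show "\<forall>\<^sub>F s in nhds 0. deriv (\<lambda>y. f (s ^ M, y)) (\<phi> s) = 0"
      by eventually_elim (rule crit)
  qed (use M c(5) in auto)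
  moreover have "((\<lambda>s. f (s ^ M, \<phi> s) / s ^ (e * d)) \<longlongrightarrow> A ^ d * poly R \<kappa>) (at 0)"
  proof -
    have inball: "\<forall>\<^sub>F s in at 0. s \<in> ball 0 \<epsilon> \<and> s \<noteq> (0::complex)"
      using c(1) eventually_at_in_open[of "ball 0 \<epsilon>" "0::complex"] by auto
    have "isCont \<psi> 0" using c(1,2) holomorphic_on_imp_continuous_on continuous_on_eq_continuous_at
      by (metis centre_in_ball open_ball)
    then have "(\<psi> \<longlongrightarrow> 0) (at 0)" using c(4) by (simp add: isCont_def)
    moreover have "isCont v 0" using e(2,3) holomorphic_on_imp_continuous_on continuous_on_eq_continuous_at
      by (metis centre_in_ball open_ball)
    ultimately have "((\<lambda>s. v (\<psi> s)) \<longlongrightarrow> \<kappa>) (at 0)" using e(4) isCont_tendsto_compose by metis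
    then have "((\<lambda>s. (\<psi> s / s) ^ (e * d) * poly R (v (\<psi> s))) \<longlongrightarrow> r0 ^ (e * d) * poly R \<kappa>) (at 0)"
      by (intro tendsto_intros c(9))
    moreover have "\<forall>\<^sub>F s in at 0. (\<psi> s / s) ^ (e * d) * poly R (v (\<psi> s)) = f (s ^ M, \<phi> s) / s ^ (e * d)"
      using inball
    proof eventually_elim
      case (elim s)
      then have "s \<in> ball 0 \<epsilon>" by simp
      from c(8)[OF this] have "f (s ^ M, \<phi> s) = P ((\<psi> s ^ e) ^ a, (\<psi> s ^ e) ^ b * v (\<psi> s))"
        using f[of "(s ^ M, \<phi> s)"] by (simp add: M_def power_mult)
      then show ?case by (simp add: homogenization_curve[OF w] power_divide power_mult)
    qed
    ultimately show ?thesis unfolding r0 power_mult[symmetric] by (rule Lim_transform_eventually)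
  qed
  moreover have "e * d * a = d * M" by (simp add: M_def)
  ultimately show ?thesis by blast
qed

lemma henry_parusinski_f:
  assumes A: "A ^ a = \<alpha>"
  shows "henry_parusinski f = (\<lambda>\<kappa>. (of_nat d / of_nat a, A ^ d * poly R \<kappa>)) ` {\<kappa>. poly (pderiv R) \<kappa> = 0}"
proof -
  have A0: "A \<noteq> 0" using A \<alpha> ab by (auto simp: power_0_left)
  have h: "of_nat k / of_nat M = (of_nat d / of_nat a :: rat)" if "k * a = d * M" "0 < M" for k M
    using that ab by (simp add: field_simps flip: of_nat_mult)
  show ?thesis
  proof (intro equalityI subsetI)
    fix p assume "p \<in> henry_parusinski f"
    then obtain h' c M \<phi> k where p: "p = (h', c)" "c \<noteq> 0" "polar_arc f M \<phi>" "h' = of_nat k / of_nat M"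
        "((\<lambda>s. f (s ^ M, \<phi> s) / s ^ k) \<longlongrightarrow> c) (at 0)"
      unfolding henry_parusinski_def by blast
    have "0 < M" using p(3) unfolding polar_arc_def by blast
    then show "p \<in> (\<lambda>\<kappa>. (of_nat d / of_nat a, A ^ d * poly R \<kappa>)) ` {\<kappa>. poly (pderiv R) \<kappa> = 0}"
      using polar_arc_value[OF p(3,5,2) A] h p(1,4) by auto
  next
    fix p :: "rat \<times> complex" assume "p \<in> (\<lambda>\<kappa>. (of_nat d / of_nat a, A ^ d * poly R \<kappa>)) ` {\<kappa>. poly (pderiv R) \<kappa> = 0}"
    then obtain \<kappa> where p: "p = (of_nat d / of_nat a, A ^ d * poly R \<kappa>)" "poly (pderiv R) \<kappa> = 0" by blast
    obtain M \<phi> k where m: "polar_arc f M \<phi>" "k * a = d * M" "((\<lambda>s. f (s ^ M, \<phi> s) / s ^ k) \<longlongrightarrow> A ^ d * poly R \<kappa>) (at 0)"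
      using polar_arc_exists[OF p(2) A] by blast
    have "0 < M" using m(1) unfolding polar_arc_def by blast
    moreover have "A ^ d * poly R \<kappa> \<noteq> 0" using isolated_homogenization(3)[OF iso w ab, of \<kappa>] p(2) A0 by auto
    ultimately show "p \<in> henry_parusinski f"
      unfolding henry_parusinski_def p(1) mem_Collect_eq prod.case
      using m h[OF m(2), symmetric] by blast
  qed
qed

end

section \<open>Weighted expansion along the degenerate arc\<close>

lemma Taylor_remainder_tendsto:
  assumes h: "h holomorphic_on ball 0 \<delta>" and \<delta>: "0 < \<delta>"
  shows "((\<lambda>x. (h x - (\<Sum>j<k. (deriv ^^ j) h 0 / fact j * x ^ j)) / x ^ k) \<longlongrightarrow> (deriv ^^ k) h 0 / fact k) (at 0)"
proof -
  define r where "r = \<delta> / 2"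
  have r: "0 < r" "cball 0 r \<subseteq> ball (0::complex) \<delta>" using \<delta> by (auto simp: r_def)
  have hr: "h holomorphic_on cball 0 r" using h r(2) by (rule holomorphic_on_subset)
  have ch: "continuous_on (cball 0 r) h" using hr by (rule holomorphic_on_imp_continuous_on)
  define U where "U x = 1 / (2 * of_real pi * \<i>) *
      contour_integral (circlepath 0 r) (\<lambda>u. h u * (1 / u ^ k) / (u - x) ^ 1)" for x
  have "continuous_on ({0::complex} \<times> ball 0 r)
      (\<lambda>z. contour_integral (circlepath 0 r) (\<lambda>w. (\<lambda>z. h (snd z)) (fst z, w) * (1 / w ^ k) / (w - snd z) ^ 1))"
    by (rule continuous_on_Cauchy_kernel)
       (use r in \<open>auto intro!: continuous_intros continuous_on_compose2[OF ch]\<close>)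
  then have "continuous_on (ball 0 r) (\<lambda>x. contour_integral (circlepath 0 r) (\<lambda>w. h w * (1 / w ^ k) / (w - x) ^ 1))"
    by (auto dest: continuous_on_compose2[where f = "\<lambda>x. (0::complex, x)" and s = "ball 0 r"] intro!: continuous_intros)
  then have "continuous_on (ball 0 r) U" unfolding U_def by (intro continuous_intros)
  then have "isCont U 0" using r(1) by (simp add: continuous_on_eq_continuous_at)
  then have "(U \<longlongrightarrow> U 0) (at 0)" by (simp add: isCont_def)
  moreover have "U 0 = (deriv ^^ k) h 0 / fact k"
  proof -
    have "((\<lambda>u. h u / (u - 0) ^ Suc k) has_contour_integral (2 * pi * \<i>) / fact k * (deriv ^^ k) h 0) (circlepath 0 r)"
      by (rule Cauchy_has_contour_integral_higher_derivative_circlepath[OF ch holomorphic_on_subset[OF hr]]) (use r in auto)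
    then have "((\<lambda>u. h u * (1 / u ^ k) / (u - 0) ^ 1) has_contour_integral (2 * pi * \<i>) / fact k * (deriv ^^ k) h 0) (circlepath 0 r)"
      by (simp add: mult.commute)
    from contour_integral_unique[OF this] show ?thesis by (simp add: U_def)
  qed
  moreover have "\<forall>\<^sub>F x in at 0. U x = (h x - (\<Sum>j<k. (deriv ^^ j) h 0 / fact j * x ^ j)) / x ^ k"
  proof -
    have "\<forall>\<^sub>F x in at 0. x \<in> ball 0 r \<and> x \<noteq> (0::complex)"
      using r(1) eventually_at_in_open[of "ball 0 r" "0::complex"] by auto
    then show ?thesis
    proof eventually_elim
      case (elim x)
      then have "norm x < r" by simp
      from Taylor_circlepath_remainder[OF hr this, of k] elim show ?case by (simp add: U_def)
    qed
  qed
  ultimately show ?thesis using Lim_transform_eventually by fastforce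
qed

lemma leading_coefficient_limit:
  assumes h: "h holomorphic_on ball 0 \<delta>" and \<delta>: "0 < \<delta>" and lim: "((\<lambda>x. h x / x ^ D) \<longlongrightarrow> L) (at 0)"
  shows "L = (deriv ^^ D) h 0 / fact D"
proof -
  have z: "(deriv ^^ k) h 0 = 0" if "k < D" for k
    using that
  proof (induction k rule: less_induct)
    case (less k)
    have "((\<lambda>x. (h x - (\<Sum>j<k. (deriv ^^ j) h 0 / fact j * x ^ j)) / x ^ k) \<longlongrightarrow> (deriv ^^ k) h 0 / fact k) (at 0)"
      by (rule Taylor_remainder_tendsto[OF h \<delta>])
    then have 1: "((\<lambda>x. h x / x ^ k) \<longlongrightarrow> (deriv ^^ k) h 0 / fact k) (at 0)"
      using less by simp
    have "((\<lambda>x. h x / x ^ D * x ^ (D - k)) \<longlongrightarrow> L * 0 ^ (D - k)) (at 0)" by (intro tendsto_intros lim)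
    moreover have "\<forall>\<^sub>F x in at 0. h x / x ^ D * x ^ (D - k) = h x / x ^ k"
    proof -
      have "\<forall>\<^sub>F x in at 0. x \<noteq> (0::complex)" by (simp add: eventually_at_filter)
      then show ?thesis by eventually_elim (use less.prems in \<open>simp add: power_diff\<close>)
    qed
    ultimately have "((\<lambda>x. h x / x ^ k) \<longlongrightarrow> L * 0 ^ (D - k)) (at 0)" by (rule Lim_transform_eventually)
    from LIM_unique[OF 1 this] less.prems show ?case by (simp add: power_0_left)
  qed
  have "((\<lambda>x. (h x - (\<Sum>j<D. (deriv ^^ j) h 0 / fact j * x ^ j)) / x ^ D) \<longlongrightarrow> (deriv ^^ D) h 0 / fact D) (at 0)"
    by (rule Taylor_remainder_tendsto[OF h \<delta>])
  then have "((\<lambda>x. h x / x ^ D) \<longlongrightarrow> (deriv ^^ D) h 0 / fact D) (at 0)" using z by simp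
  from LIM_unique[OF lim this] show ?thesis .
qed

text \<open>
  Data read off from limits of $f$. The coefficients $e_j$ describe an arc; $p_j$ is the leading
  coefficient of $f$, as a function of $y$, along the arcs that agree with it below order $j$ and have
  $y$ as coefficient of order $j$, and its only double root is $e_j$; $Q$ plays the same role at the
  fractional order $b/a$. For $j = 1$ the degree of $p_j$ includes the tangent line that comes from a
  factor $x$ of the quasi-homogeneous polynomial.
\<close>

definition weighted_expansion ::
    "nat \<Rightarrow> nat \<Rightarrow> nat \<Rightarrow> (complex \<times> complex \<Rightarrow> complex) \<Rightarrow>
      (nat \<Rightarrow> complex) \<Rightarrow> (nat \<Rightarrow> complex poly) \<Rightarrow> complex poly \<Rightarrow> bool"
  where "weighted_expansion a b d f e p Q \<longleftrightarrow> e 0 = 0 \<and>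
    (\<forall>j. 0 < j \<and> a * j < b \<longrightarrow>
      degree (p j) = (if j = 1 then (d - b * degree Q) div a else 0) + degree Q \<and>
      (\<forall>z. poly (p j) z = 0 \<and> poly (pderiv (p j)) z = 0 \<longleftrightarrow> z = e j) \<and>
      (\<forall>y. ((\<lambda>s. f (s, (\<Sum>i<j. e i * s ^ i) + s ^ j * y) / s ^ ((d - b * degree Q) div a + j * degree Q))
        \<longlongrightarrow> poly (p j) y) (at 0))) \<and>
    (\<forall>y. ((\<lambda>s. f (s ^ a, (\<Sum>i\<le>(b - 1) div a. e i * (s ^ a) ^ i) + s ^ b * y) / s ^ d)
      \<longlongrightarrow> poly Q y) (at 0))"

lemma weighted_affine:
  assumes w: "weighted a b d R" and g: "\<gamma> \<noteq> 0 \<Longrightarrow> a dvd b"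
  shows "weighted a b d (smult \<xi> (R \<circ>\<^sub>p [:\<gamma>, \<eta>:]))"
  unfolding weighted_def
proof (intro allI impI)
  fix j assume "coeff (smult \<xi> (R \<circ>\<^sub>p [:\<gamma>, \<eta>:])) j \<noteq> 0"
  then have "coeff (R \<circ>\<^sub>p [:\<gamma>, \<eta>:]) j \<noteq> 0" by auto
  moreover have "R \<circ>\<^sub>p [:\<gamma>, \<eta>:] = (\<Sum>l\<le>degree R. smult (coeff R l) ([:\<gamma>, \<eta>:] ^ l))"
    unfolding pcompose_altdef poly_altdef by (simp add: coeff_map_poly degree_map_poly)
  ultimately obtain l where l: "coeff R l * coeff ([:\<gamma>, \<eta>:] ^ l) j \<noteq> 0"
    by (auto simp: coeff_sum elim!: sum.not_neutral_contains_not_neutral)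
  have jl: "j \<le> l"
  proof (rule ccontr)
    assume "\<not> j \<le> l"
    moreover have "degree ([:\<gamma>, \<eta>:] ^ l) \<le> l" using degree_power_le[of "[:\<gamma>, \<eta>:]" l] by (simp add: degree_pCons_le le_trans split: if_splits)
    ultimately show False using l by (simp add: coeff_eq_0)
  qed
  have R: "b * l \<le> d" "a dvd d - b * l" using w l unfolding weighted_def by auto
  show "b * j \<le> d \<and> a dvd d - b * j"
  proof (cases "j = l")
    case False
    then have "\<gamma> \<noteq> 0" using l jl by (auto simp: coeff_linear_poly_power power_0_left)
    then have "a dvd b * (l - j)" using g by simp
    then have c1: "a dvd (d - b * l) + b * (l - j)" using R(2) by (rule dvd_add[rotated])
    have c2: "b * j \<le> b * l" using jl by simp
    have c3: "d - b * j = (d - b * l) + b * (l - j)"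
      using R(1) c2 unfolding diff_mult_distrib2 by linarith
    show ?thesis unfolding c3 using c1 le_trans[OF c2 R(1)] by blast
  qed (use R in simp)
qed

lemma critical_values_affine:
  assumes "\<eta> \<noteq> 0"
  shows "poly (smult \<xi> (R \<circ>\<^sub>p [:\<gamma>, \<eta>:])) ` {\<kappa>. poly (pderiv (smult \<xi> (R \<circ>\<^sub>p [:\<gamma>, \<eta>:]))) \<kappa> = 0} =
    (if \<xi> = 0 then {0} else (\<lambda>c. \<xi> * c) ` poly R ` {\<kappa>. poly (pderiv R) \<kappa> = (0::complex)})"
proof (cases "\<xi> = 0")
  case False
  have 1: "poly (pderiv (smult \<xi> (R \<circ>\<^sub>p [:\<gamma>, \<eta>:]))) \<kappa> = 0 \<longleftrightarrow> poly (pderiv R) (\<gamma> + \<eta> * \<kappa>) = 0" for \<kappa>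
    using False assms by (simp add: pderiv_smult pderiv_pcompose poly_pcompose pderiv_pCons mult.commute)
  have "\<exists>\<kappa>'. \<gamma> + \<eta> * \<kappa>' = \<kappa>" for \<kappa> using assms by (intro exI[of _ "(\<kappa> - \<gamma>) / \<eta>"]) (simp add: field_simps)
  then show ?thesis using False by (auto simp: 1 poly_pcompose mult.commute image_iff) (metis (full_types))+
qed (auto simp: image_iff)

context weighted_germ
begin

text \<open>
  Strict differentiability in the second variable, from the continuity of the partial derivative.
\<close>

lemma Y_strict:
  assumes "0 < \<eta>"
  obtains \<rho> where "0 < \<rho>" "\<And>x y y'. norm x < \<rho> \<Longrightarrow> norm y < \<rho> \<Longrightarrow> norm y' < \<rho> \<Longrightarrow>
    norm (Y (x, y) - Y (x, y') - y2 * (y - y')) \<le> \<eta> * norm (y - y')"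
proof -
  have "isCont (partial2 Y) 0"
    using holomorphic2_continuous_partials(2)[OF hol(2) UV(1)] UV(1,3) by (auto simp: continuous_on_eq_continuous_at)
  then obtain e where e: "e > 0" "\<And>z. norm z < e \<Longrightarrow> norm (partial2 Y z - y2) < \<eta>"
    unfolding continuous_at_eps_delta y2_def using assms by (metis dist_norm diff_zero)
  obtain r where r: "0 < r" "cball 0 r \<times> cball 0 r \<subseteq> U" using open_polydisc[OF UV(1,3)] by auto
  define \<rho> where "\<rho> = min r (e / 2)"
  have \<rho>: "0 < \<rho>" using e(1) r(1) by (simp add: \<rho>_def)
  show thesis
  proof (rule that[OF \<rho>])
    fix x y y' :: complex assume x: "norm x < \<rho>" and y: "norm y < \<rho>" "norm y' < \<rho>"
    have z: "(x, w) \<in> U \<and> norm (partial2 Y (x, w) - y2) \<le> \<eta>" if "w \<in> ball 0 \<rho>" for w :: complex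
    proof
      show "(x, w) \<in> U" using x that by (intro subsetD[OF r(2)]) (auto simp: \<rho>_def)
      have "norm (x, w) < e" using norm_Pair_le[of x w] x that by (auto simp: \<rho>_def)
      then show "norm (partial2 Y (x, w) - y2) \<le> \<eta>" using e(2) by (simp add: less_imp_le)
    qed
    have "norm ((Y (x, y) - y2 * y) - (Y (x, y') - y2 * y')) \<le> \<eta> * norm (y - y')"
    proof (rule field_differentiable_bound[where S = "ball 0 \<rho>" and f' = "\<lambda>w. partial2 Y (x, w) - y2"])
      fix w :: complex assume w: "w \<in> ball 0 \<rho>"
      have "((\<lambda>w. Y (x, w)) has_field_derivative partial2 Y (x, w)) (at w)"
        using holomorphic2_on_partial_diff(2)[OF hol(2), of "(x, w)"] z[OF w] by simp
      then show "((\<lambda>w. Y (x, w) - y2 * w) has_field_derivative partial2 Y (x, w) - y2) (at w within ball 0 \<rho>)"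
      proof (rule has_field_derivative_at_within[OF DERIV_diff])
        show "((\<lambda>w. y2 * w) has_field_derivative y2) (at w)" by (auto intro!: derivative_eq_intros)
      qed
      show "norm (partial2 Y (x, w) - y2) \<le> \<eta>" using z[OF w] by blast
    qed (use y in auto)
    then show "norm (Y (x, y) - Y (x, y') - y2 * (y - y')) \<le> \<eta> * norm (y - y')" by (simp add: algebra_simps)
  qed
qed

text \<open>
  Near its zero set $Y$ is $y_2$ times the vertical distance to it, up to lower order.
\<close>

lemma Y_near_zero_curve:
  assumes lim: "(p \<longlongrightarrow> 0) H" "(q \<longlongrightarrow> 0) H" "(c \<longlongrightarrow> 0) H" and z: "\<forall>\<^sub>F s in H. Y (p s, c s) = 0"
    and q: "((\<lambda>s. (q s - c s) / w s) \<longlongrightarrow> \<delta>) H" and w: "\<forall>\<^sub>F s in H. w s \<noteq> 0"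
  shows "((\<lambda>s. Y (p s, q s) / w s) \<longlongrightarrow> y2 * \<delta>) H"
proof -
  have "((\<lambda>s. Y (p s, q s) / w s - y2 * ((q s - c s) / w s)) \<longlongrightarrow> 0) H"
  proof (rule tendstoI)
    fix e :: real assume e: "e > 0"
    define \<eta> where "\<eta> = e / (2 * (norm \<delta> + 1))"
    have pos: "norm \<delta> + 1 > 0" by (simp add: add_nonneg_pos)
    have \<eta>: "\<eta> > 0" using e pos by (simp add: \<eta>_def)
    obtain \<rho> where \<rho>: "0 < \<rho>" "\<And>x y y'. norm x < \<rho> \<Longrightarrow> norm y < \<rho> \<Longrightarrow> norm y' < \<rho> \<Longrightarrow>
        norm (Y (x, y) - Y (x, y') - y2 * (y - y')) \<le> \<eta> * norm (y - y')" using Y_strict[OF \<eta>] by blast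
    have "\<forall>\<^sub>F s in H. dist ((q s - c s) / w s) \<delta> < 1" using tendstoD[OF q] by simp
    with tendstoD[OF lim(1) \<rho>(1)] tendstoD[OF lim(2) \<rho>(1)] tendstoD[OF lim(3) \<rho>(1)] z w
    show "\<forall>\<^sub>F s in H. dist (Y (p s, q s) / w s - y2 * ((q s - c s) / w s)) 0 < e"
    proof eventually_elim
      case (elim s)
      have "norm (Y (p s, q s) - y2 * (q s - c s)) \<le> \<eta> * norm (q s - c s)"
        using \<rho>(2)[of "p s" "q s" "c s"] elim by simp
      then have "norm (Y (p s, q s) / w s - y2 * ((q s - c s) / w s)) \<le> \<eta> * norm ((q s - c s) / w s)"
        using elim(5) by (simp add: norm_divide divide_right_mono flip: diff_divide_distrib)
      also have "\<dots> \<le> \<eta> * (norm \<delta> + 1)"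
        using elim(6) norm_triangle_ineq2[of "(q s - c s) / w s" \<delta>] \<eta> by (intro mult_left_mono) (auto simp: dist_norm)
      also have "\<dots> = e / 2"
      proof -
        have "e / (2 * K) * K = e / 2" if "K > 0" for K using that by simp
        from this[OF pos] show ?thesis unfolding \<eta>_def .
      qed
      also have "\<dots> < e" using e by simp
      finally show ?case by simp
    qed
  qed
  from tendsto_add[OF this tendsto_mult[OF tendsto_const[of y2] q]] show ?thesis by simp
qed

lemma analytically_equivalent_f: "analytically_equivalent P f"
proof -
  let ?F = "\<lambda>z. (X z, Y z)" and ?G = "\<lambda>z. (X' z, Y' z)"
  have "homeomorphism U V ?F ?G"
    unfolding homeomorphism_def
  proof (intro conjI)
    show "?F ` U = V" using maps inv by (auto simp: image_iff) metis
    show "?G ` V = U" using maps inv by (auto simp: image_iff) metis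
    show "continuous_on U ?F" "continuous_on V ?G"
      using hol[THEN holomorphic2_on_imp_continuous_on] by (auto intro!: continuous_on_Pair)
  qed (use inv in auto)
  then have "biholomorphic_germ ?F"
    unfolding biholomorphic_germ_def using UV zero hol
    by (intro conjI exI[of _ U] exI[of _ V] exI[of _ ?G]) (auto simp: o_def zero_prod_def)
  moreover have "\<forall>\<^sub>F z in nhds 0. z \<in> U" using UV(1,3) by (rule eventually_nhds_in_open)
  then have "\<forall>\<^sub>F z in nhds 0. f z = P (?F z)" by eventually_elim (rule f)
  ultimately show ?thesis unfolding analytically_equivalent_def by blast
qed

text \<open>
  The most degenerate arc of $f$ is taken to be the preimage of $Y = 0$; only its terms of order below
  $b/a$ are determined by $f$.
\<close>

lemma zero_curve:
  obtains c \<epsilon> where "0 < \<epsilon>" "c holomorphic_on ball 0 \<epsilon>" "c 0 = 0"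
    "\<And>s. s \<in> ball 0 \<epsilon> \<Longrightarrow> Y (s, c s) = 0" "((\<lambda>s. c s / s) \<longlongrightarrow> slope) (at 0)"
proof -
  obtain r where r: "0 < r" "cball 0 r \<times> cball 0 r \<subseteq> V" using open_polydisc[OF UV(2,4)] by auto
  show thesis
  proof (rule curve_in_domain[of "\<lambda>_. 0" r 1 2 \<alpha>])
    show "(s ^ 1, s ^ 2 * 0) \<in> V" if "s \<in> ball 0 r" for s
      using that r(1) by (intro subsetD[OF r(2)]) auto
    fix \<psi> \<phi> \<epsilon> assume *: "0 < \<epsilon>" "\<phi> holomorphic_on ball 0 \<epsilon>" "\<phi> 0 = 0"
      "\<And>s. s \<in> ball 0 \<epsilon> \<Longrightarrow> (s ^ 1, \<phi> s) \<in> U \<and> X (s ^ 1, \<phi> s) = \<psi> s ^ 1 \<and> Y (s ^ 1, \<phi> s) = \<psi> s ^ 2 * 0"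
      "((\<lambda>s. \<phi> s / s ^ 1) \<longlongrightarrow> slope) (at 0)"
    show thesis by (rule that[OF *(1-3)]) (use *(4,5) in auto)
  qed (use r in auto)
qed

text \<open>
  The coefficients $e_j$ are the Taylor coefficients of the curve $Y = 0$. Below order $b/a$ the limit
  of $f$ is the top monomial of $P$ in $(x, y - e_j)$; at order $b/a$ it is $P(\<alpha>, y_2 (y -
  \<gamma>))$, where $\<gamma>$ is the Taylor coefficient of order $b/a$ if this is an integer and $0$
  otherwise.
\<close>

lemma normal_form:
  obtains e :: "nat \<Rightarrow> complex" and p :: "nat \<Rightarrow> complex poly" and Q where
    "weighted a b d Q" "degree Q = degree R" "analytically_equivalent f (homogenization a b d Q)"
    "henry_parusinski f = (\<lambda>\<kappa>. (of_nat d / of_nat a, poly Q \<kappa>)) ` {\<kappa>. poly (pderiv Q) \<kappa> = 0}"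
    "weighted_expansion a b d f e p Q"
proof -
  let ?N = "degree R"
  obtain c \<epsilon> where c: "0 < \<epsilon>" "c holomorphic_on ball 0 \<epsilon>" "c 0 = 0"
    "\<And>s. s \<in> ball 0 \<epsilon> \<Longrightarrow> Y (s, c s) = 0" "((\<lambda>s. c s / s) \<longlongrightarrow> slope) (at 0)"
  proof (rule zero_curve)
    fix c \<epsilon> assume "0 < \<epsilon>" "c holomorphic_on ball 0 \<epsilon>" "c 0 = 0"
      "\<And>s. s \<in> ball 0 \<epsilon> \<Longrightarrow> Y (s, c s) = 0" "((\<lambda>s. c s / s) \<longlongrightarrow> slope) (at 0)"
    then show thesis by (rule that)
  qed
  define e where "e j = (deriv ^^ j) c 0 / fact j" for j
  have T: "((\<lambda>x. (c x - (\<Sum>i<j. e i * x ^ i)) / x ^ j) \<longlongrightarrow> e j) (at 0)" for j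
    unfolding e_def by (rule Taylor_remainder_tendsto[OF c(2,1)])
  have e0: "e 0 = 0" by (simp add: e_def c(3))
  have e1: "e 1 = slope" using T[of 1] LIM_unique[OF _ c(5)] e0 by simp
  have nz: "\<forall>\<^sub>F s in at 0. s \<noteq> (0::complex)" by (simp add: eventually_at_filter)
  have id: "((\<lambda>s::complex. s) \<longlongrightarrow> 0) (at 0)" by simp
  have c0: "(c \<longlongrightarrow> 0) (at 0)"
    using c holomorphic_on_imp_continuous_on continuous_on_eq_continuous_at
    by (metis centre_in_ball open_ball isCont_def)
  have Yc: "\<forall>\<^sub>F s in at 0. Y (s, c s) = 0"
    using eventually_at_in_open'[of "ball 0 \<epsilon>" 0] c(1,4) by (auto elim!: eventually_mono)
  obtain A where A: "\<alpha> = A ^ a" using exists_complex_root[of a \<alpha>] ab by auto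
  have A0: "A \<noteq> 0" using A \<alpha> ab by (auto simp: power_0_left)
  define p where "p j = smult (lead_coeff R) ((if j = 1 then [:x1, x2:] else [:\<alpha>:]) ^ i0 * [:- (y2 * e j), y2:] ^ ?N)" for j
  have step: "((\<lambda>s. f (s, (\<Sum>i<j. e i * s ^ i) + s ^ j * y) / s ^ (i0 + j * ?N)) \<longlongrightarrow> poly (p j) y) (at 0)"
    if j: "0 < j" "a * j < b" for j y
  proof -
    let ?q = "\<lambda>s. (\<Sum>i<j. e i * s ^ i) + s ^ j * y"
    have "((\<lambda>s. y - (c s - (\<Sum>i<j. e i * s ^ i)) / s ^ j) \<longlongrightarrow> y - e j) (at 0)" by (intro tendsto_intros T)
    moreover have "\<forall>\<^sub>F s in at 0. y - (c s - (\<Sum>i<j. e i * s ^ i)) / s ^ j = (?q s - c s) / s ^ j"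
      using nz by eventually_elim (simp add: field_simps)
    ultimately have qc: "((\<lambda>s. (?q s - c s) / s ^ j) \<longlongrightarrow> y - e j) (at 0)" by (rule Lim_transform_eventually)
    have qs: "((\<lambda>s. ?q s / s) \<longlongrightarrow> (if j = 1 then y else slope)) (at 0)"
    proof -
      have "((\<lambda>s. (?q s - c s) / s ^ j * s ^ (j - 1) + c s / s) \<longlongrightarrow> (y - e j) * 0 ^ (j - 1) + slope) (at 0)"
        by (intro tendsto_intros qc c(5))
      moreover have "\<forall>\<^sub>F s in at 0. (?q s - c s) / s ^ j * s ^ (j - 1) + c s / s = ?q s / s"
        using nz
      proof eventually_elim
        case (elim s)
        have "s ^ j = s * s ^ (j - 1)" using j by (simp flip: power_Suc)
        then have "(?q s - c s) / s ^ j * s ^ (j - 1) = (?q s - c s) / s" using elim by simp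
        then show ?case by (simp add: diff_divide_distrib)
      qed
      ultimately have "((\<lambda>s. ?q s / s) \<longlongrightarrow> (y - e j) * 0 ^ (j - 1) + slope) (at 0)" by (rule Lim_transform_eventually)
      then show ?thesis using j e1 by (cases "j = 1") (auto simp: power_0_left)
    qed
    have q0: "(?q \<longlongrightarrow> 0) (at 0)"
    proof -
      have "((\<lambda>s. ?q s / s * s) \<longlongrightarrow> (if j = 1 then y else slope) * 0) (at 0)" by (intro tendsto_intros qs)
      moreover have "\<forall>\<^sub>F s in at 0. ?q s / s * s = ?q s" using nz by eventually_elim simp
      ultimately have "(?q \<longlongrightarrow> (if j = 1 then y else slope) * 0) (at 0)" by (rule Lim_transform_eventually)
      then show ?thesis by simp
    qed
    have "((\<lambda>s::complex. s / s) \<longlongrightarrow> 1) (at 0)" by (rule tendsto_eventually) (simp add: eventually_at_filter)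
    from f_along_scaled_arc(1)[OF this qs id nz]
    have LX: "((\<lambda>s. X (s, ?q s) / s ^ 1) \<longlongrightarrow> x1 + x2 * (if j = 1 then y else slope)) (at 0)" by simp
    have wn: "\<forall>\<^sub>F s in at 0. s ^ j \<noteq> (0::complex)" using nz by eventually_elim simp
    have LY: "((\<lambda>s. Y (s, ?q s) / s ^ j) \<longlongrightarrow> y2 * (y - e j)) (at 0)"
      by (rule Y_near_zero_curve[OF id q0 c0 Yc qc wn])
    have "((\<lambda>s. P (X (s, ?q s), Y (s, ?q s)) / s ^ (1 * i0 + j * ?N)) \<longlongrightarrow>
        lead_coeff R * (x1 + x2 * (if j = 1 then y else slope)) ^ i0 * (y2 * (y - e j)) ^ ?N) (at 0)"
      by (rule homogenization_tendsto_top[OF w LX LY nz id i0(2)]) (use j ab in auto)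
    moreover have "\<forall>\<^sub>F s in at 0. P (X (s, ?q s), Y (s, ?q s)) / s ^ (1 * i0 + j * ?N) = f (s, ?q s) / s ^ (i0 + j * ?N)"
      using eventually_in_U[OF id q0] by eventually_elim (simp add: f)
    ultimately have "((\<lambda>s. f (s, ?q s) / s ^ (i0 + j * ?N)) \<longlongrightarrow>
        lead_coeff R * (x1 + x2 * (if j = 1 then y else slope)) ^ i0 * (y2 * (y - e j)) ^ ?N) (at 0)"
      by (rule Lim_transform_eventually)
    moreover have "poly (p j) y = lead_coeff R * (x1 + x2 * (if j = 1 then y else slope)) ^ i0 * (y2 * (y - e j)) ^ ?N"
      by (auto simp: p_def poly_power \<alpha>_def algebra_simps)
    ultimately show ?thesis by simp
  qed
  have x2: "x2 \<noteq> 0" if "i0 \<noteq> 0" using miniregular_linear_part(1) that by (auto simp: F_def power_0_left)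
  have degp: "degree (p j) = (if j = 1 then i0 else 0) + ?N" for j
  proof -
    have "degree ((if j = 1 then [:x1, x2:] else [:\<alpha>:]) ^ i0) = (if j = 1 then i0 else 0)"
    proof (cases "j = 1 \<and> i0 \<noteq> 0")
      case True
      then show ?thesis using x2 by (simp add: degree_power_eq)
    next
      case False
      then show ?thesis using i0(1) by (cases "i0 = 0") (auto simp: le_Suc_eq)
    qed
    moreover have "degree ([:- (y2 * e j), y2:] ^ ?N) = ?N"
      using miniregular_linear_part(2) by (simp add: degree_power_eq)
    moreover have "(if j = 1 then [:x1, x2:] else [:\<alpha>:]) ^ i0 \<noteq> 0"
      using x2 \<alpha> by (cases "i0 = 0") auto
    moreover have "[:- (y2 * e j), y2:] ^ ?N \<noteq> 0" using miniregular_linear_part(2) by simp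
    ultimately show ?thesis using lead by (simp add: p_def degree_mult_eq)
  qed
  have dbl: "poly (p j) z = 0 \<and> poly (pderiv (p j)) z = 0 \<longleftrightarrow> z = e j" for j z
  proof
    assume z: "z = e j"
    define l where "l = [:- (y2 * e j), y2:]"
    have "l ^ 2 dvd p j"
      unfolding p_def l_def using N by (intro dvd_smult dvd_mult le_imp_power_dvd)
    then obtain q where q: "p j = l ^ 2 * q" by (elim dvdE)
    have "poly l z = 0" using z by (simp add: l_def)
    then show "poly (p j) z = 0 \<and> poly (pderiv (p j)) z = 0"
      unfolding q by (simp add: pderiv_mult power2_eq_square)
  next
    assume z: "poly (p j) z = 0 \<and> poly (pderiv (p j)) z = 0"
    show "z = e j"
    proof (rule ccontr)
      assume ne: "z \<noteq> e j"
      then have K: "poly ([:- (y2 * e j), y2:] ^ ?N) z \<noteq> 0"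
        using miniregular_linear_part(2) by (simp add: poly_power algebra_simps)
      then have L: "poly ((if j = 1 then [:x1, x2:] else [:\<alpha>:]) ^ i0) z = 0"
        using z lead by (auto simp: p_def)
      then have i: "i0 \<noteq> 0" "j = 1" using \<alpha> by (auto simp: poly_power split: if_splits)
      then have i1: "i0 = 1" using i0(1) by simp
      define K where "K = [:- (y2 * e j), y2:] ^ ?N"
      define l where "l = [:x1, x2:]"
      have "p j = smult (lead_coeff R) (l * K)"
        unfolding p_def K_def l_def i1 using i(2) by (simp only: if_True power_one_right simp_thms)
      then have "pderiv (p j) = smult (lead_coeff R) (l * pderiv K + K * pderiv l)"
        by (simp only: pderiv_smult pderiv_mult)
      moreover have "poly l z = 0" using L i i1 by (simp add: l_def)
      moreover have "pderiv l = [:x2:]" by (simp add: l_def pderiv_pCons)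
      ultimately have "poly (pderiv (p j)) z = lead_coeff R * (poly K z * x2)" by simp
      moreover have "poly K z \<noteq> 0" unfolding K_def by (rule K)
      ultimately show False using z x2 i lead by simp
    qed
  qed
  \<comment> \<open>\<open>m\<close> is the least integer with $a m \<ge> b$.\<close>
  define m where "m = Suc ((b - 1) div a)"
  have m: "b \<le> a * m"
  proof -
    have "b - 1 < a * m" using dividend_less_times_div[OF ab(1), of "b - 1"] by (simp add: m_def)
    then show ?thesis by simp
  qed
  define \<gamma> where "\<gamma> = (if a * m = b then e m else 0)"
  define Q where "Q = smult (A ^ d) (R \<circ>\<^sub>p [:- (y2 * \<gamma> / A ^ b), y2 / A ^ b:])"
  have \<gamma>: "\<gamma> \<noteq> 0 \<Longrightarrow> a dvd b" by (auto simp: \<gamma>_def split: if_splits)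
  have wQ: "weighted a b d Q" unfolding Q_def by (rule weighted_affine[OF w]) (use \<gamma> in auto)
  have \<eta>: "y2 / A ^ b \<noteq> 0" using miniregular_linear_part(2) A0 by simp
  have dQ: "degree Q = ?N" using A0 \<eta> by (simp add: Q_def degree_pcompose)
  have pQ: "poly Q y = A ^ d * poly R (y2 / A ^ b * y + - (y2 * \<gamma> / A ^ b))" for y
    by (simp add: Q_def poly_pcompose algebra_simps)
  have "analytically_equivalent P (homogenization a b d Q)"
    by (rule analytically_equivalent_homogenization[OF w wQ _ _ d_pos pQ]) (use ab A0 \<eta> \<gamma> in auto)
  then have eQ: "analytically_equivalent f (homogenization a b d Q)"
    using analytically_equivalent_sym[OF analytically_equivalent_f] analytically_equivalent_trans by blast
  have "poly Q ` {\<kappa>. poly (pderiv Q) \<kappa> = 0} = (\<lambda>c. A ^ d * c) ` poly R ` {\<kappa>. poly (pderiv R) \<kappa> = 0}"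
    unfolding Q_def critical_values_affine[OF \<eta>] using A0 by simp
  then have "Pair (of_nat d / of_nat a) ` poly Q ` {\<kappa>. poly (pderiv Q) \<kappa> = 0} =
      Pair (of_nat d / of_nat a :: rat) ` (\<lambda>c. A ^ d * c) ` poly R ` {\<kappa>. poly (pderiv R) \<kappa> = 0}" by simp
  then have hp: "henry_parusinski f = (\<lambda>\<kappa>. (of_nat d / of_nat a, poly Q \<kappa>)) ` {\<kappa>. poly (pderiv Q) \<kappa> = 0}"
    unfolding henry_parusinski_f[OF A[symmetric]] by (simp add: image_image)
  have main: "((\<lambda>s. f (s ^ a, (\<Sum>i\<le>(b - 1) div a. e i * (s ^ a) ^ i) + s ^ b * y) / s ^ d) \<longlongrightarrow> poly Q y) (at 0)" for y
  proof -
    let ?q = "\<lambda>s. (\<Sum>i<m. e i * (s ^ a) ^ i) + s ^ b * y"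
    have pa: "filterlim (\<lambda>s::complex. s ^ a) (at 0) (at 0)"
      unfolding filterlim_at using ab nz by (auto intro!: tendsto_eq_intros elim!: eventually_mono simp: power_0_left)
    then have pa0: "((\<lambda>s::complex. s ^ a) \<longlongrightarrow> 0) (at 0)" by (simp add: filterlim_at)
    have "((\<lambda>s. y - (c (s ^ a) - (\<Sum>i<m. e i * (s ^ a) ^ i)) / (s ^ a) ^ m * s ^ (a * m - b)) \<longlongrightarrow> y - e m * 0 ^ (a * m - b)) (at 0)"
      by (intro tendsto_intros filterlim_compose[OF T pa])
    moreover have "\<forall>\<^sub>F s in at 0. y - (c (s ^ a) - (\<Sum>i<m. e i * (s ^ a) ^ i)) / (s ^ a) ^ m * s ^ (a * m - b) = (?q s - c (s ^ a)) / s ^ b"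
      using nz
    proof eventually_elim
      case (elim s)
      have "s ^ (a * m - b) = s ^ (a * m) / s ^ b" using m elim by (simp add: power_diff)
      then have "(c (s ^ a) - (\<Sum>i<m. e i * (s ^ a) ^ i)) / (s ^ a) ^ m * s ^ (a * m - b) = (c (s ^ a) - (\<Sum>i<m. e i * (s ^ a) ^ i)) / s ^ b"
        using elim by (simp flip: power_mult)
      then show ?case using elim by (simp add: field_simps)
    qed
    ultimately have "((\<lambda>s. (?q s - c (s ^ a)) / s ^ b) \<longlongrightarrow> y - e m * 0 ^ (a * m - b)) (at 0)" by (rule Lim_transform_eventually)
    moreover have "e m * 0 ^ (a * m - b) = \<gamma>" using m by (simp add: \<gamma>_def power_0_left)
    ultimately have qc: "((\<lambda>s. (?q s - c (s ^ a)) / s ^ b) \<longlongrightarrow> y - \<gamma>) (at 0)" by simp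
    have qs: "((\<lambda>s. ?q s / s ^ a) \<longlongrightarrow> slope) (at 0)"
    proof -
      have "((\<lambda>s. (?q s - c (s ^ a)) / s ^ b * s ^ (b - a) + c (s ^ a) / s ^ a) \<longlongrightarrow> (y - \<gamma>) * 0 ^ (b - a) + slope) (at 0)"
        by (intro tendsto_intros qc filterlim_compose[OF c(5) pa])
      moreover have "\<forall>\<^sub>F s in at 0. (?q s - c (s ^ a)) / s ^ b * s ^ (b - a) + c (s ^ a) / s ^ a = ?q s / s ^ a"
        using nz
      proof eventually_elim
        case (elim s)
        have "s ^ b = s ^ (b - a) * s ^ a" using ab by (simp flip: power_add)
        then have "(?q s - c (s ^ a)) / s ^ b * s ^ (b - a) = (?q s - c (s ^ a)) / s ^ a" using elim by simp
        then show ?case by (simp add: diff_divide_distrib)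
      qed
      ultimately have "((\<lambda>s. ?q s / s ^ a) \<longlongrightarrow> (y - \<gamma>) * 0 ^ (b - a) + slope) (at 0)" by (rule Lim_transform_eventually)
      then show ?thesis using ab by (simp add: power_0_left)
    qed
    have wa: "\<forall>\<^sub>F s in at 0. s ^ a \<noteq> (0::complex)" and wb: "\<forall>\<^sub>F s in at 0. s ^ b \<noteq> (0::complex)"
      using nz by (eventually_elim, simp)+
    have q0: "(?q \<longlongrightarrow> 0) (at 0)"
    proof -
      have "((\<lambda>s. ?q s / s ^ a * s ^ a) \<longlongrightarrow> slope * 0) (at 0)" by (intro tendsto_intros qs pa0)
      moreover have "\<forall>\<^sub>F s in at 0. ?q s / s ^ a * s ^ a = ?q s" using nz by eventually_elim simp
      ultimately have "(?q \<longlongrightarrow> slope * 0) (at 0)" by (rule Lim_transform_eventually)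
      then show ?thesis by simp
    qed
    have "\<forall>\<^sub>F s in at 0. s ^ a / s ^ a = (1::complex)" using nz by eventually_elim simp
    then have "((\<lambda>s::complex. s ^ a / s ^ a) \<longlongrightarrow> 1) (at 0)" by (rule tendsto_eventually)
    from f_along_scaled_arc(1)[OF this qs pa0 wa]
    have LX: "((\<lambda>s. X (s ^ a, ?q s) / s ^ a) \<longlongrightarrow> \<alpha>) (at 0)" by (simp add: \<alpha>_def)
    have LY: "((\<lambda>s. Y (s ^ a, ?q s) / s ^ b) \<longlongrightarrow> y2 * (y - \<gamma>)) (at 0)"
      by (rule Y_near_zero_curve[OF pa0 q0 filterlim_compose[OF c0 pa] eventually_compose_filterlim[OF Yc pa] qc wb])
    have "((\<lambda>s. P (X (s ^ a, ?q s), Y (s ^ a, ?q s)) / s ^ d) \<longlongrightarrow> P (\<alpha>, y2 * (y - \<gamma>))) (at 0)"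
      by (rule homogenization_tendsto_quasi[OF w LX LY nz])
    moreover have "\<forall>\<^sub>F s in at 0. P (X (s ^ a, ?q s), Y (s ^ a, ?q s)) / s ^ d = f (s ^ a, ?q s) / s ^ d"
      using eventually_in_U[OF pa0 q0] by eventually_elim (simp add: f)
    ultimately have "((\<lambda>s. f (s ^ a, ?q s) / s ^ d) \<longlongrightarrow> P (\<alpha>, y2 * (y - \<gamma>))) (at 0)" by (rule Lim_transform_eventually)
    moreover have "P (\<alpha>, y2 * (y - \<gamma>)) = poly Q y"
    proof -
      have "P (\<alpha>, y2 * (y - \<gamma>)) = P (A ^ a, A ^ b * (y2 * (y - \<gamma>) / A ^ b))" using A A0 by simp
      also have "\<dots> = A ^ d * poly R (y2 * (y - \<gamma>) / A ^ b)" by (rule homogenization_curve[OF w])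
      also have "y2 * (y - \<gamma>) / A ^ b = - (y2 * \<gamma> / A ^ b) + y * (y2 / A ^ b)"
        by (simp add: right_diff_distrib diff_divide_distrib mult.commute)
      finally show ?thesis by (simp add: Q_def poly_pcompose)
    qed
    ultimately show ?thesis by (simp add: m_def lessThan_Suc_atMost)
  qed
  have "d - b * ?N = a * i0" using i0(2) by linarith
  then have i0Q: "(d - b * degree Q) div a = i0" using ab dQ by simp
  have "weighted_expansion a b d f e p Q"
    unfolding weighted_expansion_def i0Q unfolding dQ using e0 degp dbl step main by blast
  then show thesis by (rule that[OF wQ dQ eQ hp])
qed

end

section \<open>Continuous dependence on the parameter\<close>

text \<open>
  Pointwise convergence of polynomials of bounded degree outside a finite set implies convergence of
  the coefficients: divide by $y - c$ and use induction on the degree.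
\<close>

lemma coefficients_tendsto:
  fixes p :: "'a \<Rightarrow> complex poly"
  assumes "\<And>t. degree (p t) \<le> D" "degree q \<le> D" "finite E"
    and "\<And>y. y \<notin> E \<Longrightarrow> ((\<lambda>t. poly (p t) y) \<longlongrightarrow> poly q y) F"
  shows "((\<lambda>t. coeff (p t) k) \<longlongrightarrow> coeff q k) F"
  using assms
proof (induction D arbitrary: p q E k)
  case 0
  obtain y :: complex where y: "y \<notin> E" using ex_new_if_finite[OF infinite_UNIV_char_0 0(3)] by blast
  have c: "poly r y = coeff r 0" if "degree r \<le> 0" for r :: "complex poly"
    using that by (auto elim!: degree_eq_zeroE)
  have "((\<lambda>t. coeff (p t) 0) \<longlongrightarrow> coeff q 0) F"
    using 0(4)[OF y] c[OF 0(1)] c[OF 0(2)] by simp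
  moreover have "coeff r k = 0" if "degree r \<le> 0" "k \<noteq> 0" for r :: "complex poly"
    using that by (auto intro: coeff_eq_0)
  ultimately show ?case using 0(1,2) by (cases "k = 0") auto
next
  case (Suc D)
  obtain c :: complex where c: "c \<notin> E" using ex_new_if_finite[OF infinite_UNIV_char_0 Suc.prems(3)] by blast
  let ?s = "\<lambda>r. synthetic_div r c"
  have eq: "r = [:- c, 1:] * ?s r + [:poly r c:]" for r :: "complex poly" by (rule synthetic_div_correct'[symmetric])
  have ev: "poly r y = (y - c) * poly (?s r) y + poly r c" for r y
    using arg_cong[OF eq[of r], of "\<lambda>r. poly r y"] by (simp add: algebra_simps)
  have IH: "((\<lambda>t. coeff (?s (p t)) k) \<longlongrightarrow> coeff (?s q) k) F" for k
  proof (rule Suc.IH)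
    show "degree (?s (p t)) \<le> D" for t using Suc.prems(1)[of t] by (simp add: degree_synthetic_div)
    show "degree (?s q) \<le> D" using Suc.prems(2) by (simp add: degree_synthetic_div)
    show "finite (insert c E)" using Suc.prems(3) by simp
    fix y assume y: "y \<notin> insert c E"
    have "((\<lambda>t. (poly (p t) y - poly (p t) c) / (y - c)) \<longlongrightarrow> (poly q y - poly q c) / (y - c)) F"
      using y c by (intro tendsto_intros Suc.prems(4)) auto
    moreover have "(poly r y - poly r c) / (y - c) = poly (?s r) y" for r
      using y by (simp add: ev[of r y])
    ultimately show "((\<lambda>t. poly (?s (p t)) y) \<longlongrightarrow> poly (?s q) y) F" by simp
  qed
  have ck: "coeff r k = (if k = 0 then poly r c else coeff (?s r) (k - 1)) - c * coeff (?s r) k" for r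
    by (subst eq) (cases k, auto)
  have "((\<lambda>t. (if k = 0 then poly (p t) c else coeff (?s (p t)) (k - 1)) - c * coeff (?s (p t)) k) \<longlongrightarrow>
      (if k = 0 then poly q c else coeff (?s q) (k - 1)) - c * coeff (?s q) k) F"
    using Suc.prems(4)[OF c] by (cases "k = 0") (auto intro!: tendsto_intros IH)
  then show ?case by (simp flip: ck)
qed

lemma root_bound:
  fixes p :: "complex poly"
  assumes "degree p = D" "p \<noteq> 0" "poly p z = 0"
  shows "norm z \<le> 1 + (\<Sum>k<D. norm (coeff p k)) / norm (coeff p D)"
proof (cases "norm z \<le> 1")
  case True
  then show ?thesis by (smt (verit) divide_nonneg_nonneg norm_ge_zero sum_nonneg)
next
  case False
  have lc: "coeff p D \<noteq> 0" using assms by auto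
  have "D \<noteq> 0"
  proof
    assume "D = 0"
    then obtain c where "p = [:c:]" using assms(1) degree_eq_zeroE by blast
    then show False using assms by simp
  qed
  have "coeff p D * z ^ D = - (\<Sum>k<D. coeff p k * z ^ k)"
    using assms(1,3) by (simp add: poly_altdef lessThan_Suc_atMost[symmetric] eq_neg_iff_add_eq_0 add.commute)
  then have "norm (coeff p D) * norm z ^ D = norm (\<Sum>k<D. coeff p k * z ^ k)"
    by (metis norm_minus_cancel norm_mult norm_power)
  also have "\<dots> \<le> (\<Sum>k<D. norm (coeff p k) * norm z ^ (D - 1))"
    using False by (intro sum_norm_le) (auto simp: norm_mult norm_power intro!: mult_left_mono power_increasing)
  also have "\<dots> = (\<Sum>k<D. norm (coeff p k)) * norm z ^ (D - 1)" by (simp add: sum_distrib_right)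
  also have "norm z ^ D = norm z * norm z ^ (D - 1)" using \<open>D \<noteq> 0\<close> by (simp flip: power_Suc)
  finally have "norm (coeff p D) * norm z * norm z ^ (D - 1) \<le> (\<Sum>k<D. norm (coeff p k)) * norm z ^ (D - 1)"
    by (simp only: mult.assoc)
  moreover have "norm z ^ (D - 1) > 0" using False by (intro zero_less_power) linarith
  ultimately have "norm (coeff p D) * norm z \<le> (\<Sum>k<D. norm (coeff p k))" by simp
  then have "norm z \<le> (\<Sum>k<D. norm (coeff p k)) / norm (coeff p D)" using lc by (simp add: field_simps)
  then show ?thesis by simp
qed

text \<open>
  The roots stay bounded and the pairs $(t, z)$ with a double root $z$ form a closed set, so the
  closed graph theorem for compact ranges applies.
\<close>

lemma continuous_on_double_root:
  fixes S :: "real set" and P :: "real \<Rightarrow> complex poly"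
  assumes S: "compact S" and deg: "\<And>t. t \<in> S \<Longrightarrow> degree (P t) = D" "0 < D"
    and cont: "\<And>k. continuous_on S (\<lambda>t. coeff (P t) k)"
    and e: "\<And>t z. t \<in> S \<Longrightarrow> poly (P t) z = 0 \<and> poly (pderiv (P t)) z = 0 \<longleftrightarrow> z = e t"
  shows "continuous_on S e"
proof -
  have ne: "P t \<noteq> 0" if "t \<in> S" for t using deg(1)[OF that] deg(2) by auto
  define B where "B t = 1 + (\<Sum>k<D. norm (coeff (P t) k)) / norm (coeff (P t) D)" for t
  have "continuous_on S B"
    unfolding B_def using ne deg by (intro continuous_intros cont) (auto simp: leading_coeff_0_iff[symmetric] simp del: leading_coeff_0_iff)
  then have "bounded (B ` S)" using S compact_continuous_image compact_imp_bounded by blast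
  then obtain M where M: "\<And>t. t \<in> S \<Longrightarrow> \<bar>B t\<bar> \<le> M" unfolding bounded_iff by auto
  have "norm (e t) \<le> M" if "t \<in> S" for t
  proof -
    have "poly (P t) (e t) = 0" using e[OF that, of "e t"] by simp
    from root_bound[OF deg(1)[OF that] ne[OF that] this] M[OF that] show ?thesis by (auto simp: B_def)
  qed
  then have 1: "e \<in> S \<rightarrow> cball 0 M" by auto
  have "closed ((\<lambda>t. (t, e t)) ` S)"
  proof -
    define G where "G z = (\<Sum>k\<le>D. coeff (P (fst z)) k * snd z ^ k)" for z :: "real \<times> complex"
    define G' where "G' z = (\<Sum>k\<le>D. of_nat (Suc k) * coeff (P (fst z)) (Suc k) * snd z ^ k)" for z :: "real \<times> complex"
    have c: "continuous_on (S \<times> UNIV) (\<lambda>z. coeff (P (fst z)) k)" for k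
      by (rule continuous_on_compose2[OF cont]) (auto intro!: continuous_intros)
    have "continuous_on (S \<times> UNIV) (\<lambda>z. (G z, G' z))"
      unfolding G_def G'_def by (intro continuous_intros c)
    then have cl: "closed ((S \<times> UNIV) \<inter> (\<lambda>z. (G z, G' z)) -` {(0, 0)})"
      using S by (intro continuous_closed_preimage) (auto intro: closed_Times compact_imp_closed)
    have G: "G (t, z) = poly (P t) z" "G' (t, z) = poly (pderiv (P t)) z" if "t \<in> S" for t z
    proof -
      show "G (t, z) = poly (P t) z" using deg(1)[OF that] by (simp add: G_def poly_altdef)
      have "G' (t, z) = (\<Sum>k\<le>D. coeff (pderiv (P t)) k * z ^ k)" by (simp add: G'_def coeff_pderiv)
      also have "\<dots> = poly (pderiv (P t)) z"
        unfolding poly_altdef using deg(1)[OF that] by (intro sum.mono_neutral_right) (auto simp: coeff_eq_0 degree_pderiv)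
      finally show "G' (t, z) = poly (pderiv (P t)) z" .
    qed
    have "(\<lambda>t. (t, e t)) ` S = (S \<times> UNIV) \<inter> (\<lambda>z. (G z, G' z)) -` {(0, 0)}"
    proof -
      have e1: "z = e t" if "t \<in> S" "poly (P t) z = 0" "poly (pderiv (P t)) z = 0" for t z
        using e[OF that(1)] that(2,3) by blast
      have e2: "poly (P t) (e t) = 0" "poly (pderiv (P t)) (e t) = 0" if "t \<in> S" for t
        using e[OF that, of "e t"] by simp_all
      show ?thesis by (auto simp: G e2 intro!: e1 image_eqI)
    qed
    then show ?thesis using cl by simp
  qed
  from continuous_from_closed_graph[OF compact_cball 1 this] show ?thesis .
qed

text \<open>
  The limit is a Taylor coefficient of a one-variable function, hence a Cauchy integral over a circle
  that can be chosen independently of $t$.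
\<close>

lemma continuous_on_leading_limit:
  fixes f :: "real \<Rightarrow> complex \<times> complex \<Rightarrow> complex" and c :: "nat \<Rightarrow> real \<Rightarrow> complex"
  assumes S: "compact S" and U: "open U" "0 \<in> U" and hol: "\<And>t. t \<in> S \<Longrightarrow> holomorphic2_on (f t) U"
    and cont: "continuous_on (S \<times> U) (\<lambda>(t, z). f t z)"
    and c: "\<And>i. i \<in> I \<Longrightarrow> continuous_on S (c i)" and c0: "\<And>t. t \<in> S \<Longrightarrow> c 0 t = 0"
    and pq: "0 < p" "0 < q"
    and lim: "\<And>t. t \<in> S \<Longrightarrow> ((\<lambda>s. f t (s ^ p, (\<Sum>i\<in>I. c i t * (s ^ p) ^ i) + s ^ q * y) / s ^ D) \<longlongrightarrow> L t) (at 0)"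
  shows "continuous_on S L"
proof -
  obtain r0 where r0: "0 < r0" "cball 0 r0 \<times> cball 0 r0 \<subseteq> U" using open_polydisc[OF U] by auto
  define g where "g t s = (\<Sum>i\<in>I. c i t * (s ^ p) ^ i) + s ^ q * y" for t and s :: complex
  have cg: "continuous_on (S \<times> X) (\<lambda>z. g (fst z) (snd z))" for X
    unfolding g_def
    by (intro continuous_intros continuous_on_compose2[OF c]) auto
  have g0: "g t 0 = 0" if "t \<in> S" for t
    unfolding g_def using c0[OF that] pq by (auto intro!: sum.neutral simp: power_0_left)
  have "uniformly_continuous_on (S \<times> cball 0 1) (\<lambda>z. g (fst z) (snd z))"
    by (rule compact_uniformly_continuous[OF cg]) (use S in \<open>auto intro: compact_Times\<close>)
  then obtain \<delta> where \<delta>: "0 < \<delta>" "\<And>z z'. z \<in> S \<times> cball 0 1 \<Longrightarrow> z' \<in> S \<times> cball 0 1 \<Longrightarrow> dist z' z < \<delta> \<Longrightarrow>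
      dist (g (fst z') (snd z')) (g (fst z) (snd z)) < r0"
    unfolding uniformly_continuous_on_def using r0(1) by metis
  define \<rho> where "\<rho> = min (min 1 r0) \<delta>"
  have \<rho>: "0 < \<rho>" "\<rho> \<le> 1" "\<rho> \<le> r0" "\<rho> \<le> \<delta>" using r0(1) \<delta>(1) by (auto simp: \<rho>_def)
  have inU: "(s ^ p, g t s) \<in> U" if "t \<in> S" "s \<in> ball 0 \<rho>" for t s
  proof (rule subsetD[OF r0(2)])
    have s: "norm s < \<rho>" using that by simp
    have "norm s ^ p \<le> norm s ^ 1" using pq s \<rho> by (intro power_decreasing) auto
    then have "norm (s ^ p) \<le> r0" using s \<rho> by (simp add: norm_power)
    moreover have "dist (g t s) (g t 0) < r0"
      using \<delta>(2)[of "(t, 0)" "(t, s)"] that(1) s \<rho> by (simp add: dist_Pair_Pair)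
    ultimately show "(s ^ p, g t s) \<in> cball 0 r0 \<times> cball 0 r0" using g0[OF that(1)] by simp
  qed
  have holg: "g t holomorphic_on X" for t X unfolding g_def by (intro holomorphic_intros)
  have hol: "(\<lambda>s. f t (s ^ p, g t s)) holomorphic_on ball 0 \<rho>" if "t \<in> S" for t
    by (rule holomorphic2_on_curve[OF hol[OF that]]) (auto intro!: holomorphic_intros holg inU that)
  define \<rho>' where "\<rho>' = \<rho> / 2"
  have \<rho>': "0 < \<rho>'" "cball 0 \<rho>' \<subseteq> ball (0::complex) \<rho>" using \<rho> by (auto simp: \<rho>'_def)
  have L: "L t = 1 / (2 * of_real pi * \<i>) * contour_integral (circlepath 0 \<rho>') (\<lambda>s. f t (s ^ p, g t s) / s ^ Suc D)"
    if t: "t \<in> S" for t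
  proof -
    have "L t = (deriv ^^ D) (\<lambda>s. f t (s ^ p, g t s)) 0 / fact D"
      by (rule leading_coefficient_limit[OF hol[OF t] \<rho>(1)]) (use lim[OF t] in \<open>simp add: g_def\<close>)
    moreover have h: "(\<lambda>s. f t (s ^ p, g t s)) holomorphic_on cball 0 \<rho>'" using hol[OF t] \<rho>'(2) by (rule holomorphic_on_subset)
    have "((\<lambda>s. f t (s ^ p, g t s) / (s - 0) ^ Suc D) has_contour_integral
        (2 * pi * \<i>) / fact D * (deriv ^^ D) (\<lambda>s. f t (s ^ p, g t s)) 0) (circlepath 0 \<rho>')"
      by (rule Cauchy_has_contour_integral_higher_derivative_circlepath[OF holomorphic_on_imp_continuous_on[OF h] holomorphic_on_subset[OF h]])
         (use \<rho>' in auto)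
    from contour_integral_unique[OF this]
    have "contour_integral (circlepath 0 \<rho>') (\<lambda>s. f t (s ^ p, g t s) / s ^ Suc D) =
        (2 * pi * \<i>) / fact D * (deriv ^^ D) (\<lambda>s. f t (s ^ p, g t s)) 0" by simp
    ultimately show ?thesis by simp
  qed
  have "continuous_on S (\<lambda>t. contour_integral (circlepath 0 \<rho>') (\<lambda>s. f t (s ^ p, g t s) / s ^ Suc D))"
  proof (rule continuous_on_circle_integral[OF _ \<rho>'(1)])
    have "continuous_on (S \<times> sphere 0 \<rho>') (\<lambda>z. (\<lambda>(t, z). f t z) (fst z, (snd z ^ p, g (fst z) (snd z))))"
    proof (rule continuous_on_compose2[OF cont])
      show "continuous_on (S \<times> sphere 0 \<rho>') (\<lambda>z. (fst z, (snd z ^ p, g (fst z) (snd z))))"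
        by (intro continuous_intros cg)
      show "(\<lambda>z. (fst z, (snd z ^ p, g (fst z) (snd z)))) ` (S \<times> sphere 0 \<rho>') \<subseteq> S \<times> U"
        using inU \<rho>'(2) by (auto simp: subset_iff)
    qed
    then show "continuous_on (S \<times> sphere 0 \<rho>') (\<lambda>(t, s). f t (s ^ p, g t s) / s ^ Suc D)"
      unfolding case_prod_unfold using \<rho>'(1) by (intro continuous_intros) auto
  qed
  then have "continuous_on S (\<lambda>t. 1 / (2 * of_real pi * \<i>) * contour_integral (circlepath 0 \<rho>') (\<lambda>s. f t (s ^ p, g t s) / s ^ Suc D))"
    by (intro continuous_intros)
  then show ?thesis by (simp add: L cong: continuous_on_cong)
qed

section \<open>Rigidity of polynomials with prescribed critical values\<close>

lemma sum_orders_complex: "p \<noteq> 0 \<Longrightarrow> (\<Sum>x | poly p x = 0. order x p) = degree (p :: complex poly)"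
  using size_proots_complex[of p] by (simp add: size_multiset_overloaded_eq)

lemma degree_diff_const: "0 < degree p \<Longrightarrow> degree (p - [:c:]) = degree (p :: complex poly)"
  using degree_add_eq_left[of "- [:c:]" p] unfolding diff_conv_add_uminus by simp

text \<open>
  Riemann-Hurwitz for polynomials: each fibre loses as many points as the orders of the derivative on
  it, and these orders add up to the degree of the derivative.
\<close>

lemma sum_card_fibres:
  fixes p :: "complex poly"
  assumes C: "finite C" and crit: "\<And>x. poly (pderiv p) x = 0 \<Longrightarrow> poly p x \<in> C" and deg: "0 < degree p"
  shows "(\<Sum>c\<in>C. card {x. poly p x = c}) + (degree p - 1) = degree p * card C"
proof -
  let ?N = "degree p"
  have fin: "finite {x. poly p x = c}" for c
  proof -
    have "p - [:c:] \<noteq> 0" using deg by auto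
    moreover have "{x. poly p x = c} = {x. poly (p - [:c:]) x = 0}" by auto
    ultimately show ?thesis using poly_roots_finite[of "p - [:c:]"] by simp
  qed
  have d0: "pderiv p \<noteq> 0" using deg by (simp add: pderiv_eq_0_iff)
  have fibre: "?N = card {x. poly p x = c} + (\<Sum>x | poly p x = c. order x (pderiv p))" for c
  proof -
    let ?q = "p - [:c:]"
    have q: "?q \<noteq> 0" "degree ?q = ?N" "pderiv ?q = pderiv p"
      using deg by (auto simp: degree_diff_const pderiv_diff pderiv_pCons)
    have "?N = (\<Sum>x | poly ?q x = 0. order x ?q)" using sum_orders_complex[OF q(1)] q(2) by simp
    also have "\<dots> = (\<Sum>x | poly p x = c. 1 + order x (pderiv p))"
      using order_pderiv[of ?q] q d0 by (intro sum.cong) (auto simp: order_root)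
    also have "\<dots> = card {x. poly p x = c} + (\<Sum>x | poly p x = c. order x (pderiv p))"
      by (subst sum.distrib) simp
    finally show ?thesis .
  qed
  have "(\<Sum>c\<in>C. \<Sum>x | poly p x = c. order x (pderiv p)) = (\<Sum>x\<in>(\<Union>c\<in>C. {x. poly p x = c}). order x (pderiv p))"
    using C fin by (intro sum.UNION_disjoint[symmetric]) auto
  also have "\<dots> = (\<Sum>x | poly (pderiv p) x = 0. order x (pderiv p))"
    using C fin crit by (intro sum.mono_neutral_right) (auto simp: order_0I)
  also have "\<dots> = ?N - 1" using sum_orders_complex[OF d0] by (simp add: degree_pderiv)
  finally have "(\<Sum>c\<in>C. \<Sum>x | poly p x = c. order x (pderiv p)) = ?N - 1" .
  moreover have "?N * card C = (\<Sum>c\<in>C. card {x. poly p x = c} + (\<Sum>x | poly p x = c. order x (pderiv p)))"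
    using fibre by simp
  ultimately show ?thesis by (simp add: sum.distrib)
qed

lemma finite_family_convergent_subsequence:
  fixes x :: "'i \<Rightarrow> nat \<Rightarrow> complex"
  assumes "finite I" "\<And>i. i \<in> I \<Longrightarrow> bounded (range (x i))"
  obtains r l where "strict_mono (r :: nat \<Rightarrow> nat)" "\<And>i. i \<in> I \<Longrightarrow> (\<lambda>n. x i (r n)) \<longlonglongrightarrow> l i"
proof -
  have "\<exists>r l. strict_mono (r :: nat \<Rightarrow> nat) \<and> (\<forall>i\<in>I. (\<lambda>n. x i (r n)) \<longlonglongrightarrow> l i)"
    using assms
  proof (induction I)
    case empty
    then show ?case by (intro exI[of _ "\<lambda>n. n"]) (simp add: strict_mono_def)
  next
    case (insert i I)
    then obtain r l where r: "strict_mono (r :: nat \<Rightarrow> nat)" "\<forall>i\<in>I. (\<lambda>n. x i (r n)) \<longlonglongrightarrow> l i" by auto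
    have "bounded (range (x i))" using insert.prems by blast
    then have "bounded (range (\<lambda>n. x i (r n)))" by (rule bounded_subset) auto
    then obtain a s where s: "strict_mono (s :: nat \<Rightarrow> nat)" "((\<lambda>n. x i (r n)) \<circ> s) \<longlonglongrightarrow> a"
      using bounded_imp_convergent_subsequence by blast
    have "\<forall>j\<in>insert i I. (\<lambda>n. x j (r (s n))) \<longlonglongrightarrow> (l(i := a)) j"
      using s(2) r(2) LIMSEQ_subseq_LIMSEQ[OF _ s(1)] insert.hyps by (auto simp: o_def)
    then show ?case using strict_mono_o[OF r(1) s(1)] by (intro exI[of _ "r \<circ> s"] exI[of _ "l(i := a)"]) (auto simp: o_def)
  qed
  then show thesis using that by blast
qed

lemma poly_tendsto:
  fixes p :: "nat \<Rightarrow> complex poly"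
  assumes deg: "\<And>n. degree (p n) \<le> D" "degree q \<le> D" and c: "\<And>k. (\<lambda>n. coeff (p n) k) \<longlonglongrightarrow> coeff q k"
    and x: "x \<longlonglongrightarrow> y"
  shows "(\<lambda>n. poly (p n) (x n)) \<longlonglongrightarrow> poly q y"
proof -
  have e: "poly r z = (\<Sum>k\<le>D. coeff r k * z ^ k)" if "degree r \<le> D" for r :: "complex poly" and z
    unfolding poly_altdef using that by (intro sum.mono_neutral_left) (auto simp: coeff_eq_0)
  have "(\<lambda>n. \<Sum>k\<le>D. coeff (p n) k * x n ^ k) \<longlonglongrightarrow> (\<Sum>k\<le>D. coeff q k * y ^ k)"
    by (intro tendsto_intros c x)
  then show ?thesis by (simp add: e deg)
qed

lemma coeff_iterated_pderiv_tendsto: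
  fixes p :: "nat \<Rightarrow> complex poly"
  assumes "\<And>k. (\<lambda>n. coeff (p n) k) \<longlonglongrightarrow> coeff q k"
  shows "(\<lambda>n. coeff ((pderiv ^^ i) (p n)) k) \<longlonglongrightarrow> coeff ((pderiv ^^ i) q) k"
proof (induction i arbitrary: k)
  case (Suc i)
  then show ?case by (simp add: coeff_pderiv tendsto_mult_left)
qed (use assms in simp)

lemma degree_iterated_pderiv_le: "degree ((pderiv ^^ i) p) \<le> degree (p :: complex poly)"
  by (induction i) (auto simp: degree_pderiv)

lemma iterated_pderiv_linear:
  "(pderiv ^^ i) (smult c p - q) = smult c ((pderiv ^^ i) p) - (pderiv ^^ i) (q :: complex poly)"
  by (induction i) (auto simp: pderiv_diff pderiv_smult)

lemma order_prod_linear: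
  assumes "finite A"
  shows "order x (\<Prod>i\<in>A. [:- r i, 1:]) = card {i \<in> A. r i = (x :: complex)}"
  using assms
proof (induction A)
  case (insert i A)
  have ne: "(\<Prod>i\<in>A. [:- r i, 1:]) \<noteq> 0" using insert by auto
  have o: "order x [:- r i, 1:] = (if r i = x then 1 else 0)"
    using order_power_n_n[of x 1] by (auto intro: order_0I)
  have "order x (\<Prod>i\<in>insert i A. [:- r i, 1:]) = order x ([:- r i, 1:] * (\<Prod>i\<in>A. [:- r i, 1:]))"
    using insert.hyps by simp
  also have "\<dots> = order x [:- r i, 1:] + order x (\<Prod>i\<in>A. [:- r i, 1:])"
    by (rule order_mult) (use ne in \<open>metis mult_eq_0_iff pCons_eq_0_iff one_neq_zero\<close>)
  also have "\<dots> = (if r i = x then 1 else 0) + card {i \<in> A. r i = x}" unfolding o insert.IH ..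
  also have "{j \<in> insert i A. r j = x} = (if r i = x then insert i {j \<in> A. r j = x} else {j \<in> A. r j = x})" by auto
  then have "(if r i = x then 1 else 0) + card {i \<in> A. r i = x} = card {j \<in> insert i A. r j = x}"
    using insert.hyps by auto
  finally show ?case .
qed (auto intro: order_0I)

lemma roots_bounded:
  fixes p :: "nat \<Rightarrow> complex poly"
  assumes deg: "\<And>n. degree (p n) = D" "degree q = D" "q \<noteq> 0" and c: "\<And>k. (\<lambda>n. coeff (p n) k) \<longlonglongrightarrow> coeff q k"
    and nz: "\<And>n. p n \<noteq> 0" and z: "\<And>n. poly (p n) (z n) = 0"
  shows "bounded (range z)"
proof -
  let ?B = "\<lambda>n. 1 + (\<Sum>k<D. norm (coeff (p n) k)) / norm (coeff (p n) D)"
  have "coeff q D \<noteq> 0" using deg(2,3) by auto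
  then have "?B \<longlonglongrightarrow> 1 + (\<Sum>k<D. norm (coeff q k)) / norm (coeff q D)" by (intro tendsto_intros c) auto
  then have "bounded (range ?B)" by (rule convergent_imp_bounded)
  then obtain M where M: "\<And>n. \<bar>?B n\<bar> \<le> M" unfolding bounded_iff by auto
  have "norm (z n) \<le> M" for n
    using root_bound[OF deg(1) nz z, of n] M[of n] by linarith
  then show ?thesis unfolding bounded_iff by auto
qed

text \<open>
  The sequences of roots of $S_n - c$ and the normalised differences $E_n = (S_n - Q)/e_n$ are made
  convergent by passing to a subsequence. The fibres over $C$ have equally many points in total for
  $S_n$ and for $Q$, so roots that coincide in the limit already coincide for large $n$. For a
  critical point $\<kappa>$ of $Q$ with value $c$, let $m$ be its order as a root of $Q - c$, $k_n$
  the root of order at least $m$ of $S_n - c$ near it, and $\<delta>_n = k_n - \<kappa>$. Evaluating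
  the derivatives of order $i < m$ of $S_n - c = (Q - c) + e_n E_n$ at $k_n$ gives $e_n E_n^{(i)}(k_n)
  = - \<delta>_n^{m-i} q_i(k_n)$ with $q_i(\<kappa>) \<noteq> 0$. The case $i = m - 1$ shows that
  $\<delta>_n / e_n$ converges, and then the cases $i < m - 1$ show that the limit $D$ of $E_n$
  vanishes at $\<kappa>$ to order at least $m - 1$, the order of $Q'$.
\<close>

lemma eventually_eq_if_same_critical_values:
  fixes S :: "nat \<Rightarrow> complex poly"
  assumes N: "2 \<le> N" "degree Q = N" "\<And>n. degree (S n) = N"
    and lead: "\<And>n. coeff (S n) N = coeff Q N"
    and centred: "\<And>n. coeff (S n) (N - 1) = 0" "coeff Q (N - 1) = 0"
    and conv: "\<And>k. (\<lambda>n. coeff (S n) k) \<longlonglongrightarrow> coeff Q k"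
    and C: "C = poly Q ` {x. poly (pderiv Q) x = 0}"
    and crit: "\<And>n x. poly (pderiv (S n)) x = 0 \<Longrightarrow> poly (S n) x \<in> C"
  shows "\<exists>n. S n = Q"
proof (rule ccontr)
  assume "\<nexists>n. S n = Q"
  then have ne: "S n \<noteq> Q" for n by blast
  define l where "l = coeff Q N"
  have l: "l \<noteq> 0" using N by (auto simp: l_def)
  have dQ: "pderiv Q \<noteq> 0" using N by (auto simp: pderiv_eq_0_iff)
  have finC: "finite C" unfolding C using poly_roots_finite[OF dQ] by blast
  have critQ: "poly Q x \<in> C" if "poly (pderiv Q) x = 0" for x using that C by blast
  define e where "e n = (\<Sum>k\<le>N. norm (coeff (S n - Q) k))" for n
  have e: "e n > 0" for n
  proof -
    obtain k where k: "coeff (S n - Q) k \<noteq> 0" using ne[of n] by (metis coeff_0 poly_eqI eq_iff_diff_eq_0)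
    have "degree (S n - Q) \<le> N" using N degree_diff_le[of "S n" N Q] by simp
    then have "k \<le> N" using k le_degree order_trans by blast
    then show ?thesis unfolding e_def using k by (intro sum_pos2[of _ k]) auto
  qed
  define E where "E n = smult (1 / of_real (e n)) (S n - Q)" for n
  have cE: "norm (coeff (E n) k) = norm (coeff (S n - Q) k) / e n" for n k
    using e[of n] by (simp add: E_def norm_divide)
  have sumE: "(\<Sum>k\<le>N. norm (coeff (E n) k)) = 1" for n
    unfolding cE sum_divide_distrib[symmetric] e_def[symmetric] using e[of n] by simp
  have bE: "bounded (range (\<lambda>n. coeff (E n) k))" if "k \<le> N" for k
  proof -
    have "norm (coeff (E n) k) \<le> 1" for n
      using member_le_sum[of k "{..N}" "\<lambda>k. norm (coeff (E n) k)"] sumE[of n] that by auto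
    then show ?thesis unfolding bounded_iff by auto
  qed
  have "\<exists>\<rho>. S n - [:c:] = smult l (\<Prod>i<N. [:- \<rho> i, 1:])" for n c
  proof -
    have d: "degree (S n - [:c:]) = N" using N by (simp add: degree_diff_const)
    then have "lead_coeff (S n - [:c:]) = l" using lead[of n] N by (simp add: l_def coeff_eq_0)
    then show ?thesis using complex_poly_decompose'[of "S n - [:c:]"] d by metis
  qed
  then obtain \<rho> where \<rho>: "\<And>n c. S n - [:c:] = smult l (\<Prod>i<N. [:- \<rho> n c i, 1:])" by metis
  have b\<rho>: "bounded (range (\<lambda>n. \<rho> n c i))" if "i < N" for c i
  proof (rule roots_bounded[of "\<lambda>n. S n - [:c:]" N "Q - [:c:]"])
    show "degree (S n - [:c:]) = N" for n using N by (simp add: degree_diff_const)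
    then show "S n - [:c:] \<noteq> 0" for n using N by (metis degree_0 not_numeral_le_zero)
    show "degree (Q - [:c:]) = N" using N by (simp add: degree_diff_const)
    then show "Q - [:c:] \<noteq> 0" using N by auto
    show "(\<lambda>n. coeff (S n - [:c:]) k) \<longlonglongrightarrow> coeff (Q - [:c:]) k" for k
      by (simp add: tendsto_diff conv)
    show "poly (S n - [:c:]) (\<rho> n c i) = 0" for n
      unfolding \<rho> using that by (auto simp: poly_prod)
  qed
  let ?I = "Inl ` {..N} \<union> Inr ` (C \<times> {..<N})"
  define x where "x j = (case j of Inl k \<Rightarrow> (\<lambda>n. coeff (E n) k) | Inr (c, i) \<Rightarrow> (\<lambda>n. \<rho> n c i))" for j
  have finI: "finite ?I" using finC by auto
  have bI: "bounded (range (x j))" if "j \<in> ?I" for j using that bE b\<rho> by (auto simp: x_def)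
  obtain r L where r: "strict_mono (r :: nat \<Rightarrow> nat)" and L: "\<And>j. j \<in> ?I \<Longrightarrow> (\<lambda>n. x j (r n)) \<longlonglongrightarrow> L j"
  proof (rule finite_family_convergent_subsequence[OF finI bI])
    fix r :: "nat \<Rightarrow> nat" and L assume "strict_mono r" "\<And>j. j \<in> ?I \<Longrightarrow> (\<lambda>n. x j (r n)) \<longlonglongrightarrow> L j"
    then show thesis by (rule that)
  qed
  define D where "D = (\<Sum>k\<le>N. monom (L (Inl k)) k)"
  define t where "t c i = L (Inr (c, i))" for c i
  have cD: "coeff D k = (if k \<le> N then L (Inl k) else 0)" for k
    by (simp add: D_def coeff_sum)
  have Edeg: "degree (E n) \<le> N" for n
    using N degree_diff_le[of "S n" N Q] order_trans[OF degree_smult_le] by (auto simp: E_def)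
  have Econv: "(\<lambda>n. coeff (E (r n)) k) \<longlonglongrightarrow> coeff D k" for k
  proof (cases "k \<le> N")
    case True
    then show ?thesis using L[of "Inl k"] by (simp add: x_def cD)
  next
    case False
    then have "coeff (E (r n)) k = 0" for n using Edeg[of "r n"] by (intro coeff_eq_0) auto
    then show ?thesis using False by (simp add: cD)
  qed
  have tconv: "(\<lambda>n. \<rho> (r n) c i) \<longlonglongrightarrow> t c i" if "c \<in> C" "i < N" for c i
    using L[of "Inr (c, i)"] that by (auto simp: x_def t_def)
  have "(\<lambda>n. \<Sum>k\<le>N. norm (coeff (E (r n)) k)) \<longlonglongrightarrow> (\<Sum>k\<le>N. norm (coeff D k))"
    by (intro tendsto_intros Econv)
  then have "(\<Sum>k\<le>N. norm (coeff D k)) = 1" by (simp add: sumE LIMSEQ_const_iff)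
  then have D0: "D \<noteq> 0" by auto
  have Dz: "coeff D k = 0" if "k = N \<or> k = N - 1" for k
  proof -
    have "coeff (E n) k = 0" for n using that lead centred by (auto simp: E_def)
    then show ?thesis using Econv[of k] by (simp add: LIMSEQ_const_iff)
  qed
  have degD: "degree D \<le> N - 2"
  proof (rule degree_le, intro allI impI)
    fix k assume "N - 2 < k"
    then have "k = N \<or> k = N - 1 \<or> N < k" by linarith
    then consider "k = N \<or> k = N - 1" | "N < k" by blast
    then show "coeff D k = 0"
    proof cases
      case 1
      then show ?thesis by (rule Dz)
    qed (simp add: cD)
  qed
  have Qt: "Q - [:c:] = smult l (\<Prod>i<N. [:- t c i, 1:])" if c: "c \<in> C" for c
  proof -
    have "poly (Q - [:c:]) y = poly (smult l (\<Prod>i<N. [:- t c i, 1:])) y" for y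
    proof -
      have "(\<lambda>n. l * (\<Prod>i<N. y - \<rho> (r n) c i)) \<longlonglongrightarrow> l * (\<Prod>i<N. y - t c i)"
        using c by (intro tendsto_intros tconv) auto
      moreover have "l * (\<Prod>i<N. y - \<rho> (r n) c i) = poly (S (r n) - [:c:]) y" for n
        unfolding \<rho> by (simp add: poly_prod)
      moreover have "(\<lambda>n. poly (S (r n) - [:c:]) y) \<longlonglongrightarrow> poly (Q - [:c:]) y"
      proof -
        have "(\<lambda>n. poly (S n) y) \<longlonglongrightarrow> poly Q y"
          by (rule poly_tendsto[of S N Q]) (use N conv in auto)
        from LIMSEQ_subseq_LIMSEQ[OF this r] show ?thesis by (simp add: o_def tendsto_diff)
      qed
      ultimately show ?thesis using LIMSEQ_unique by (fastforce simp: poly_prod)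
    qed
    then show ?thesis by (simp add: poly_eq_poly_eq_iff[symmetric] fun_eq_iff)
  qed
  have fibS: "{y. poly (S n) y = c} = \<rho> n c ` {..<N}" for n c
  proof -
    have "poly (S n) y = c \<longleftrightarrow> poly (S n - [:c:]) y = 0" for y by simp
    also have "\<dots> y \<longleftrightarrow> y \<in> \<rho> n c ` {..<N}" for y unfolding \<rho> using l by (auto simp: poly_prod)
    finally show ?thesis by blast
  qed
  have fibQ: "{y. poly Q y = c} = t c ` {..<N}" if "c \<in> C" for c
  proof -
    have "poly Q y = c \<longleftrightarrow> poly (Q - [:c:]) y = 0" for y by simp
    also have "\<dots> y \<longleftrightarrow> y \<in> t c ` {..<N}" for y unfolding Qt[OF that] using l by (auto simp: poly_prod)
    finally show ?thesis by blast
  qed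
  have cards: "(\<Sum>c\<in>C. card (t c ` {..<N})) = (\<Sum>c\<in>C. card (\<rho> n c ` {..<N}))" for n
  proof -
    have "(\<Sum>c\<in>C. card {y. poly Q y = c}) + (N - 1) = (\<Sum>c\<in>C. card {y. poly (S n) y = c}) + (N - 1)"
      using sum_card_fibres[OF finC critQ] sum_card_fibres[OF finC crit[of n]] N by simp
    then show ?thesis by (simp add: fibS fibQ)
  qed
  \<comment> \<open>Distinct limits have distinct approximants, so each fibre of $S_n$ has at least as many points as the limit fibre; equal totals force equality fibre by fibre.\<close>
  have glue: "\<forall>\<^sub>F n in sequentially. \<forall>c\<in>C. \<forall>i<N. \<forall>j<N. t c i = t c j \<longrightarrow> \<rho> (r n) c i = \<rho> (r n) c j"
  proof -
    have "\<forall>\<^sub>F n in sequentially. \<forall>c\<in>C. \<forall>i\<in>{..<N}. \<forall>j\<in>{..<N}. t c i \<noteq> t c j \<longrightarrow> \<rho> (r n) c i \<noteq> \<rho> (r n) c j"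
    proof (intro eventually_ball_finite ballI finC)
      fix c i j assume *: "c \<in> C" "i \<in> {..<N}" "j \<in> {..<N}"
      have lim: "(\<lambda>n. \<rho> (r n) c i - \<rho> (r n) c j) \<longlonglongrightarrow> t c i - t c j" using * by (intro tendsto_intros tconv) auto
      show "\<forall>\<^sub>F n in sequentially. t c i \<noteq> t c j \<longrightarrow> \<rho> (r n) c i \<noteq> \<rho> (r n) c j"
      proof (cases "t c i = t c j")
        case False
        then have "t c i - t c j \<noteq> 0" by simp
        from tendsto_imp_eventually_ne[OF lim this] show ?thesis by eventually_elim auto
      qed simp
    qed auto
    then show ?thesis
    proof eventually_elim
      case (elim n)
      define h where "h c y = t c (SOME i. i < N \<and> \<rho> (r n) c i = y)" for c y
      have h: "h c (\<rho> (r n) c i) = t c i" if "c \<in> C" "i < N" for c i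
      proof -
        have "(SOME j. j < N \<and> \<rho> (r n) c j = \<rho> (r n) c i) < N \<and>
            \<rho> (r n) c (SOME j. j < N \<and> \<rho> (r n) c j = \<rho> (r n) c i) = \<rho> (r n) c i"
          by (rule someI[of "\<lambda>j. j < N \<and> \<rho> (r n) c j = \<rho> (r n) c i" i]) (use that in simp)
        then show ?thesis unfolding h_def using elim that by fastforce
      qed
      have im: "t c ` {..<N} = h c ` \<rho> (r n) c ` {..<N}" if "c \<in> C" for c
        using h[OF that] by (force simp: image_image)
      have le: "card (t c ` {..<N}) \<le> card (\<rho> (r n) c ` {..<N})" if "c \<in> C" for c
        unfolding im[OF that] by (rule card_image_le) simp
      have eq: "card (h c ` \<rho> (r n) c ` {..<N}) = card (\<rho> (r n) c ` {..<N})" if c: "c \<in> C" for c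
        using sum_mono_inv[OF cards[of "r n"] le c finC] im[OF c] by simp
      show ?case
      proof (intro ballI allI impI)
        fix c i j assume *: "c \<in> C" "i < N" "j < N" "t c i = t c j"
        have "inj_on (h c) (\<rho> (r n) c ` {..<N})" using eq[OF *(1)] by (intro eq_card_imp_inj_on) auto
        moreover have "h c (\<rho> (r n) c i) = h c (\<rho> (r n) c j)" using h * by simp
        ultimately show "\<rho> (r n) c i = \<rho> (r n) c j" using * unfolding inj_on_def by auto
      qed
    qed
  qed
  have ordD: "order \<kappa> (pderiv Q) \<le> order \<kappa> D" if \<kappa>: "poly (pderiv Q) \<kappa> = 0" for \<kappa>
  proof -
    define c where "c = poly Q \<kappa>"
    have cC: "c \<in> C" using critQ[OF \<kappa>] by (simp add: c_def)
    have "\<kappa> \<in> t c ` {..<N}" using fibQ[OF cC] by (auto simp: c_def)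
    then obtain i0 where i0: "i0 < N" "t c i0 = \<kappa>" by auto
    define k where "k n = \<rho> (r n) c i0" for n
    have k: "k \<longlonglongrightarrow> \<kappa>" using tconv[OF cC i0(1)] i0(2) by (simp add: k_def[abs_def])
    define Qc where "Qc = Q - [:c:]"
    have "degree Qc = N" using N unfolding Qc_def by (simp add: degree_diff_const)
    then have Qc: "Qc \<noteq> 0" "pderiv Qc = pderiv Q" "poly Qc \<kappa> = 0"
      using N(1) by (auto simp: Qc_def pderiv_diff pderiv_pCons c_def)
    define m where "m = order \<kappa> Qc"
    have m: "m = Suc (order \<kappa> (pderiv Q))"
      using order_pderiv[of Qc \<kappa>] Qc dQ by (simp add: m_def order_root)
    define J where "J = {j \<in> {..<N}. t c j = \<kappa>}"
    have mJ: "m = card J"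
      unfolding m_def Qc_def Qt[OF cC] order_smult[OF l] J_def by (rule order_prod_linear) simp
    have root: "\<forall>\<^sub>F n in sequentially. \<forall>i<m. poly ((pderiv ^^ i) (S (r n) - [:c:])) (k n) = 0"
      using glue
    proof eventually_elim
      case (elim n)
      have "(\<Prod>j<N. [:- \<rho> (r n) c j, 1:]) = (\<Prod>j\<in>{..<N} - J. [:- \<rho> (r n) c j, 1:]) * (\<Prod>j\<in>J. [:- \<rho> (r n) c j, 1:])"
        by (rule prod.subset_diff) (auto simp: J_def)
      moreover have "(\<Prod>j\<in>J. [:- \<rho> (r n) c j, 1:]) = (\<Prod>j\<in>J. [:- k n, 1:])"
      proof (rule prod.cong[OF refl])
        fix j assume "j \<in> J"
        then have "j < N" "t c j = t c i0" using i0(2) by (simp_all add: J_def)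
        then have "\<rho> (r n) c j = \<rho> (r n) c i0" using elim cC i0(1) by blast
        then show "[:- \<rho> (r n) c j, 1:] = [:- k n, 1:]" by (simp add: k_def)
      qed
      ultimately have "[:- k n, 1:] ^ m dvd S (r n) - [:c:]"
        unfolding \<rho> mJ by (simp only: prod_constant) (intro dvd_smult dvd_triv_right)
      moreover have "degree (S (r n) - [:c:]) = N" using N by (simp add: degree_diff_const)
      then have S0: "S (r n) - [:c:] \<noteq> 0" using N(1) by (metis degree_0 not_numeral_le_zero)
      ultimately have le: "m \<le> order (k n) (S (r n) - [:c:])" by (simp add: order_divides)
      show ?case
      proof (intro allI impI)
        fix i assume i: "i < m"
        have "(pderiv ^^ i) (S (r n) - [:c:]) \<noteq> 0 \<and> order (k n) ((pderiv ^^ i) (S (r n) - [:c:])) = order (k n) (S (r n) - [:c:]) - i"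
          by (rule order_iterated_pderiv[OF S0]) (use i le in simp)
        then show "poly ((pderiv ^^ i) (S (r n) - [:c:])) (k n) = 0" using i le by (simp add: order_root)
      qed
    qed
    define \<delta> where "\<delta> n = k n - \<kappa>" for n
    have \<delta>: "\<delta> \<longlonglongrightarrow> 0" using tendsto_diff[OF k tendsto_const[of \<kappa>]] by (simp add: \<delta>_def[abs_def])
    have "\<exists>q. (pderiv ^^ i) Qc = [:- \<kappa>, 1:] ^ (m - i) * q \<and> poly q \<kappa> \<noteq> 0" if "i < m" for i
    proof -
      have "(pderiv ^^ i) Qc \<noteq> 0" "order \<kappa> ((pderiv ^^ i) Qc) = m - i"
        using order_iterated_pderiv[OF Qc(1), of i \<kappa>] that by (auto simp: m_def)
      then show ?thesis using order_decomp[of "(pderiv ^^ i) Qc" \<kappa>] by (auto simp: poly_eq_0_iff_dvd)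
    qed
    then obtain q where q: "\<And>i. i < m \<Longrightarrow> (pderiv ^^ i) Qc = [:- \<kappa>, 1:] ^ (m - i) * q i"
        "\<And>i. i < m \<Longrightarrow> poly (q i) \<kappa> \<noteq> 0" by metis
    have eqn: "\<forall>\<^sub>F n in sequentially. \<forall>i<m. of_real (e (r n)) * poly ((pderiv ^^ i) (E (r n))) (k n) = - (\<delta> n ^ (m - i) * poly (q i) (k n))"
      using root
    proof eventually_elim
      case (elim n)
      show ?case
      proof (intro allI impI)
        fix i assume i: "i < m"
        have "S (r n) - [:c:] = smult (of_real (e (r n))) (E (r n)) - (- Qc)"
          using e[of "r n"] by (simp add: E_def Qc_def)
        then have "(pderiv ^^ i) (S (r n) - [:c:]) = smult (of_real (e (r n))) ((pderiv ^^ i) (E (r n))) - (pderiv ^^ i) (- Qc)"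
          by (simp only: iterated_pderiv_linear)
        moreover have "(pderiv ^^ i) (- Qc) = - (pderiv ^^ i) Qc"
          using iterated_pderiv_linear[of i 0 0 Qc] by simp
        ultimately have "of_real (e (r n)) * poly ((pderiv ^^ i) (E (r n))) (k n) + poly ((pderiv ^^ i) Qc) (k n) = 0"
          using elim i by (metis (no_types, lifting) diff_minus_eq_add poly_add poly_smult)
        then show "of_real (e (r n)) * poly ((pderiv ^^ i) (E (r n))) (k n) = - (\<delta> n ^ (m - i) * poly (q i) (k n))"
          unfolding q(1)[OF i] by (simp add: \<delta>_def poly_power eq_neg_iff_add_eq_0)
      qed
    qed
    have Elim: "(\<lambda>n. poly ((pderiv ^^ i) (E (r n))) (k n)) \<longlonglongrightarrow> poly ((pderiv ^^ i) D) \<kappa>" for i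
    proof (rule poly_tendsto[OF _ _ _ k, of _ N])
      show "degree ((pderiv ^^ i) (E (r n))) \<le> N" for n
        using degree_iterated_pderiv_le[of i "E (r n)"] Edeg[of "r n"] by linarith
      show "degree ((pderiv ^^ i) D) \<le> N"
        using degree_iterated_pderiv_le[of i D] degD by linarith
    qed (rule coeff_iterated_pderiv_tendsto[OF Econv])
    have qlim: "(\<lambda>n. poly (q i) (k n)) \<longlonglongrightarrow> poly (q i) \<kappa>" for i by (intro tendsto_intros k)
    have mm: "m - 1 < m" using m by simp
    define W where "W n = - (poly ((pderiv ^^ (m - 1)) (E (r n))) (k n) / poly (q (m - 1)) (k n))" for n
    define wl where "wl = - (poly ((pderiv ^^ (m - 1)) D) \<kappa> / poly (q (m - 1)) \<kappa>)"
    have W: "W \<longlonglongrightarrow> wl"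
      unfolding W_def wl_def by (intro tendsto_intros Elim qlim q(2)[OF mm])
    have D\<delta>: "\<forall>\<^sub>F n in sequentially. \<delta> n = of_real (e (r n)) * W n"
      using eqn tendsto_imp_eventually_ne[OF qlim q(2)[OF mm]]
    proof eventually_elim
      case (elim n)
      have "m - (m - 1) = 1" using m by simp
      then have "of_real (e (r n)) * poly ((pderiv ^^ (m - 1)) (E (r n))) (k n) = - (\<delta> n * poly (q (m - 1)) (k n))"
        using elim(1)[rule_format, OF mm] by simp
      then have "\<delta> n = - (of_real (e (r n)) * poly ((pderiv ^^ (m - 1)) (E (r n))) (k n)) / poly (q (m - 1)) (k n)"
        using elim(2) by (simp add: field_simps)
      then show ?case by (simp add: W_def)
    qed
    have zero: "poly ((pderiv ^^ i) D) \<kappa> = 0" if i: "i < m - 1" for i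
    proof -
      have "(\<lambda>n. - (W n * \<delta> n ^ (m - i - 1) * poly (q i) (k n))) \<longlonglongrightarrow> - (wl * 0 ^ (m - i - 1) * poly (q i) \<kappa>)"
        by (intro tendsto_intros W \<delta> qlim)
      moreover have "\<forall>\<^sub>F n in sequentially. - (W n * \<delta> n ^ (m - i - 1) * poly (q i) (k n)) = poly ((pderiv ^^ i) (E (r n))) (k n)"
        using eqn D\<delta>
      proof eventually_elim
        case (elim n)
        have "m - i = Suc (m - i - 1)" using i by simp
        then have "\<delta> n ^ (m - i) = of_real (e (r n)) * (W n * \<delta> n ^ (m - i - 1))"
          using elim(2) by (metis mult.assoc power_Suc)
        then have "of_real (e (r n)) * poly ((pderiv ^^ i) (E (r n))) (k n) = of_real (e (r n)) * - (W n * \<delta> n ^ (m - i - 1) * poly (q i) (k n))"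
          using elim(1) i by simp
        moreover have "complex_of_real (e (r n)) \<noteq> 0" using e[of "r n"] by simp
        ultimately show ?case using mult_left_cancel by metis
      qed
      ultimately have "(\<lambda>n. poly ((pderiv ^^ i) (E (r n))) (k n)) \<longlonglongrightarrow> - (wl * 0 ^ (m - i - 1) * poly (q i) \<kappa>)"
        by (rule Lim_transform_eventually)
      from LIMSEQ_unique[OF Elim this] i show ?thesis by (simp add: power_0_left)
    qed
    have "m - 1 \<le> order \<kappa> D"
    proof (rule ccontr)
      assume "\<not> m - 1 \<le> order \<kappa> D"
      then have lt: "order \<kappa> D < m - 1" by simp
      have "(pderiv ^^ order \<kappa> D) D \<noteq> 0 \<and> order \<kappa> ((pderiv ^^ order \<kappa> D) D) = order \<kappa> D - order \<kappa> D"
        by (rule order_iterated_pderiv[OF D0]) simp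
      then show False using zero[OF lt] by (simp add: order_root)
    qed
    then show ?thesis using m by simp
  qed
  have "N - 1 = (\<Sum>x | poly (pderiv Q) x = 0. order x (pderiv Q))"
    using sum_orders_complex[OF dQ] N(2) by (simp add: degree_pderiv)
  also have "\<dots> \<le> (\<Sum>x | poly (pderiv Q) x = 0. order x D)" using ordD by (intro sum_mono) simp
  also have "\<dots> \<le> (\<Sum>x | poly D x = 0. order x D)"
  proof (rule sum_mono2)
    show "finite {x. poly D x = 0}" by (rule poly_roots_finite[OF D0])
    show "{x. poly (pderiv Q) x = 0} \<subseteq> {x. poly D x = 0}"
    proof
      fix x assume x: "x \<in> {x. poly (pderiv Q) x = 0}"
      then have "0 < order x (pderiv Q)" using dQ by (simp add: order_root)
      then have "0 < order x D" using ordD x by fastforce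
      then show "x \<in> {x. poly D x = 0}" by (simp add: order_root)
    qed
  qed simp
  also have "\<dots> = degree D" by (rule sum_orders_complex[OF D0])
  finally show False using degD N(1) by simp
qed

section \<open>Triviality of the family\<close>

text \<open>
  The factors $\<xi>_n$ accumulate at some $x \<noteq> 0$ with $x C = C$, since critical values
  converge along with the polynomials. Multiplying $Q_n$ by $x / \<xi>_n$ makes its critical values
  equal to $C$, and a scaling of $y$ that tends to $1$ restores the leading coefficient.
\<close>

lemma same_critical_values_imp_orbit:
  fixes Q :: "nat \<Rightarrow> complex poly"
  assumes N: "2 \<le> N" "degree Q0 = N" "\<And>n. degree (Q n) = N"
    and centred: "\<And>n. coeff (Q n) (N - 1) = 0" "coeff Q0 (N - 1) = 0"
    and conv: "\<And>k. (\<lambda>n. coeff (Q n) k) \<longlonglongrightarrow> coeff Q0 k"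
    and C: "C = poly Q0 ` {x. poly (pderiv Q0) x = 0}" "0 \<notin> C"
    and \<xi>: "\<And>n. \<xi> n \<noteq> 0" "\<And>n. poly (Q n) ` {x. poly (pderiv (Q n)) x = 0} = (\<lambda>c. \<xi> n * c) ` C"
  shows "\<exists>n \<zeta> \<eta>. \<zeta> \<noteq> 0 \<and> \<eta> \<noteq> 0 \<and> (\<forall>y. poly Q0 y = \<zeta> * poly (Q n) (\<eta> * y))"
proof -
  have dQ0: "pderiv Q0 \<noteq> 0" using N by (auto simp: pderiv_eq_0_iff)
  have finC: "finite C" unfolding C using poly_roots_finite[OF dQ0] by blast
  have "degree (pderiv Q0) \<noteq> 0" using N by (simp add: degree_pderiv)
  then obtain x0 where "poly (pderiv Q0) x0 = 0"
    using fundamental_theorem_of_algebra by (metis constant_degree)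
  then obtain c1 where c1: "c1 \<in> C" using C by blast
  have "\<exists>\<kappa>. poly (pderiv (Q n)) \<kappa> = 0 \<and> poly (Q n) \<kappa> = \<xi> n * c" if "c \<in> C" for c n
  proof -
    have "\<xi> n * c \<in> poly (Q n) ` {x. poly (pderiv (Q n)) x = 0}" unfolding \<xi>(2) using that by blast
    then show ?thesis by auto
  qed
  then obtain \<kappa> where \<kappa>: "\<And>c n. c \<in> C \<Longrightarrow> poly (pderiv (Q n)) (\<kappa> c n) = 0"
      "\<And>c n. c \<in> C \<Longrightarrow> poly (Q n) (\<kappa> c n) = \<xi> n * c" by metis
  have dconv: "(\<lambda>n. coeff (pderiv (Q n)) k) \<longlonglongrightarrow> coeff (pderiv Q0) k" for k
    using coeff_iterated_pderiv_tendsto[OF conv, of 1 k] by simp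
  have b\<kappa>: "bounded (range (\<kappa> c))" if "c \<in> C" for c
  proof (rule roots_bounded[OF _ _ dQ0 dconv])
    show "degree (pderiv (Q n)) = N - 1" for n using N by (simp add: degree_pderiv)
    show "degree (pderiv Q0) = N - 1" using N by (simp add: degree_pderiv)
    show "pderiv (Q n) \<noteq> 0" for n using N(1) N(3)[of n] by (simp add: pderiv_eq_0_iff)
    show "poly (pderiv (Q n)) (\<kappa> c n) = 0" for n using \<kappa>(1)[OF that] .
  qed
  obtain r k where r: "strict_mono (r :: nat \<Rightarrow> nat)" and k: "\<And>c. c \<in> C \<Longrightarrow> (\<lambda>n. \<kappa> c (r n)) \<longlonglongrightarrow> k c"
  proof (rule finite_family_convergent_subsequence[OF finC b\<kappa>])
    fix r :: "nat \<Rightarrow> nat" and k assume "strict_mono r" "\<And>c. c \<in> C \<Longrightarrow> (\<lambda>n. \<kappa> c (r n)) \<longlonglongrightarrow> k c"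
    then show thesis by (rule that)
  qed
  have convr: "(\<lambda>n. coeff (Q (r n)) i) \<longlonglongrightarrow> coeff Q0 i" for i
    using LIMSEQ_subseq_LIMSEQ[OF conv r] by (simp add: o_def)
  have dconvr: "(\<lambda>n. coeff (pderiv (Q (r n))) i) \<longlonglongrightarrow> coeff (pderiv Q0) i" for i
    using LIMSEQ_subseq_LIMSEQ[OF dconv r] by (simp add: o_def)
  have kC: "poly Q0 (k c) \<in> C" if c: "c \<in> C" for c
  proof -
    have "(\<lambda>n. poly (pderiv (Q (r n))) (\<kappa> c (r n))) \<longlonglongrightarrow> poly (pderiv Q0) (k c)"
      by (rule poly_tendsto[of _ N, OF _ _ dconvr k[OF c]]) (use N in \<open>auto simp: degree_pderiv\<close>)
    then have "poly (pderiv Q0) (k c) = 0" using \<kappa>(1)[OF c] by (simp add: LIMSEQ_const_iff)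
    then show ?thesis using C by blast
  qed
  have \<xi>c: "(\<lambda>n. \<xi> (r n) * c) \<longlonglongrightarrow> poly Q0 (k c)" if c: "c \<in> C" for c
  proof -
    have "(\<lambda>n. poly (Q (r n)) (\<kappa> c (r n))) \<longlonglongrightarrow> poly Q0 (k c)"
      by (rule poly_tendsto[of _ N, OF _ _ convr k[OF c]]) (use N in auto)
    then show ?thesis using \<kappa>(2)[OF c] by simp
  qed
  define x where "x = poly Q0 (k c1) / c1"
  have c1n: "c1 \<noteq> 0" using c1 C(2) by blast
  have "(\<lambda>n. \<xi> (r n) * c1 / c1) \<longlonglongrightarrow> x" unfolding x_def by (intro tendsto_intros \<xi>c c1 c1n)
  then have \<xi>x: "(\<lambda>n. \<xi> (r n)) \<longlonglongrightarrow> x" using c1n by simp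
  have x0: "x \<noteq> 0" using kC[OF c1] C(2) c1n by (auto simp: x_def)
  have xc: "x * c \<in> C" if "c \<in> C" for c
    using LIMSEQ_unique[OF tendsto_mult[OF \<xi>x tendsto_const[of c]] \<xi>c[OF that]] kC[OF that] by simp
  have xC: "(\<lambda>c. x * c) ` C = C"
    by (rule endo_inj_surj[OF finC]) (use xc x0 in \<open>auto simp: inj_on_def\<close>)
  define l where "l = coeff Q0 N"
  have l: "l \<noteq> 0" using N by (auto simp: l_def)
  define ln where "ln n = x / \<xi> (r n) * coeff (Q (r n)) N" for n
  have ln0: "ln n \<noteq> 0" for n using N(1) N(3)[of "r n"] x0 \<xi>(1) by (auto simp: ln_def)
  have lnl: "ln \<longlonglongrightarrow> l"
  proof -
    have "ln \<longlonglongrightarrow> x / x * coeff Q0 N" unfolding ln_def by (intro tendsto_intros \<xi>x x0 convr)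
    then show ?thesis using x0 by (simp add: l_def)
  qed
  \<comment> \<open>The principal branch gives the root of $l / l_n$ that tends to $1$.\<close>
  define \<eta> where "\<eta> n = exp (Ln (l / ln n) / of_nat N)" for n
  have \<eta>N: "\<eta> n ^ N * ln n = l" for n
    using N(1) l ln0[of n] by (simp add: \<eta>_def flip: exp_of_nat_mult)
  have \<eta>1: "\<eta> \<longlonglongrightarrow> 1"
  proof -
    have "(\<lambda>n. l / ln n) \<longlonglongrightarrow> l / l" by (intro tendsto_intros lnl l)
    then have "(\<lambda>n. l / ln n) \<longlonglongrightarrow> 1" using l by simp
    then have "\<eta> \<longlonglongrightarrow> exp (Ln 1 / of_nat N)" unfolding \<eta>_def by (intro tendsto_intros) (use N in auto)
    then show ?thesis by simp
  qed
  have \<eta>0: "\<eta> n \<noteq> 0" for n by (simp add: \<eta>_def)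
  define S where "S n = smult (x / \<xi> (r n)) (Q (r n) \<circ>\<^sub>p [:0, \<eta> n:])" for n
  have cS: "coeff (S n) k = x / \<xi> (r n) * (\<eta> n ^ k * coeff (Q (r n)) k)" for n k
    by (simp add: S_def coeff_pcompose_linear)
  have "\<exists>n. S n = Q0"
  proof (rule eventually_eq_if_same_critical_values[OF N(1,2) _ _ _ centred(2) _ C(1)])
    show "degree (S n) = N" for n using N(3)[of "r n"] x0 \<xi>(1) \<eta>0 by (simp add: S_def degree_pcompose)
    show "coeff (S n) N = coeff Q0 N" for n using \<eta>N[of n] by (simp add: cS ln_def l_def mult_ac)
    show "coeff (S n) (N - 1) = 0" for n using centred(1)[of "r n"] by (simp add: cS)
    show "(\<lambda>n. coeff (S n) k) \<longlonglongrightarrow> coeff Q0 k" for k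
    proof -
      have "(\<lambda>n. coeff (S n) k) \<longlonglongrightarrow> x / x * (1 ^ k * coeff Q0 k)"
        unfolding cS by (intro tendsto_intros \<xi>x x0 \<eta>1 convr)
      then show ?thesis using x0 by simp
    qed
    fix n y assume y: "poly (pderiv (S n)) y = 0"
    have "poly (S n) ` {x. poly (pderiv (S n)) x = 0} = (\<lambda>c. x / \<xi> (r n) * c) ` (\<lambda>c. \<xi> (r n) * c) ` C"
      unfolding S_def critical_values_affine[OF \<eta>0] \<xi>(2) using x0 \<xi>(1) by simp
    also have "\<dots> = (\<lambda>c. x * c) ` C" using \<xi>(1) by (simp add: image_image)
    also have "\<dots> = C" by (rule xC)
    finally show "poly (S n) y \<in> C" using y by blast
  qed
  then obtain n where n: "S n = Q0" by blast
  have "poly Q0 y = x / \<xi> (r n) * poly (Q (r n)) (\<eta> n * y)" for y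
    unfolding n[symmetric] by (simp add: S_def poly_pcompose mult.commute)
  moreover have "x / \<xi> (r n) \<noteq> 0" using x0 \<xi>(1) by simp
  ultimately show ?thesis using \<eta>0 by blast
qed

lemma weighted_germ_exists:
  assumes ab: "0 < a" "a < b" and w: "weighted a b d R" and N: "2 \<le> degree R"
    and eq: "analytically_equivalent f (homogenization a b d R)" and iso: "isolated_singularity f" and mini: "miniregular f"
  shows "\<exists>X Y X' Y' U V. weighted_germ a b d R f X Y X' Y' U V"
proof -
  obtain \<Phi> where \<Phi>: "biholomorphic_germ \<Phi>" "\<forall>\<^sub>F z in nhds 0. f z = homogenization a b d R (\<Phi> z)"
    using analytically_equivalent_sym[OF eq] unfolding analytically_equivalent_def by blast
  obtain U V \<Psi> where *: "open U" "open V" "0 \<in> U" "0 \<in> V" "homeomorphism U V \<Phi> \<Psi>" "\<Phi> 0 = 0" "\<Psi> 0 = 0"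
    "holomorphic2_on (fst \<circ> \<Phi>) U" "holomorphic2_on (snd \<circ> \<Phi>) U"
    "holomorphic2_on (fst \<circ> \<Psi>) V" "holomorphic2_on (snd \<circ> \<Psi>) V"
    using biholomorphic_germ_inverse[OF \<Phi>(1)] by metis
  obtain W where W: "open W" "0 \<in> W" "\<And>z. z \<in> W \<Longrightarrow> f z = homogenization a b d R (\<Phi> z)"
    using \<Phi>(2) unfolding eventually_nhds by blast
  have c: "continuous_on V \<Psi>" and i: "\<And>z. z \<in> U \<Longrightarrow> \<Psi> (\<Phi> z) = z" "\<And>z. z \<in> V \<Longrightarrow> \<Phi> (\<Psi> z) = z"
      "\<And>z. z \<in> U \<Longrightarrow> \<Phi> z \<in> V" "\<And>z. z \<in> V \<Longrightarrow> \<Psi> z \<in> U"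
    using *(5) unfolding homeomorphism_def by auto
  have "weighted_germ a b d R f (fst \<circ> \<Phi>) (snd \<circ> \<Phi>) (fst \<circ> \<Psi>) (snd \<circ> \<Psi>) (U \<inter> W) (V \<inter> \<Psi> -` W)"
  proof unfold_locales
    show "isolated_singularity (homogenization a b d R)"
      by (rule isolated_singularity_analytically_equivalent[OF iso eq])
    show "open (V \<inter> \<Psi> -` W)" by (rule continuous_open_preimage[OF c *(2) W(1)])
    show "holomorphic2_on (fst \<circ> \<Phi>) (U \<inter> W)" "holomorphic2_on (snd \<circ> \<Phi>) (U \<inter> W)"
      "holomorphic2_on (fst \<circ> \<Psi>) (V \<inter> \<Psi> -` W)" "holomorphic2_on (snd \<circ> \<Psi>) (V \<inter> \<Psi> -` W)"
      using *(8-11) by (auto elim: holomorphic2_on_mono)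
  qed (use assms * W i in \<open>auto simp: o_def\<close>)
  then show ?thesis by blast
qed

lemma degree_homogenization:
  assumes iso: "isolated_singularity (homogenization a b d R)" and w: "weighted a b d R" and ab: "0 < a" "a < b"
  shows "degree R = d div b"
proof -
  obtain i where i: "i \<le> 1" "d = a * i + b * degree R" using isolated_homogenization(4)[OF iso w ab] by blast
  have "a * i < b" using i(1) ab by (cases "i = 0") (auto simp: le_Suc_eq)
  then show ?thesis using i(2) by simp
qed

lemma normal_form_exists:
  assumes ab: "0 < a" "a < b" and w: "weighted a b d R"
    and eq: "analytically_equivalent f (homogenization a b d R)" and iso: "isolated_singularity f" and mini: "miniregular f"
    and N: "2 \<le> degree R"
  shows "\<exists>e p Q. weighted a b d Q \<and> degree Q = degree R \<and> analytically_equivalent f (homogenization a b d Q) \<and>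
    henry_parusinski f = (\<lambda>\<kappa>. (of_nat d / of_nat a, poly Q \<kappa>)) ` {\<kappa>. poly (pderiv Q) \<kappa> = 0} \<and>
    weighted_expansion a b d f e p Q"
proof -
  obtain X Y X' Y' U V where wg: "weighted_germ a b d R f X Y X' Y' U V"
    using weighted_germ_exists[OF ab w N eq iso mini] by blast
  interpret weighted_germ a b d R f X Y X' Y' U V by (rule wg)
  show ?thesis by (rule normal_form) blast
qed

lemma continuous_on_coefficients:
  fixes p :: "real \<Rightarrow> complex poly"
  assumes "\<And>t. t \<in> S \<Longrightarrow> degree (p t) \<le> D" "\<And>y. continuous_on S (\<lambda>t. poly (p t) y)"
  shows "continuous_on S (\<lambda>t. coeff (p t) k)"
  unfolding continuous_on_def
proof
  fix x assume x: "x \<in> S"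
  let ?p = "\<lambda>t. if t \<in> S then p t else p x"
  have ev: "\<forall>\<^sub>F t in at x within S. t \<in> S" by (simp add: eventually_at_filter)
  have "((\<lambda>t. coeff (?p t) k) \<longlongrightarrow> coeff (p x) k) (at x within S)"
  proof (rule coefficients_tendsto[of ?p D _ "{}"])
    fix y
    have "((\<lambda>t. poly (p t) y) \<longlongrightarrow> poly (p x) y) (at x within S)"
      using assms(2) x unfolding continuous_on_def by blast
    moreover have "\<forall>\<^sub>F t in at x within S. poly (p t) y = poly (?p t) y" using ev by eventually_elim simp
    ultimately show "((\<lambda>t. poly (?p t) y) \<longlongrightarrow> poly (p x) y) (at x within S)" by (rule Lim_transform_eventually)
  qed (use assms(1) x in auto)
  moreover have "\<forall>\<^sub>F t in at x within S. coeff (?p t) k = coeff (p t) k" using ev by eventually_elim simp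
  ultimately show "((\<lambda>t. coeff (p t) k) \<longlongrightarrow> coeff (p x) k) (at x within S)" by (rule Lim_transform_eventually)
qed

lemma coeff_translate:
  fixes p :: "complex poly"
  assumes "degree p = N" "0 < N"
  shows "coeff (p \<circ>\<^sub>p [:g, 1:]) (N - 1) = coeff p (N - 1) + of_nat N * g * coeff p N"
proof -
  have "p \<circ>\<^sub>p [:g, 1:] = (\<Sum>l\<le>N. smult (coeff p l) ([:g, 1:] ^ l))"
    unfolding pcompose_altdef poly_altdef using assms by (simp add: coeff_map_poly degree_map_poly)
  then have "coeff (p \<circ>\<^sub>p [:g, 1:]) (N - 1) = (\<Sum>l\<le>N. coeff p l * coeff ([:g, 1:] ^ l) (N - 1))"
    by (simp add: coeff_sum)
  also have "\<dots> = (\<Sum>l\<in>{N - 1, N}. coeff p l * coeff ([:g, 1:] ^ l) (N - 1))"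
  proof (rule sum.mono_neutral_right)
    show "\<forall>l\<in>{..N} - {N - 1, N}. coeff p l * coeff ([:g, 1:] ^ l) (N - 1) = 0"
    proof
      fix l assume "l \<in> {..N} - {N - 1, N}"
      then have "degree ([:g, 1:] ^ l) < N - 1" by (auto simp: degree_linear_power)
      then show "coeff p l * coeff ([:g, 1:] ^ l) (N - 1) = 0" by (simp add: coeff_eq_0)
    qed
  qed auto
  also have "\<dots> = coeff p (N - 1) + of_nat N * g * coeff p N"
  proof -
    obtain n where n: "N = Suc n" using assms(2) by (cases N) auto
    have "coeff ([:g, 1:] ^ n) n = 1" "coeff ([:g, 1:] ^ Suc n) n = of_nat (Suc n) * g"
      using coeff_linear_poly_power[of n n g 1] coeff_linear_poly_power[of n "Suc n" g 1] by simp_all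
    then show ?thesis unfolding n by (simp del: power_Suc)
  qed
  finally show ?thesis .
qed

lemma degree_eq_1E:
  assumes "degree p = 1"
  obtains u v where "p = [:v, u:]" "u \<noteq> 0"
proof (cases p)
  case (pCons v q)
  then have "degree q = 0" "q \<noteq> 0" using assms by (auto split: if_splits)
  then obtain u where "q = [:u:]" by (elim degree_eq_zeroE)
  then show thesis using that[of v u] pCons \<open>q \<noteq> 0\<close> by simp
qed

lemma analytically_trivial_of_normal_forms:
  assumes "\<And>t. t \<in> {0..1} \<Longrightarrow> analytically_equivalent (f t) (g t)"
    and "\<And>s t. s \<in> {0..1} \<Longrightarrow> t \<in> {0..1} \<Longrightarrow> analytically_equivalent (g s) (g t)"
  shows "analytically_trivial f"
  unfolding analytically_trivial_def
proof (intro ballI)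
  fix s t :: real assume st: "s \<in> {0..1}" "t \<in> {0..1}"
  show "analytically_equivalent (f s) (f t)"
    by (rule analytically_equivalent_trans[OF assms(1)[OF st(1)]
          analytically_equivalent_trans[OF assms(2)[OF st] analytically_equivalent_sym[OF assms(1)[OF st(2)]]]])
qed

text \<open>
  If the degree $N$ of $R_t$ is at most one, the germs are smooth or Morse and the polynomials are
  equivalent by an affine substitution. Otherwise $R_t$ is replaced by the continuous centred
  representative $P_t$, and rigidity shows that the classes of its homogenization are open in the
  interval.
\<close>

lemma analytically_trivial_of_lt:
  fixes f :: "real \<Rightarrow> complex \<times> complex \<Rightarrow> complex"
  assumes lt: "a < b"
    and cont: "continuous_germ_family f"
    and qh: "\<And>t. t \<in> {0..1} \<Longrightarrow> quasi_homogeneous_germ a b d (f t)"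
    and iso: "\<And>t. t \<in> {0..1} \<Longrightarrow> isolated_singularity (f t)"
    and mini: "\<And>t. t \<in> {0..1} \<Longrightarrow> miniregular (f t)"
    and hp: "\<And>s t. s \<in> {0..1} \<Longrightarrow> t \<in> {0..1} \<Longrightarrow>
           same_hp_invariant (henry_parusinski (f s)) (henry_parusinski (f t))"
  shows "analytically_trivial f"
proof -
  have "\<exists>R. weighted a b d R \<and> analytically_equivalent (f t) (homogenization a b d R) \<and> 0 < a"
    if "t \<in> {0..1}" for t
    using qh[OF that] unfolding quasi_homogeneous_germ_def by (metis quasi_homogeneous_polyE)
  then obtain R where w: "\<And>t. t \<in> {0..1} \<Longrightarrow> weighted a b d (R t)"
    and eq: "\<And>t. t \<in> {0..1} \<Longrightarrow> analytically_equivalent (f t) (homogenization a b d (R t))"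
    and a0: "\<And>t::real. t \<in> {0..1} \<Longrightarrow> 0 < a" by metis
  have ab: "0 < a" "a < b" using a0[of 0] lt by auto
  have isoP: "isolated_singularity (homogenization a b d (R t))" if "t \<in> {0..1}" for t
    by (rule isolated_singularity_analytically_equivalent[OF iso[OF that] eq[OF that]])
  define N where "N = d div b"
  have dR: "degree (R t) = N" if "t \<in> {0..1}" for t
    using degree_homogenization[OF isoP[OF that] w[OF that] ab] by (simp add: N_def)
  have dpos: "0 < d" using isolated_homogenization(2)[OF isoP[of 0] w[of 0] ab] by simp
  have R0: "R t \<noteq> 0" if "t \<in> {0..1}" for t using isolated_homogenization(1)[OF isoP[OF that] w[OF that] ab] .
  show ?thesis
  proof (cases "2 \<le> N")
    case False
    have "analytically_equivalent (homogenization a b d (R s)) (homogenization a b d (R t))"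
      if s: "s \<in> {0..1}" and t: "t \<in> {0..1}" for s t
    proof (cases "N = 0")
      case True
      obtain u v where uv: "R s = [:u:]" "R t = [:v:]" using dR[OF s] dR[OF t] True by (metis degree_eq_zeroE)
      then have "u \<noteq> 0" "v \<noteq> 0" using R0[OF s] R0[OF t] by auto
      then show ?thesis
        by (intro analytically_equivalent_homogenization[OF w[OF s] w[OF t], of "v / u" 1 0])
           (use ab dpos uv in auto)
    next
      case N0: False
      then have N1: "N = 1" using False by simp
      obtain u u' where u: "R s = [:u', u:]" "u \<noteq> 0"
        using dR[OF s] N1 by (metis degree_eq_1E)
      obtain v v' where v: "R t = [:v', v:]" "v \<noteq> 0"
        using dR[OF t] N1 by (metis degree_eq_1E)
      have dv: "a dvd b" if "(v' - u') / u \<noteq> 0"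
      proof -
        have 1: "b * 1 \<le> d \<and> a dvd (d - b * 1)" using w[OF s] u unfolding weighted_def by (auto dest: spec[of _ 1])
        have "u' \<noteq> 0 \<or> v' \<noteq> 0" using that by auto
        then have "a dvd (d - b * 0)" using w[OF s] w[OF t] u v unfolding weighted_def by (auto dest: spec[of _ 0])
        then show ?thesis using 1 by (metis dvd_diffD1 diff_diff_cancel diff_zero dvd_diff_nat mult.right_neutral mult_zero_right)
      qed
      show ?thesis
      proof (rule analytically_equivalent_homogenization[OF w[OF s] w[OF t], of 1 "v / u" "(v' - u') / u"])
        show "poly (R t) y = 1 * poly (R s) (v / u * y + (v' - u') / u)" for y
          using u(2) by (simp add: u(1) v(1) field_simps)
      qed (use ab dpos u(2) v(2) dv in auto)
    qed
    then show ?thesis using eq by (intro analytically_trivial_of_normal_forms)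
  next
    case N2: True
    define i where "i = (d - b * N) div a"
    let ?S = "{0..1::real}"
    have "\<exists>e p Q. weighted a b d Q \<and> degree Q = N \<and> analytically_equivalent (f t) (homogenization a b d Q) \<and>
        henry_parusinski (f t) = (\<lambda>\<kappa>. (of_nat d / of_nat a, poly Q \<kappa>)) ` {\<kappa>. poly (pderiv Q) \<kappa> = 0} \<and>
        weighted_expansion a b d (f t) e p Q" if "t \<in> ?S" for t
      using normal_form_exists[OF ab w[OF that] eq[OF that] iso[OF that] mini[OF that]] N2 dR[OF that] by simp
    then obtain e p Q where wQ: "\<And>t. t \<in> ?S \<Longrightarrow> weighted a b d (Q t)" and dQ: "\<And>t. t \<in> ?S \<Longrightarrow> degree (Q t) = N"
      and eQ: "\<And>t. t \<in> ?S \<Longrightarrow> analytically_equivalent (f t) (homogenization a b d (Q t))"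
      and hQ: "\<And>t. t \<in> ?S \<Longrightarrow> henry_parusinski (f t) = (\<lambda>\<kappa>. (of_nat d / of_nat a, poly (Q t) \<kappa>)) ` {\<kappa>. poly (pderiv (Q t)) \<kappa> = 0}"
      and ex: "\<And>t. t \<in> ?S \<Longrightarrow> weighted_expansion a b d (f t) (e t) (p t) (Q t)" by metis
    note ex' = ex[unfolded weighted_expansion_def]
    have e0: "e t 0 = 0" if "t \<in> ?S" for t using ex'[OF that] by blast
    have dp: "degree (p t j) = (if j = 1 then i else 0) + N"
      and dbl: "poly (p t j) z = 0 \<and> poly (pderiv (p t j)) z = 0 \<longleftrightarrow> z = e t j"
      and lp: "((\<lambda>s. f t (s, (\<Sum>i<j. e t i * s ^ i) + s ^ j * y) / s ^ (i + j * N)) \<longlongrightarrow> poly (p t j) y) (at 0)"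
      if "t \<in> ?S" "0 < j" "a * j < b" for t j z y
      using ex'[OF that(1)] that(2,3) unfolding i_def dQ[OF that(1)] by blast+
    have lQ: "((\<lambda>s. f t (s ^ a, (\<Sum>i\<le>(b - 1) div a. e t i * (s ^ a) ^ i) + s ^ b * y) / s ^ d) \<longlongrightarrow> poly (Q t) y) (at 0)"
      if "t \<in> ?S" for t y using ex'[OF that] by blast
    obtain U where U: "open U" "0 \<in> U" "\<And>t. t \<in> ?S \<Longrightarrow> holomorphic2_on (f t) U" "continuous_on (?S \<times> U) (\<lambda>(t, z). f t z)"
      using cont unfolding continuous_germ_family_def by blast
    have ec: "continuous_on ?S (\<lambda>t. e t j)" if "a * j < b" for j
      using that
    proof (induction j rule: less_induct)
      case (less j)
      show ?case
      proof (cases "j = 0")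
        case True
        show ?thesis by (rule continuous_on_eq[OF continuous_on_const[of _ 0]]) (use True e0 in simp)
      next
        case False
        then have j: "0 < j" by simp
        have prev: "continuous_on ?S (\<lambda>t. e t l)" if "l \<in> {..<j}" for l
        proof -
          have "a * l \<le> a * j" using that by simp
          then have "a * l < b" using less.prems by linarith
          then show ?thesis using less.IH[of l] that by simp
        qed
        have pt: "continuous_on ?S (\<lambda>t. poly (p t j) y)" for y
          by (rule continuous_on_leading_limit[OF compact_Icc U, where c = "\<lambda>i t. e t i" and I = "{..<j}" and p = 1 and q = j and y = y and D = "i + j * N"])
             (use prev e0 j lp[OF _ j less.prems] in auto)
        show ?thesis
        proof (rule continuous_on_double_root[where P = "\<lambda>t. p t j" and D = "(if j = 1 then i else 0) + N"])
          show "continuous_on ?S (\<lambda>t. coeff (p t j) k)" for k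
            by (rule continuous_on_coefficients[OF _ pt]) (use dp[OF _ j less.prems] in auto)
        qed (use dp[OF _ j less.prems] dbl[OF _ j less.prems] N2 in auto)
      qed
    qed
    have Qpt: "continuous_on ?S (\<lambda>t. poly (Q t) y)" for y
    proof (rule continuous_on_leading_limit[OF compact_Icc U, where c = "\<lambda>i t. e t i" and I = "{..(b - 1) div a}" and p = a and q = b and y = y and D = d])
      fix l assume "l \<in> {..(b - 1) div a}"
      then have "a * l \<le> b - 1" using ab(1) by (simp add: less_eq_div_iff_mult_less_eq mult.commute)
      then show "continuous_on ?S (\<lambda>t. e t l)" using ab by (intro ec) auto
    qed (use e0 ab lQ in auto)
    have Qc: "continuous_on ?S (\<lambda>t. coeff (Q t) k)" for k
      by (rule continuous_on_coefficients[OF _ Qpt]) (use dQ in auto)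
    have lead: "coeff (Q t) N \<noteq> 0" if "t \<in> ?S" for t using dQ[OF that] N2 by (metis leading_coeff_0_iff degree_0 not_numeral_le_zero)
    \<comment> \<open>Centring: nonzero only if $a$ divides $b$, because otherwise the monomials of degree $N$ and $N - 1$ cannot both occur.\<close>
    define g where "g t = - coeff (Q t) (N - 1) / (of_nat N * coeff (Q t) N)" for t
    have gc: "continuous_on ?S g" unfolding g_def using lead N2 by (intro continuous_intros Qc) auto
    define P where "P t = smult 1 (Q t \<circ>\<^sub>p [:g t, 1:])" for t
    have gd: "a dvd b" if "g t \<noteq> 0" "t \<in> ?S" for t
    proof -
      have "coeff (Q t) (N - 1) \<noteq> 0" using that by (auto simp: g_def)
      then have 1: "b * (N - 1) \<le> d" "a dvd d - b * (N - 1)" using wQ[OF that(2)] unfolding weighted_def by auto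
      have 2: "b * N \<le> d" "a dvd d - b * N" using wQ[OF that(2)] lead[OF that(2)] unfolding weighted_def by auto
      have "b * N = b * (N - 1) + b" using N2 by (cases N) auto
      then have "d - b * (N - 1) = (d - b * N) + b" using 2(1) by linarith
      then show ?thesis using 1(2) 2(2) dvd_add_right_iff by metis
    qed
    have wP: "weighted a b d (P t)" if "t \<in> ?S" for t
      unfolding P_def by (rule weighted_affine[OF wQ[OF that]]) (use gd that in auto)
    have dP: "degree (P t) = N" if "t \<in> ?S" for t using dQ[OF that] by (simp add: P_def degree_pcompose)
    have eP: "analytically_equivalent (f t) (homogenization a b d (P t))" if "t \<in> ?S" for t
    proof -
      have "analytically_equivalent (homogenization a b d (Q t)) (homogenization a b d (P t))"
        by (rule analytically_equivalent_homogenization[OF wQ[OF that] wP[OF that] _ _ dpos, of 1 1 "g t"])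
           (use ab gd[OF _ that] in \<open>auto simp: P_def poly_pcompose add.commute\<close>)
      then show ?thesis by (rule analytically_equivalent_trans[OF eQ[OF that]])
    qed
    have Pcv: "poly (P t) ` {\<kappa>. poly (pderiv (P t)) \<kappa> = 0} = poly (Q t) ` {\<kappa>. poly (pderiv (Q t)) \<kappa> = 0}" for t
      unfolding P_def by (subst critical_values_affine) auto
    have Pcent: "coeff (P t) (N - 1) = 0" if "t \<in> ?S" for t
    proof -
      have "coeff (P t) (N - 1) = coeff (Q t) (N - 1) + of_nat N * g t * coeff (Q t) N"
        using coeff_translate[OF dQ[OF that], of "g t"] N2 by (simp add: P_def)
      also have "\<dots> = 0" using lead[OF that] N2 by (simp add: g_def)
      finally show ?thesis .
    qed
    have Pc: "continuous_on ?S (\<lambda>t. coeff (P t) k)" for k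
    proof (rule continuous_on_coefficients)
      show "degree (P t) \<le> N" if "t \<in> ?S" for t using dP[OF that] by simp
      fix y
      have "continuous_on ?S (\<lambda>t. \<Sum>k\<le>N. coeff (Q t) k * (g t + y) ^ k)" by (intro continuous_intros Qc gc)
      then show "continuous_on ?S (\<lambda>t. poly (P t) y)"
      proof (rule continuous_on_eq)
        fix t assume "t \<in> ?S"
        then show "(\<Sum>k\<le>N. coeff (Q t) k * (g t + y) ^ k) = poly (P t) y"
          using dQ poly_altdef[of "Q t" "g t + y"] by (simp add: P_def poly_pcompose)
      qed
    qed
    have Pne: "0 \<notin> poly (P t) ` {\<kappa>. poly (pderiv (P t)) \<kappa> = 0}" if "t \<in> ?S" for t
      using isolated_homogenization(3)[OF isolated_singularity_analytically_equivalent[OF iso[OF that] eP[OF that]] wP[OF that] ab]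
      by auto
    have cv: "\<exists>\<xi>. \<xi> \<noteq> 0 \<and> poly (P t) ` {\<kappa>. poly (pderiv (P t)) \<kappa> = 0} = (\<lambda>c. \<xi> * c) ` poly (P s) ` {\<kappa>. poly (pderiv (P s)) \<kappa> = 0}"
      if s: "s \<in> ?S" and t: "t \<in> ?S" for s t
    proof -
      obtain w where w: "henry_parusinski (f t) = (\<lambda>(h, c). (h, c * exp (of_rat h * w))) ` henry_parusinski (f s)"
        using hp[OF s t] unfolding same_hp_invariant_def by blast
      define \<xi> where "\<xi> = exp (of_rat (of_nat d / of_nat a) * w)"
      have "snd ` henry_parusinski (f t) = (\<lambda>c. \<xi> * c) ` snd ` henry_parusinski (f s)"
        unfolding w hQ[OF s] by (simp add: image_image \<xi>_def mult.commute)
      then have "poly (Q t) ` {\<kappa>. poly (pderiv (Q t)) \<kappa> = 0} = (\<lambda>c. \<xi> * c) ` poly (Q s) ` {\<kappa>. poly (pderiv (Q s)) \<kappa> = 0}"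
        unfolding hQ[OF s] hQ[OF t] by (simp add: image_image)
      moreover have "\<xi> \<noteq> 0" by (simp add: \<xi>_def)
      ultimately show ?thesis unfolding Pcv by blast
    qed
    define rel where "rel s t \<longleftrightarrow> analytically_equivalent (homogenization a b d (P s)) (homogenization a b d (P t))" for s t
    have near: "\<exists>\<delta>>0. \<forall>t\<in>?S. dist t t0 < \<delta> \<longrightarrow> rel t0 t" if t0: "t0 \<in> ?S" for t0
    proof (rule ccontr)
      assume "\<not> ?thesis"
      then have "\<forall>n. \<exists>t\<in>?S. dist t t0 < inverse (of_nat (Suc n)) \<and> \<not> rel t0 t" by (metis inverse_positive_iff_positive of_nat_0_less_iff zero_less_Suc)
      then obtain \<tau> where \<tau>: "\<And>n. \<tau> n \<in> ?S" "\<And>n. dist (\<tau> n) t0 < inverse (of_nat (Suc n))" "\<And>n. \<not> rel t0 (\<tau> n)" by metis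
      have "\<tau> \<longlonglongrightarrow> t0"
      proof (rule metric_LIMSEQ_I)
        fix r :: real assume "0 < r"
        then obtain n0 where n0: "inverse (of_nat (Suc n0)) < r" using reals_Archimedean by blast
        have "dist (\<tau> n) t0 < r" if "n \<ge> n0" for n
        proof -
          have "inverse (real (Suc n)) \<le> inverse (real (Suc n0))" using that by (intro le_imp_inverse_le) auto
          then show ?thesis using \<tau>(2)[of n] n0 by linarith
        qed
        then show "\<exists>no. \<forall>n\<ge>no. dist (\<tau> n) t0 < r" by blast
      qed
      then have conv: "(\<lambda>n. coeff (P (\<tau> n)) k) \<longlonglongrightarrow> coeff (P t0) k" for k
        using Pc[of k] \<tau>(1) t0 unfolding continuous_on_sequentially by (auto simp: o_def)
      have "\<forall>n. \<exists>\<xi>. \<xi> \<noteq> 0 \<and> poly (P (\<tau> n)) ` {\<kappa>. poly (pderiv (P (\<tau> n))) \<kappa> = 0} = (\<lambda>c. \<xi> * c) ` poly (P t0) ` {\<kappa>. poly (pderiv (P t0)) \<kappa> = 0}"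
        using cv[OF t0 \<tau>(1)] by blast
      then obtain \<xi> where \<xi>: "\<And>n. \<xi> n \<noteq> 0"
        "\<And>n. poly (P (\<tau> n)) ` {\<kappa>. poly (pderiv (P (\<tau> n))) \<kappa> = 0} = (\<lambda>c. \<xi> n * c) ` poly (P t0) ` {\<kappa>. poly (pderiv (P t0)) \<kappa> = 0}"
        by metis
      have "\<exists>n \<zeta> \<eta>. \<zeta> \<noteq> 0 \<and> \<eta> \<noteq> 0 \<and> (\<forall>y. poly (P t0) y = \<zeta> * poly (P (\<tau> n)) (\<eta> * y))"
        by (rule same_critical_values_imp_orbit[OF N2 dP[OF t0] dP[OF \<tau>(1)] Pcent[OF \<tau>(1)] Pcent[OF t0] conv refl Pne[OF t0] \<xi>])
      then obtain n \<zeta> \<eta> where n: "\<zeta> \<noteq> 0" "\<eta> \<noteq> 0" "\<And>y. poly (P t0) y = \<zeta> * poly (P (\<tau> n)) (\<eta> * y)" by blast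
      have "analytically_equivalent (homogenization a b d (P (\<tau> n))) (homogenization a b d (P t0))"
        by (rule analytically_equivalent_homogenization[OF wP[OF \<tau>(1)] wP[OF t0] _ _ dpos, of \<zeta> n \<eta> 0])
           (use ab n in auto)
      then show False using \<tau>(3)[of n] analytically_equivalent_sym unfolding rel_def by blast
    qed
    have "rel s t" if st: "s \<in> ?S" "t \<in> ?S" for s t
    proof (rule connected_equivalence_relation[of ?S s t rel])
      fix t0 assume t0: "t0 \<in> ?S"
      obtain \<delta> where \<delta>: "\<delta> > 0" "\<forall>t\<in>?S. dist t t0 < \<delta> \<longrightarrow> rel t0 t" using near[OF t0] by blast
      show "\<exists>T. openin (top_of_set ?S) T \<and> t0 \<in> T \<and> (\<forall>x\<in>T. rel t0 x)"
        using \<delta> t0 by (intro exI[of _ "?S \<inter> ball t0 \<delta>"]) (auto simp: openin_open_Int dist_commute)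
    next
      show "rel y x" if "rel x y" for x y
        using that unfolding rel_def by (rule analytically_equivalent_sym)
      show "rel x z" if "rel x y" "rel y z" for x y z
        using that unfolding rel_def by (rule analytically_equivalent_trans)
    qed (use st in auto)
    then show ?thesis unfolding rel_def using eP by (intro analytically_trivial_of_normal_forms)
  qed
qed

lemma quasi_homogeneous_germ_swap:
  assumes "quasi_homogeneous_germ a b d f" shows "quasi_homogeneous_germ b a d f"
proof -
  obtain P where P: "quasi_homogeneous_poly a b d P" "analytically_equivalent f P"
    using assms unfolding quasi_homogeneous_germ_def by blast
  obtain c where ab: "0 < a" "0 < b"
    and c: "\<And>x y. P (x, y) = (\<Sum>(i, j)\<in>{(i, j). a * i + b * j = d}. c i j * x ^ i * y ^ j)"
    using P(1) unfolding quasi_homogeneous_poly_def by blast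
  let ?P = "\<lambda>z. P (snd z, fst z)"
  have "?P (x, y) = (\<Sum>(i, j)\<in>{(i, j). b * i + a * j = d}. c j i * x ^ i * y ^ j)" for x y
    unfolding fst_conv snd_conv c
    by (rule sum.reindex_bij_witness[of _ "\<lambda>(i, j). (j, i)" "\<lambda>(i, j). (j, i)"]) (auto simp: add.commute mult_ac)
  then have "quasi_homogeneous_poly b a d ?P"
    unfolding quasi_homogeneous_poly_def using ab by (intro conjI exI[of _ "\<lambda>i j. c j i"]) auto
  moreover have "analytically_equivalent f ?P"
    using analytically_equivalent_trans[OF P(2) analytically_equivalent_swap] .
  ultimately show ?thesis unfolding quasi_homogeneous_germ_def by blast
qed

theorem theorem4p5:
  fixes f :: "real \<Rightarrow> complex \<times> complex \<Rightarrow> complex"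
    and a b d :: nat
  assumes "a \<noteq> b"
    and "continuous_germ_family f"
    and "\<And>t. t \<in> {0..1} \<Longrightarrow> quasi_homogeneous_germ a b d (f t)"
    and "\<And>t. t \<in> {0..1} \<Longrightarrow> isolated_singularity (f t)"
    and "\<And>t. t \<in> {0..1} \<Longrightarrow> miniregular (f t)"
    and "\<And>s t. s \<in> {0..1} \<Longrightarrow> t \<in> {0..1} \<Longrightarrow>
           same_hp_invariant (henry_parusinski (f s)) (henry_parusinski (f t))"
  shows "analytically_trivial f"
proof (cases "a < b")
  case True
  show ?thesis by (rule analytically_trivial_of_lt[OF True assms(2-6)])
next
  case False
  then have "b < a" using assms(1) by simp
  then show ?thesis
    by (rule analytically_trivial_of_lt[OF _ assms(2) quasi_homogeneous_germ_swap[OF assms(3)] assms(4-6)])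
qed

end
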